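(* The following functions are orbitally unstable under the cubic Szegő flow: (a) $\varphi(z)=\alpha\prod_{j=1}^N\frac{z-\bar p_j}{1-p_jz}$ with $\alpha\in\mathbb C\setminus\{0\}$, $N\ge1$, $0\le|p_j|<1$; (b) $\varphi(z)=\alpha\frac{z^\ell}{1-p^Nz^N}$ with $\alpha\ne0$, $N\ge2$, $0\le\ell\le N-1$, $0<|p|<1$. Here orbital instability of $\varphi$ means: there exist $\varepsilon_0>0$ and a sequence $u_0^{(n)}\in H^{1/2}_+$ with $\|u_0^{(n)}-\varphi\|_{H^{1/2}}\to0$ such that the solutions $u^{(n)}$ of $i\partial_tu=\Pi(|u|^2u)$, $u^{(n)}(0)=u_0^{(n)}$, satisfy $\sup_{t\in\mathbb R}\inf_{(a,b)\in\mathbb T^2}\|u^{(n)}(t)-\varphi_{a,b}\|_{H^{1/2}}\ge\varepsilon_0$ for all $n$, where $\varphi_{a,b}(z)=e^{ia}\varphi(e^{ib}z)$.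
   Context: $L^2_+$ is the Hardy space of the circle (functions $\sum_{k\ge0}\hat u(k)e^{ik\theta}$ in $L^2$, identified with holomorphic functions on the unit disc), $H^{1/2}_+=H^{1/2}\cap L^2_+$, $\Pi$ the Szegő projector onto $L^2_+$. The cubic Szegő equation $i\partial_tu=\Pi(|u|^2u)$ is globally well-posed on $H^{1/2}_+$. *)

theory Defs
  imports "HOL-Analysis.Analysis"
begin

text \<open>Elements of the Hardy space are represented by their Fourier (= Taylor) coefficients
  u :: nat \<Rightarrow> complex, u k = hat u(k), k \<ge> 0.\<close>

definition h12 :: "(nat \<Rightarrow> complex) \<Rightarrow> bool" where
  "h12 u \<longleftrightarrow> summable (\<lambda>k. (1 + real k) * (cmod (u k))\<^sup>2)"

definition h12_norm :: "(nat \<Rightarrow> complex) \<Rightarrow> real" where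
  "h12_norm u = sqrt (\<Sum>k. (1 + real k) * (cmod (u k))\<^sup>2)"

definition h12_dist :: "(nat \<Rightarrow> complex) \<Rightarrow> (nat \<Rightarrow> complex) \<Rightarrow> real" where
  "h12_dist u v = h12_norm (\<lambda>k. u k - v k)"

text \<open>Fourier coefficient n \<ge> 0 of |u|^2 u, i.e. of Pi(|u|^2 u).\<close>
definition szego_nl :: "(nat \<Rightarrow> complex) \<Rightarrow> nat \<Rightarrow> complex" where
  "szego_nl u n = infsum (\<lambda>(a, b, c). u a * cnj (u b) * u c) {(a, b, c). a + c = n + b}"

definition szego_solution :: "(nat \<Rightarrow> complex) \<Rightarrow> (real \<Rightarrow> nat \<Rightarrow> complex) \<Rightarrow> bool" where
  "szego_solution u0 u \<longleftrightarrow>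
     u 0 = u0 \<and> (\<forall>t. h12 (u t)) \<and>
     (\<forall>t. ((\<lambda>s. h12_dist (u s) (u t)) \<longlongrightarrow> 0) (at t)) \<and>
     (\<forall>n t. ((\<lambda>s. u s n) has_vector_derivative (- \<i> * szego_nl (u t) n)) (at t))"

definition taylor_coeff :: "(complex \<Rightarrow> complex) \<Rightarrow> nat \<Rightarrow> complex" where
  "taylor_coeff f k = (deriv ^^ k) f 0 / of_nat (fact k)"

definition rot :: "real \<Rightarrow> real \<Rightarrow> (complex \<Rightarrow> complex) \<Rightarrow> complex \<Rightarrow> complex" where
  "rot a b f = (\<lambda>z. exp (\<i> * of_real a) * f (exp (\<i> * of_real b) * z))"

definition orbitally_unstable :: "(complex \<Rightarrow> complex) \<Rightarrow> bool" where
  "orbitally_unstable \<phi> \<longleftrightarrow>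
    (\<exists>\<epsilon>0>0. \<exists>u0 :: nat \<Rightarrow> nat \<Rightarrow> complex.
       (\<forall>n. h12 (u0 n)) \<and>
       ((\<lambda>n. h12_dist (u0 n) (taylor_coeff \<phi>)) \<longlonglongrightarrow> 0) \<and>
       (\<forall>n. (\<exists>u. szego_solution (u0 n) u) \<and>
            (\<forall>u. szego_solution (u0 n) u \<longrightarrow>
               (SUP t. INF ab. ereal (h12_dist (u t) (taylor_coeff (rot (fst ab) (snd ab) \<phi>))))
                 \<ge> ereal \<epsilon>0)))"

end

theory Submission
  imports Defs "HOL-Complex_Analysis.Complex_Analysis" "HOL-Real_Asymp.Real_Asymp"
begin

text \<open>
  Let \<open>X\<^sub>1, X\<^sub>2, \<Psi>\<close> be inner functions with \<open>X\<^sub>1(0) = X\<^sub>2(0) = 0\<close> and let \<open>|a\<^sub>1| > |b\<^sub>1| > |a\<^sub>2| > |b\<^sub>2|\<close>. Following the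
  inverse spectral formula of Gerard and Grellier, put \<open>\<psi>\<^sub>1 = 1\<close>, \<open>\<psi>\<^sub>2 = \<Psi>\<close> and
  \<open>c\<^sub>k\<^sub>j = (a\<^sub>j - b\<^sub>k X\<^sub>k \<psi>\<^sub>j) / (|a\<^sub>j|\<^sup>2 - |b\<^sub>k|\<^sup>2)\<close>, solve \<open>c \<xi> = (1, 1)\<close> and let \<open>u = \<xi>\<^sub>1 + \<Psi> \<xi>\<^sub>2\<close>. If
  \<open>a\<^sub>j\<close> and \<open>b\<^sub>k\<close> rotate with angular velocities \<open>|a\<^sub>j|\<^sup>2\<close> and \<open>|b\<^sub>k|\<^sup>2\<close>, then \<open>u\<close> solves the cubic Szego equation: on the
  unit circle \<open>|u|\<^sup>2 u = F + cnj G\<close> with \<open>F, G\<close> holomorphic, \<open>G(0) = 0\<close> and \<open>F = i \<partial>\<^sub>t u\<close>.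

  The functions of the theorem are limits of such data in which two of the moduli merge. The relative phase
  of the two nearly equal parameters then drifts slowly but through all angles, and a low Fourier coefficient
  of the solution moves by a fixed amount away from its modulus on the orbit of the limit.

  Uniqueness of solutions in \<open>H\<^sup>1\<^sup>/\<^sup>2\<close> transfers this to every solution; it follows from an energy estimate for the
  difference in \<open>l\<^sup>2\<close> with a logarithmic loss.
\<close>

section \<open>Quadrilinear estimates and uniqueness\<close>

text \<open>Uniqueness is needed because instability is demanded of every solution with the given
  data. It is delicate because H^{1/2} of the circle does not embed in the bounded functions, so a
  plain Gronwall estimate for the difference does not close. Rotations multiply each Fourier
  coefficient by a unimodular number. One coefficient whose modulus has moved is therefore far from
  the whole orbit at once, and the infimum over the torus never has to be located. Two ways of
  merging are required. Merging \<open>a1\<close> and \<open>a2\<close> lifts the mean value to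
  nearly \<Lambda> - |b2|^2 / \<Lambda>, where \<Lambda> is the common limit of the moduli. This
  exceeds |\<phi>(0)| for nonconstant Blaschke products and for z^l / (1 - q z^N) with l >= 1. For l
  = 0 the number |\<phi>(0)| = |\<alpha>| already equals that bound. There \<open>b1\<close> and
  \<open>b2\<close> are merged instead, and the coefficient of z, which is zero on the orbit because
  N >= 2, becomes large.\<close>

lemma sum_inverse_sqrt_le: "(\<Sum>k\<le>n. 1 / sqrt (1 + real k)) \<le> 2 * sqrt (1 + real n)"
proof (induction n)
  case (Suc n)
  have "1 / sqrt (2 + real n) \<le> 2 * (sqrt (2 + real n) - sqrt (1 + real n))"
  proof -
    have "(sqrt (2 + real n) - sqrt (1 + real n)) * (sqrt (2 + real n) + sqrt (1 + real n)) = 1"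
      by (simp add: algebra_simps)
    moreover have "sqrt (1 + real n) \<le> sqrt (2 + real n)"
      by simp
    ultimately have "1 \<le> (sqrt (2 + real n) - sqrt (1 + real n)) * (2 * sqrt (2 + real n))"
      by (smt (verit, best) mult_left_mono)
    then show ?thesis
      by (simp add: field_simps add_pos_nonneg)
  qed
  with Suc show ?case by simp
qed simp

text \<open>A discrete Beta integral B(1/2, 1/2), which is why the bound does not grow with n. Since
  sqrt x + sqrt y >= sqrt (x + y), and x + y is constant on the antidiagonal, the product splits
  into two single sums at the price of the factor \<open>s\<close>.\<close>

lemma sum_antidiagonal_inverse_sqrt_le:
  "(\<Sum>b\<le>n. 1 / (sqrt (1 + real b) * sqrt (1 + real (n - b)))) \<le> 6"
proof -
  define s where "s = sqrt (2 / (2 + real n))"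
  have trm: "1 / (sqrt (1 + real b) * sqrt (1 + real (n - b)))
       \<le> s * (1 / sqrt (1 + real b) + 1 / sqrt (1 + real (n - b)))" if "b \<le> n" for b
  proof -
    define x y where "x = 1 + real b" and "y = 1 + real (n - b)"
    have xy: "x + y = 2 + real n" "x \<ge> 1" "y \<ge> 1"
      using that by (auto simp: x_def y_def)
    have "1 \<le> s * (sqrt x + sqrt y)"
    proof -
      have "2 + real n \<le> (sqrt x + sqrt y)\<^sup>2"
        using xy by (simp add: power2_sum)
      then have "sqrt (2 + real n) \<le> sqrt x + sqrt y"
        using xy by (intro real_le_lsqrt) auto
      moreover have "1 \<le> s * sqrt (2 + real n)"
        by (simp add: s_def real_sqrt_divide)
      ultimately show ?thesis
        by (smt (verit) mult_left_mono real_sqrt_ge_0_iff s_def zero_le_divide_iff of_nat_0_le_iff)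
    qed
    then have "1 / (sqrt x * sqrt y) \<le> s * (sqrt x + sqrt y) / (sqrt x * sqrt y)"
      using xy by (intro divide_right_mono) auto
    also have "\<dots> = s * (1 / sqrt x + 1 / sqrt y)"
      using xy by (simp add: field_simps)
    finally show ?thesis by (simp add: x_def y_def)
  qed
  have rev: "(\<Sum>b\<le>n. 1 / sqrt (1 + real (n - b))) = (\<Sum>b\<le>n. 1 / sqrt (1 + real b))"
    by (rule sum.reindex_bij_witness[of _ "\<lambda>b. n - b" "\<lambda>b. n - b"]) auto
  have "(\<Sum>b\<le>n. 1 / (sqrt (1 + real b) * sqrt (1 + real (n - b))))
      \<le> (\<Sum>b\<le>n. s * (1 / sqrt (1 + real b) + 1 / sqrt (1 + real (n - b))))"
    by (intro sum_mono trm) auto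
  also have "\<dots> = s * (2 * (\<Sum>b\<le>n. 1 / sqrt (1 + real b)))"
    by (simp only: sum_distrib_left[symmetric] sum.distrib rev mult_2)
  also have "\<dots> \<le> s * (4 * sqrt (1 + real n))"
    using sum_inverse_sqrt_le[of n] by (intro mult_left_mono) (auto simp: s_def)
  also have "\<dots> = 4 * sqrt (2 * (1 + real n) / (2 + real n))"
    by (simp add: s_def real_sqrt_mult[symmetric])
  also have "\<dots> \<le> 4 * sqrt (3/2 * (3/2))"
    by (intro mult_left_mono real_sqrt_le_mono) (auto simp: field_simps)
  also have "\<dots> = 6" by (simp only: real_sqrt_abs2)
  finally show ?thesis .
qed

section \<open>The resonant quadrilinear form\<close>

text \<open>The frequencies that survive when x cnj(y) z cnj(w) is averaged over the circle:
  \<open>a\<close>, \<open>c\<close> belong to the unconjugated factors and \<open>b\<close>,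
  \<open>d\<close> to the conjugated ones. The cut-off M keeps every sum finite.\<close>

definition quads :: "nat \<Rightarrow> ((nat \<times> nat) \<times> (nat \<times> nat)) set" where
  "quads M = {((a, c), (b, d)). a \<le> M \<and> c \<le> M \<and> b \<le> M \<and> d \<le> M \<and> a + c = b + d}"

lemma finite_quads [simp, intro]: "finite (quads M)"
  by (rule finite_subset[of _ "({..M} \<times> {..M}) \<times> ({..M} \<times> {..M})"]) (auto simp: quads_def)

text \<open>The squared H^{1/4} norm of a truncated sequence; \<open>wsum\<close> below is the
  squared H^{1/2} norm.\<close>

definition qnorm :: "nat \<Rightarrow> (nat \<Rightarrow> real) \<Rightarrow> real" where
  "qnorm M x = (\<Sum>k\<le>M. sqrt (1 + real k) * (x k)\<^sup>2)"

lemma qnorm_nonneg [simp]: "0 \<le> qnorm M x"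
  by (simp add: qnorm_def sum_nonneg)

abbreviation wsum :: "nat \<Rightarrow> (nat \<Rightarrow> real) \<Rightarrow> real" where
  "wsum M x \<equiv> (\<Sum>k\<le>M. (1 + real k) * (x k)\<^sup>2)"

lemma qnorm_le: "qnorm M x \<le> wsum M x"
  unfolding qnorm_def
proof (rule sum_mono)
  fix k
  have "sqrt (1 + real k) \<le> 1 + real k"
    by (rule real_le_lsqrt) (auto simp: power2_eq_square algebra_simps)
  then show "sqrt (1 + real k) * (x k)\<^sup>2 \<le> (1 + real k) * (x k)\<^sup>2"
    by (rule mult_right_mono) simp
qed

definition quad_weight :: "nat \<Rightarrow> (nat \<Rightarrow> real) \<Rightarrow> (nat \<Rightarrow> real) \<Rightarrow> real" where
  "quad_weight M x z = (\<Sum>((a,c),(b,d))\<in>quads M. (x a)\<^sup>2 * (z c)\<^sup>2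
     * (sqrt (1 + real a) * sqrt (1 + real c)) / (sqrt (1 + real b) * sqrt (1 + real d)))"

lemma sum_quads_weighted_le:
  "quad_weight M x z \<le> 6 * (qnorm M x * qnorm M z)"
proof -
  define P where "P n = {(b, d). b \<le> M \<and> d \<le> M \<and> b + d = (n::nat)}" for n
  have fin: "finite (P n)" for n
    by (rule finite_subset[of _ "{..M} \<times> {..M}"]) (auto simp: P_def)
  have quads: "quads M = Sigma ({..M} \<times> {..M}) (\<lambda>(a, c). P (a + c))"
    by (auto simp: quads_def P_def)
  have inner: "(\<Sum>(b,d)\<in>P n. 1 / (sqrt (1 + real b) * sqrt (1 + real d))) \<le> 6" for n
  proof -
    have "(\<Sum>(b,d)\<in>P n. 1 / (sqrt (1 + real b) * sqrt (1 + real d)))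
        = (\<Sum>b\<in>fst ` P n. 1 / (sqrt (1 + real b) * sqrt (1 + real (n - b))))"
      by (subst sum.reindex) (auto simp: P_def inj_on_def intro!: sum.cong)
    also have "\<dots> \<le> (\<Sum>b\<le>n. 1 / (sqrt (1 + real b) * sqrt (1 + real (n - b))))"
      by (rule sum_mono2) (auto simp: P_def)
    also have "\<dots> \<le> 6" by (rule sum_antidiagonal_inverse_sqrt_le)
    finally show ?thesis .
  qed
  have "quad_weight M x z
     = (\<Sum>(a,c)\<in>{..M} \<times> {..M}. (sqrt (1 + real a) * (x a)\<^sup>2) * (sqrt (1 + real c) * (z c)\<^sup>2) *
         (\<Sum>(b,d)\<in>P (a+c). 1 / (sqrt (1 + real b) * sqrt (1 + real d))))"
    unfolding quad_weight_def quads
    by (subst sum.Sigma[symmetric])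
       (auto simp: fin sum_distrib_left case_prod_unfold mult_ac intro!: sum.cong)
  also have "\<dots> \<le> (\<Sum>(a,c)\<in>{..M} \<times> {..M}. (sqrt (1 + real a) * (x a)\<^sup>2) * (sqrt (1 + real c) * (z c)\<^sup>2) * 6)"
    by (intro sum_mono) (auto intro!: mult_left_mono inner)
  also have "\<dots> = 6 * (qnorm M x * qnorm M z)"
  proof -
    have "qnorm M x * qnorm M z
        = (\<Sum>(a,c)\<in>{..M} \<times> {..M}. (sqrt (1 + real a) * (x a)\<^sup>2) * (sqrt (1 + real c) * (z c)\<^sup>2))"
      unfolding qnorm_def sum_product sum.cartesian_product ..
    then show ?thesis
      by (simp add: sum_distrib_left case_prod_unfold mult_ac)
  qed
  finally show ?thesis .
qed

abbreviation qsum :: "nat \<Rightarrow> (nat \<Rightarrow> real) \<Rightarrow> (nat \<Rightarrow> real) \<Rightarrow> (nat \<Rightarrow> real) \<Rightarrow> (nat \<Rightarrow> real) \<Rightarrow> real" where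
  "qsum M x z y w \<equiv> (\<Sum>((a,c),(b,d))\<in>quads M. x a * z c * (y b * w d))"

text \<open>The embedding of H^{1/4} into L^4, in terms of coefficients. Cauchy-Schwarz is applied
  with fourth roots \<open>r\<close> of the weights shifted between the pairs (a, c) and (b, d). In
  each of the two squares one pair is then summed along its antidiagonal, which costs the factor
  6.\<close>

lemma sum_quads_le:
  "qsum M x z y w
     \<le> 6 * sqrt (qnorm M x * qnorm M z * (qnorm M y * qnorm M w))"
proof -
  define r where "r k = sqrt (sqrt (1 + real k))" for k
  have r: "r k > 0" "(r k)\<^sup>2 = sqrt (1 + real k)" for k
    by (auto simp: r_def add_pos_nonneg)
  define f g where "f = (\<lambda>((a,c),(b,d)). x a * z c * (r a * r c) / (r b * r d))"
    and "g = (\<lambda>((a,c),(b,d)). y b * w d * (r b * r d) / (r a * r c))"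
  have "qsum M x z y w = (\<Sum>q\<in>quads M. f q * g q)"
    using r(1) by (intro sum.cong refl) (auto simp: f_def g_def divide_simps less_imp_neq[THEN not_sym])
  also have "\<dots> \<le> sqrt ((\<Sum>q\<in>quads M. (f q)\<^sup>2) * (\<Sum>q\<in>quads M. (g q)\<^sup>2))"
    by (intro real_le_rsqrt Cauchy_Schwarz_ineq_sum)
  also have "(\<Sum>q\<in>quads M. (f q)\<^sup>2) = quad_weight M x z"
    unfolding quad_weight_def by (intro sum.cong refl) (auto simp: f_def power_mult_distrib power_divide r)
  also have "(\<Sum>q\<in>quads M. (g q)\<^sup>2) = quad_weight M y w"
    unfolding quad_weight_def
    by (rule sum.reindex_bij_witness[of _ prod.swap prod.swap])
       (auto simp: quads_def g_def power_mult_distrib power_divide r)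
  also have "sqrt (quad_weight M x z
      * quad_weight M y w)
     \<le> sqrt ((6 * (qnorm M x * qnorm M z)) * (6 * (qnorm M y * qnorm M w)))"
    by (intro real_sqrt_le_mono mult_mono sum_quads_weighted_le)
       (auto simp: quad_weight_def intro!: sum_nonneg mult_nonneg_nonneg)
  also have "\<dots> = sqrt (6 * 6 * (qnorm M x * qnorm M z * (qnorm M y * qnorm M w)))"
    by (simp add: mult_ac)
  also have "\<dots> = 6 * sqrt (qnorm M x * qnorm M z * (qnorm M y * qnorm M w))"
    by (simp only: real_sqrt_mult[of "6 * 6"] real_sqrt_mult_self) simp
  finally show ?thesis .
qed

text \<open>Young's inequality, two factors in l^1 and two in l^2. The product of the two values of
  w is at most half the sum of their squares; after that only three indices occur, and they
  determine the fourth by resonance, so that the quadruples inject into a box of triples.\<close>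

lemma sum_quads_l1_le:
  fixes w y z :: "nat \<Rightarrow> real"
  assumes "\<And>k. 0 \<le> y k" "\<And>k. 0 \<le> z k"
  shows "qsum M w z y w
      \<le> (\<Sum>k\<le>M. y k) * (\<Sum>k\<le>M. z k) * (\<Sum>k\<le>M. (w k)\<^sup>2)"
    and "qsum M y z w w
      \<le> (\<Sum>k\<le>M. y k) * (\<Sum>k\<le>M. z k) * (\<Sum>k\<le>M. (w k)\<^sup>2)"
proof -
  let ?R = "(\<Sum>k\<le>M. y k) * (\<Sum>k\<le>M. z k) * (\<Sum>k\<le>M. (w k)\<^sup>2)"
  let ?B = "{..M} \<times> {..M} \<times> {..M}"
  have R: "?R = (\<Sum>(i,j,k)\<in>?B. y i * z j * (w k)\<^sup>2)"
    unfolding sum.cartesian_product[symmetric]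
    by (simp add: sum_distrib_left[symmetric] sum_distrib_right[symmetric])
  have inj: "(\<Sum>q\<in>quads M. case h q of (i,j,k) \<Rightarrow> y i * z j * (w k)\<^sup>2) \<le> ?R"
    if "inj_on h (quads M)" "h ` quads M \<subseteq> ?B" for h
    unfolding R using that assms
    by (subst sum.reindex[OF that(1), symmetric, unfolded o_def])
       (intro sum_mono2, auto)
  have am: "w p * z j * (y i * w q) \<le> (y i * z j * (w p)\<^sup>2 + y i * z j * (w q)\<^sup>2) / 2"
    "y i * z j * (w p * w q) \<le> (y i * z j * (w p)\<^sup>2 + y i * z j * (w q)\<^sup>2) / 2" for p q i j
  proof -
    have "w p * w q \<le> ((w p)\<^sup>2 + (w q)\<^sup>2) / 2"
      using sum_squares_bound[of "w p" "w q"] by (simp add: power2_eq_square)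
    then have "(y i * z j) * (w p * w q) \<le> (y i * z j) * (((w p)\<^sup>2 + (w q)\<^sup>2) / 2)"
      using assms by (intro mult_left_mono mult_nonneg_nonneg)
    then show "w p * z j * (y i * w q) \<le> (y i * z j * (w p)\<^sup>2 + y i * z j * (w q)\<^sup>2) / 2"
      "y i * z j * (w p * w q) \<le> (y i * z j * (w p)\<^sup>2 + y i * z j * (w q)\<^sup>2) / 2"
      by (simp_all add: distrib_left mult_ac)
  qed
  have "qsum M w z y w
      \<le> (\<Sum>((a,c),(b,d))\<in>quads M. (y b * z c * (w a)\<^sup>2 + y b * z c * (w d)\<^sup>2) / 2)"
    by (intro sum_mono) (use am in auto)
  also have "\<dots> = ((\<Sum>q\<in>quads M. case (case q of ((a,c),(b,d)) \<Rightarrow> (b,c,a)) of (i,j,k) \<Rightarrow> y i * z j * (w k)\<^sup>2)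
      + (\<Sum>q\<in>quads M. case (case q of ((a,c),(b,d)) \<Rightarrow> (b,c,d)) of (i,j,k) \<Rightarrow> y i * z j * (w k)\<^sup>2)) / 2"
    by (simp add: sum_divide_distrib[symmetric] sum.distrib case_prod_unfold)
  also have "\<dots> \<le> (?R + ?R) / 2"
    by (intro divide_right_mono add_mono inj) (auto simp: inj_on_def quads_def)
  finally show "qsum M w z y w \<le> ?R" by simp
  have "qsum M y z w w
      \<le> (\<Sum>((a,c),(b,d))\<in>quads M. (y a * z c * (w b)\<^sup>2 + y a * z c * (w d)\<^sup>2) / 2)"
    by (intro sum_mono) (use am in auto)
  also have "\<dots> = ((\<Sum>q\<in>quads M. case (case q of ((a,c),(b,d)) \<Rightarrow> (a,c,b)) of (i,j,k) \<Rightarrow> y i * z j * (w k)\<^sup>2)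
      + (\<Sum>q\<in>quads M. case (case q of ((a,c),(b,d)) \<Rightarrow> (a,c,d)) of (i,j,k) \<Rightarrow> y i * z j * (w k)\<^sup>2)) / 2"
    by (simp add: sum_divide_distrib[symmetric] sum.distrib case_prod_unfold)
  also have "\<dots> \<le> (?R + ?R) / 2"
    by (intro divide_right_mono add_mono inj) (auto simp: inj_on_def quads_def)
  finally show "qsum M y z w w \<le> ?R" by simp
qed

text \<open>H^{1/4} lies halfway between L^2 and H^{1/2}, so Cauchy-Schwarz interpolates.\<close>

lemma qnorm_le_interpolate:
  assumes "\<And>M. wsum M w \<le> R\<^sup>2" "R \<ge> 0" "(\<Sum>k\<le>M. (w k)\<^sup>2) \<le> W"
  shows "qnorm M w \<le> sqrt W * R"
proof -
  have "(qnorm M w)\<^sup>2 = (\<Sum>k\<le>M. w k * (sqrt (1 + real k) * w k))\<^sup>2"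
    unfolding qnorm_def by (simp add: power2_eq_square mult_ac)
  also have "\<dots> \<le> (\<Sum>k\<le>M. (w k)\<^sup>2) * (\<Sum>k\<le>M. (sqrt (1 + real k) * w k)\<^sup>2)"
    by (rule Cauchy_Schwarz_ineq_sum)
  also have "\<dots> = (\<Sum>k\<le>M. (w k)\<^sup>2) * wsum M w"
    by (simp add: power_mult_distrib)
  also have "\<dots> \<le> W * R\<^sup>2"
    by (intro mult_mono assms order_trans[OF sum_nonneg assms(3)] sum_nonneg) auto
  finally have "qnorm M w \<le> sqrt (W * R\<^sup>2)"
    by (rule real_le_rsqrt)
  then show ?thesis using assms by (simp add: real_sqrt_mult)
qed

text \<open>Frequencies below \<open>L\<close> are measured in \<open>l\<^sup>1\<close>, which costs a logarithm of \<open>L\<close>; the remaining ones are small in the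
  weighted norm, which gains a power of \<open>L\<close>. On a short time interval the gain beats the exponential of the
  logarithm.\<close>

lemma quadrilinear_log_bound:
  fixes w s :: "nat \<Rightarrow> real" and R W :: real and L M :: nat
  assumes w: "\<And>k. 0 \<le> w k" "\<And>k. w k \<le> s k"
    and R: "\<And>M. wsum M s \<le> R\<^sup>2" "R \<ge> 0"
    and W: "(\<Sum>k\<le>M. (w k)\<^sup>2) \<le> W"
  defines "E \<equiv> harm L * R\<^sup>2 * W + 12 * R ^ 3 * sqrt (1 / sqrt (1 + real L)) * sqrt W"
  shows "qsum M w s s w \<le> E"
    and "qsum M s s w w \<le> E"
proof -
  define \<theta> where "\<theta> = sqrt (1 / sqrt (1 + real L))"
  have E: "E = harm L * R\<^sup>2 * W + 12 * (R ^ 3 * \<theta> * sqrt W)"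
    by (simp add: E_def \<theta>_def)
  define l where "l k = (if k < L then s k else 0)" for k
  define h where "h k = (if k < L then 0 else s k)" for k
  have s: "0 \<le> s k" for k using w[of k] by linarith
  have W0: "0 \<le> W" by (rule order_trans[OF sum_nonneg W]) simp
  have lh: "s k = l k + h k" "0 \<le> l k" "0 \<le> h k" "l k \<le> s k" for k
    using s by (auto simp: l_def h_def)
  have wR: "wsum M w \<le> R\<^sup>2" for M
    by (rule order_trans[OF sum_mono R(1)]) (auto intro!: mult_left_mono power_mono w)
  have qw: "qnorm M w \<le> sqrt W * R"
    by (rule qnorm_le_interpolate[OF wR R(2) W])
  have qs: "qnorm M s \<le> R\<^sup>2"
    by (rule order_trans[OF qnorm_le R(1)])
  have qh: "qnorm M h \<le> R\<^sup>2 / sqrt (1 + real L)"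
  proof -
    have "qnorm M h \<le> (\<Sum>k\<le>M. (1 + real k) * (s k)\<^sup>2 / sqrt (1 + real L))"
      unfolding qnorm_def
    proof (rule sum_mono)
      fix k
      show "sqrt (1 + real k) * (h k)\<^sup>2 \<le> (1 + real k) * (s k)\<^sup>2 / sqrt (1 + real L)"
      proof (cases "k < L")
        case False
        have "sqrt (1 + real k) * sqrt (1 + real L) \<le> sqrt (1 + real k) * sqrt (1 + real k)"
          using False by (intro mult_left_mono) auto
        then have "sqrt (1 + real k) \<le> (1 + real k) / sqrt (1 + real L)"
          by (simp add: field_simps add_pos_nonneg)
        from mult_right_mono[OF this, of "(s k)\<^sup>2"] False show ?thesis
          by (simp add: h_def)
      qed (auto simp: h_def)
    qed
    also have "\<dots> \<le> R\<^sup>2 / sqrt (1 + real L)"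
      unfolding sum_divide_distrib[symmetric] by (intro divide_right_mono R) auto
    finally show ?thesis .
  qed
  have sum_l: "(\<Sum>k\<le>M. l k) * (\<Sum>k\<le>M. l k) \<le> harm L * R\<^sup>2"
  proof -
    define i where "i k = (if k < L then 1 / sqrt (1 + real k) else 0)" for k
    have "(\<Sum>k\<le>M. l k) = (\<Sum>k\<le>M. i k * (sqrt (1 + real k) * s k))"
      by (intro sum.cong) (auto simp: i_def l_def add_pos_nonneg less_imp_neq[THEN not_sym])
    then have "(\<Sum>k\<le>M. l k) * (\<Sum>k\<le>M. l k) \<le> (\<Sum>k\<le>M. (i k)\<^sup>2) * (\<Sum>k\<le>M. (sqrt (1 + real k) * s k)\<^sup>2)"
      using Cauchy_Schwarz_ineq_sum[of i "\<lambda>k. sqrt (1 + real k) * s k" "{..M}"]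
      by (simp add: power2_eq_square)
    also have "\<dots> \<le> harm L * R\<^sup>2"
    proof (rule mult_mono)
      have "(\<Sum>k\<le>M. (i k)\<^sup>2) = (\<Sum>k\<in>{..M} \<inter> {..<L}. inverse (real (Suc k)))"
        by (rule sum.mono_neutral_cong_right) (auto simp: i_def power_divide inverse_eq_divide)
      also have "\<dots> \<le> harm L"
        unfolding harm_altdef by (rule sum_mono2) auto
      finally show "(\<Sum>k\<le>M. (i k)\<^sup>2) \<le> harm L" .
      show "(\<Sum>k\<le>M. (sqrt (1 + real k) * s k)\<^sup>2) \<le> R\<^sup>2"
        using R(1)[of M] by (simp add: power_mult_distrib)
    qed (auto intro: harm_nonneg sum_nonneg)
    finally show ?thesis .
  qed
  have low: "(\<Sum>k\<le>M. l k) * (\<Sum>k\<le>M. l k) * (\<Sum>k\<le>M. (w k)\<^sup>2) \<le> harm L * R\<^sup>2 * W"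
    by (intro mult_mono sum_l W) (auto intro!: sum_nonneg harm_nonneg mult_nonneg_nonneg)
  have "sqrt (qnorm M w * qnorm M w * (qnorm M h * qnorm M s))
      \<le> sqrt ((sqrt W * R) * (sqrt W * R) * ((R\<^sup>2 / sqrt (1 + real L)) * R\<^sup>2))"
    using R W0 by (intro real_sqrt_le_mono mult_mono qw qh qs mult_nonneg_nonneg) auto
  also have "(sqrt W * R) * (sqrt W * R) * ((R\<^sup>2 / sqrt (1 + real L)) * R\<^sup>2)
      = W * (R ^ 3)\<^sup>2 * (1 / sqrt (1 + real L))"
    using real_sqrt_mult_self[of W] W0
    by (simp add: power2_eq_square power3_eq_cube mult_ac)
  also have "sqrt \<dots> = R ^ 3 * \<theta> * sqrt W"
    by (simp only: real_sqrt_mult \<theta>_def real_sqrt_abs) (use R in \<open>simp add: mult_ac\<close>)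
  finally have high: "6 * sqrt (qnorm M w * qnorm M w * (qnorm M h * qnorm M s)) \<le> 6 * (R ^ 3 * \<theta> * sqrt W)"
    by simp
  have high1: "6 * sqrt (qnorm M w * qnorm M h * (qnorm M s * qnorm M w)) \<le> 6 * (R ^ 3 * \<theta> * sqrt W)"
    and high2: "6 * sqrt (qnorm M w * qnorm M s * (qnorm M h * qnorm M w)) \<le> 6 * (R ^ 3 * \<theta> * sqrt W)"
    and high3: "6 * sqrt (qnorm M h * qnorm M s * (qnorm M w * qnorm M w)) \<le> 6 * (R ^ 3 * \<theta> * sqrt W)"
    and high4: "6 * sqrt (qnorm M s * qnorm M h * (qnorm M w * qnorm M w)) \<le> 6 * (R ^ 3 * \<theta> * sqrt W)"
    using high by (simp_all only: mult_ac)
  \<comment> \<open>A product goes to the l^1 estimate only if both factors are low. Each remaining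
    product contains a high factor and is treated by \<open>sum_quads_le\<close>; there are two of
    these, whence 12 = 6 + 6.\<close>
  have split: "s i * s j \<le> l i * l j + h i * s j + s i * h j" for i j
    using mult_nonneg_nonneg[OF lh(2)[of i] lh(3)[of j]] mult_nonneg_nonneg[OF lh(3)[of i] lh(3)[of j]]
    unfolding lh(1)[of i] lh(1)[of j] by (simp add: algebra_simps)
  have "qsum M w s s w
      \<le> (\<Sum>((a,c),(b,d))\<in>quads M. w a * l c * (l b * w d) + w a * h c * (s b * w d) + w a * s c * (h b * w d))"
  proof (rule sum_mono, clarify)
    fix a b c d
    have "(w a * w d) * (s c * s b) \<le> (w a * w d) * (l c * l b + h c * s b + s c * h b)"
      by (intro mult_left_mono split mult_nonneg_nonneg w)
    then show "w a * s c * (s b * w d)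
        \<le> w a * l c * (l b * w d) + w a * h c * (s b * w d) + w a * s c * (h b * w d)"
      by (simp add: algebra_simps)
  qed
  also have "\<dots> = qsum M w l l w
      + qsum M w h s w
      + qsum M w s h w"
    by (simp add: sum.distrib case_prod_unfold)
  also have "\<dots> \<le> harm L * R\<^sup>2 * W + 6 * (R ^ 3 * \<theta> * sqrt W) + 6 * (R ^ 3 * \<theta> * sqrt W)"
    by (intro add_mono order_trans[OF sum_quads_l1_le(1) low] order_trans[OF sum_quads_le high1]
        order_trans[OF sum_quads_le high2] lh)
  finally show "qsum M w s s w \<le> E"
    unfolding E by linarith
  have "qsum M s s w w
      \<le> (\<Sum>((a,c),(b,d))\<in>quads M. l a * l c * (w b * w d) + h a * s c * (w b * w d) + s a * h c * (w b * w d))"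
  proof (rule sum_mono, clarify)
    fix a b c d
    have "(w b * w d) * (s a * s c) \<le> (w b * w d) * (l a * l c + h a * s c + s a * h c)"
      by (intro mult_left_mono split mult_nonneg_nonneg w)
    then show "s a * s c * (w b * w d)
        \<le> l a * l c * (w b * w d) + h a * s c * (w b * w d) + s a * h c * (w b * w d)"
      by (simp add: algebra_simps)
  qed
  also have "\<dots> = qsum M l l w w
      + qsum M h s w w
      + qsum M s h w w"
    by (simp add: sum.distrib case_prod_unfold)
  also have "\<dots> \<le> harm L * R\<^sup>2 * W + 6 * (R ^ 3 * \<theta> * sqrt W) + 6 * (R ^ 3 * \<theta> * sqrt W)"
    by (intro add_mono order_trans[OF sum_quads_l1_le(2) low] order_trans[OF sum_quads_le high3]
        order_trans[OF sum_quads_le high4] lh)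
  finally show "qsum M s s w w \<le> E"
    unfolding E by linarith
qed

section \<open>Convergence and differences of the nonlinearity\<close>

abbreviation triples :: "nat \<Rightarrow> (nat \<times> nat \<times> nat) set" where
  "triples n \<equiv> {(a, b, c). a + c = n + b}"

text \<open>Infinite sums over triples are controlled through their finite subsets. A triple with
  output frequency n becomes the quadruple with d = n, recovered as \<open>a + c - b\<close>; the
  subtraction of naturals is exact here because a + c = n + b.\<close>

lemma sum_triples_le_quads:
  fixes f :: "nat \<Rightarrow> nat \<Rightarrow> nat \<Rightarrow> nat \<Rightarrow> real"
  assumes "finite F" "F \<subseteq> (\<Union>n\<le>N. triples n)" "\<And>a b c d. 0 \<le> f a b c d"
  obtains M where "(\<Sum>(a,b,c)\<in>F. f a b c (a + c - b)) \<le> (\<Sum>((a,c),(b,d))\<in>quads M. f a b c d)"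
proof -
  define M where "M = N + Max (insert 0 ((\<lambda>(a,b,c). a + b + c) ` F))"
  have M: "a + b + c \<le> M" if "(a,b,c) \<in> F" for a b c
    unfolding M_def using assms(1) that by (intro trans_le_add2 Max_ge) force+
  let ?h = "\<lambda>(a,b,c). ((a,c),(b,a + c - b))"
  have inj: "inj_on ?h F" by (auto simp: inj_on_def)
  have sub: "?h ` F \<subseteq> quads M"
  proof clarify
    fix a b c assume abc: "(a,b,c) \<in> F"
    then have "b \<le> a + c" using assms(2) by force
    then show "((a, c), b, a + c - b) \<in> quads M"
      using M[OF abc] by (auto simp: quads_def)
  qed
  have "(\<Sum>(a,b,c)\<in>F. f a b c (a + c - b)) = (\<Sum>((a,c),(b,d))\<in>?h ` F. f a b c d)"
    by (subst sum.reindex[OF inj]) (auto intro!: sum.cong)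
  also have "\<dots> \<le> (\<Sum>((a,c),(b,d))\<in>quads M. f a b c d)"
    using sub assms(3) by (intro sum_mono2) auto
  finally show ?thesis by (rule that)
qed

text \<open>Ensures that the \<open>infsum\<close> in \<open>szego_nl\<close> is a genuine sum and
  not the default value. The fourth function of the quadrilinear form is the indicator
  \<open>e\<close> of the frequency n, and the bound is uniform in the cut-off.\<close>

lemma trilinear_summable_on:
  fixes x y z :: "nat \<Rightarrow> real"
  assumes "\<And>k. 0 \<le> x k" "\<And>k. 0 \<le> y k" "\<And>k. 0 \<le> z k"
    and "\<And>M. wsum M x \<le> R\<^sup>2"
    and "\<And>M. wsum M y \<le> R\<^sup>2"
    and "\<And>M. wsum M z \<le> R\<^sup>2"
  shows "(\<lambda>(a,b,c). x a * y b * z c) summable_on triples n"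
proof (rule nonneg_bdd_above_summable_on)
  have q: "qnorm M v \<le> R\<^sup>2" if "\<And>M. wsum M v \<le> R\<^sup>2" for v M
    by (rule order_trans[OF qnorm_le that])
  define e where "e d = (if d = n then 1 else 0::real)" for d
  have qe: "qnorm M e \<le> sqrt (1 + real n)" for M
  proof -
    have "qnorm M e = (\<Sum>k\<le>M. if k = n then sqrt (1 + real n) else 0)"
      unfolding qnorm_def e_def by (intro sum.cong) auto
    then show ?thesis by simp
  qed
  show "bdd_above (sum (\<lambda>(a,b,c). x a * y b * z c) ` {F. F \<subseteq> triples n \<and> finite F})"
  proof (rule bdd_aboveI2)
    fix F assume F: "F \<in> {F. F \<subseteq> triples n \<and> finite F}"
    obtain M where M: "(\<Sum>(a,b,c)\<in>F. x a * z c * (y b * e (a + c - b)))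
        \<le> qsum M x z y e"
      by (rule sum_triples_le_quads[of F n "\<lambda>a b c d. x a * z c * (y b * e d)"])
         (use F assms(1-3) in \<open>auto simp: e_def\<close>)
    have "(\<Sum>(a,b,c)\<in>F. x a * y b * z c) = (\<Sum>(a,b,c)\<in>F. x a * z c * (y b * e (a + c - b)))"
      using F by (intro sum.cong) (auto simp: e_def)
    also note M
    also note sum_quads_le
    also have "6 * sqrt (qnorm M x * qnorm M z * (qnorm M y * qnorm M e))
        \<le> 6 * sqrt (R\<^sup>2 * R\<^sup>2 * (R\<^sup>2 * sqrt (1 + real n)))"
      by (intro mult_left_mono real_sqrt_le_mono mult_mono q qe assms) auto
    finally show "(\<Sum>(a,b,c)\<in>F. x a * y b * z c) \<le> \<dots>" .
  qed
qed (use assms in auto)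

text \<open>The left side is what appears when the l^2 distance of two solutions is differentiated.
  The cubic difference telescopes into three products with one factor w each. Exchanging
  \<open>a\<close> and \<open>c\<close> identifies the first and the last, and each of the three is
  at most \<open>E\<close>, whence the factor 3.\<close>

lemma szego_nl_diff_bound:
  fixes u v :: "nat \<Rightarrow> complex"
  defines "w \<equiv> \<lambda>k. cmod (u k - v k)" and "s \<equiv> \<lambda>k. cmod (u k) + cmod (v k)"
  assumes R: "\<And>M. wsum M s \<le> R\<^sup>2" "R \<ge> 0"
    and W: "\<And>M. (\<Sum>k\<le>M. (w k)\<^sup>2) \<le> W"
  shows "(\<Sum>n\<le>N. w n * cmod (szego_nl u n - szego_nl v n))
      \<le> 3 * (harm L * R\<^sup>2 * W + 12 * R ^ 3 * sqrt (1 / sqrt (1 + real L)) * sqrt W)"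
proof -
  have ws: "0 \<le> w k" "w k \<le> s k" "0 \<le> s k" "cmod (u k) \<le> s k" "cmod (v k) \<le> s k" for k
    by (auto simp: w_def s_def norm_triangle_ineq4)
  have bd: "wsum M x \<le> R\<^sup>2" if "\<And>k. 0 \<le> x k" "\<And>k. x k \<le> s k" for x M
    by (rule order_trans[OF sum_mono R(1)]) (auto intro!: mult_left_mono power_mono that)
  have tri: "(\<lambda>(a,b,c). x a * y b * z c) summable_on triples n"
    if "\<And>k. 0 \<le> x k" "\<And>k. x k \<le> s k" "\<And>k. 0 \<le> y k" "\<And>k. y k \<le> s k" "\<And>k. 0 \<le> z k" "\<And>k. z k \<le> s k"
    for x y z n
    by (rule trilinear_summable_on[of x y z R]) (rule that bd[OF that(1,2)] bd[OF that(3,4)] bd[OF that(5,6)])+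
  define g where "g = (\<lambda>(a,b,c). w a * s b * s c + s a * w b * s c + s a * s b * w c)"
  have gsum: "g summable_on triples n" for n
  proof -
    have "(\<lambda>t. (case t of (a,b,c) \<Rightarrow> w a * s b * s c) + (case t of (a,b,c) \<Rightarrow> s a * w b * s c)
        + (case t of (a,b,c) \<Rightarrow> s a * s b * w c)) summable_on triples n"
      by (intro summable_on_add tri ws order_refl)
    then show ?thesis by (simp add: g_def case_prod_unfold)
  qed
  have abs: "(\<lambda>t. norm (case t of (a,b,c) \<Rightarrow> x a * cnj (x b) * x c)) summable_on triples n"
    if "\<And>k. cmod (x k) \<le> s k" for x n
    using tri[of "\<lambda>k. cmod (x k)" "\<lambda>k. cmod (x k)" "\<lambda>k. cmod (x k)" n, OF _ that _ that _ that]
    by (simp add: case_prod_unfold norm_mult)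
  have nl: "cmod (szego_nl u n - szego_nl v n) \<le> infsum g (triples n)" for n
  proof -
    let ?f = "\<lambda>x (a,b,c). x a * cnj (x b) * (x c :: complex)"
    have f: "(?f x has_sum szego_nl x n) (triples n)" if "\<And>k. cmod (x k) \<le> s k" for x
      unfolding szego_nl_def using has_sum_infsum[OF abs_summable_summable[OF abs[OF that]]] .
    have "((\<lambda>t. - ?f v t) has_sum - szego_nl v n) (triples n)"
      using f[of v, OF ws(5)] by (simp only: has_sum_uminus minus_minus)
    from has_sum_add[OF f[of u, OF ws(4)] this]
    have "((\<lambda>t. ?f u t - ?f v t) has_sum (szego_nl u n - szego_nl v n)) (triples n)"
      by (simp only: add_uminus_conv_diff)
    moreover have "cmod (?f u t - ?f v t) \<le> g t" for t
    proof -
      obtain a b c where t: "t = (a,b,c)" by (cases t)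
      have "?f u t - ?f v t = (u a - v a) * cnj (u b) * u c + v a * cnj (u b - v b) * u c + v a * cnj (v b) * (u c - v c)"
        by (simp add: t algebra_simps)
      also have "cmod \<dots> \<le> w a * cmod (u b) * cmod (u c) + cmod (v a) * w b * cmod (u c) + cmod (v a) * cmod (v b) * w c"
        by (intro norm_triangle_le add_mono) (auto simp: norm_mult w_def simp del: complex_cnj_diff)
      also have "\<dots> \<le> g t"
        unfolding t g_def prod.case by (intro add_mono mult_mono ws mult_nonneg_nonneg) (auto simp: ws)
      finally show ?thesis .
    qed
    ultimately show ?thesis
      using norm_infsum_le[OF _ has_sum_infsum[OF gsum[of n]]] by blast
  qed
  \<comment> \<open>With \<open>w n\<close> written as \<open>w (a + c - b)\<close>, the sum over n
    becomes a single sum over the disjoint union of the sets \<open>triples n\<close>.\<close>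
  define G where "G = (\<lambda>(a,b,c). w (a + c - b) * g (a,b,c))"
  have Gn: "G summable_on triples n" "infsum G (triples n) = w n * infsum g (triples n)" for n
  proof -
    have *: "G t = w n * g t" if "t \<in> triples n" for t
      using that by (auto simp: G_def)
    show "G summable_on triples n"
      using summable_on_cong[of "triples n" G "\<lambda>t. w n * g t", OF *]
        summable_on_cmult_right[OF gsum[of n], of "w n"] by blast
    show "infsum G (triples n) = w n * infsum g (triples n)"
      using infsum_cong[of "triples n" G "\<lambda>t. w n * g t", OF *] infsum_cmult_right'[of "w n" g "triples n"]
      by (simp only:)
  qed
  define E where "E = harm L * R\<^sup>2 * W + 12 * R ^ 3 * sqrt (1 / sqrt (1 + real L)) * sqrt W"
  have "(\<Sum>n\<le>N. w n * cmod (szego_nl u n - szego_nl v n)) \<le> (\<Sum>n\<le>N. infsum G (triples n))"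
    unfolding Gn by (intro sum_mono mult_left_mono nl ws)
  also have "\<dots> = infsum G (\<Union>n\<le>N. triples n)"
    by (intro sum_infsum) (use Gn in auto)
  also have "\<dots> \<le> 3 * E"
  proof (rule infsum_le_finite_sums)
    show "G summable_on (\<Union>n\<le>N. triples n)"
      by (intro summable_on_finite_union_disjoint) (use Gn in auto)
    fix F assume F: "finite F" "F \<subseteq> (\<Union>n\<le>N. triples n)"
    obtain M where M: "(\<Sum>(a,b,c)\<in>F. w (a + c - b) * g (a,b,c))
        \<le> (\<Sum>((a,c),(b,d))\<in>quads M. w d * g (a,b,c))"
      by (rule sum_triples_le_quads[OF F, of "\<lambda>a b c d. w d * g (a,b,c)"])
         (simp_all add: g_def ws)
    have "sum G F \<le> (\<Sum>((a,c),(b,d))\<in>quads M. w d * g (a,b,c))"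
      using M by (simp add: G_def)
    also have "\<dots> = qsum M w s s w
        + qsum M s s w w
        + qsum M s w s w"
      unfolding sum.distrib[symmetric] by (intro sum.cong) (auto simp: g_def algebra_simps)
    also have "qsum M s w s w = qsum M w s s w"
      by (rule sum.reindex_bij_witness[of _ "\<lambda>((a,c),q). ((c,a),q)" "\<lambda>((a,c),q). ((c,a),q)"])
         (auto simp: quads_def)
    also have "qsum M w s s w + qsum M s s w w
        + qsum M w s s w \<le> E + E + E"
      unfolding E_def by (intro add_mono quadrilinear_log_bound ws R W)
    finally show "sum G F \<le> 3 * E" by simp
  qed
  finally show ?thesis unfolding E_def .
qed

section \<open>Bounds in H^{1/2} and uniqueness of solutions\<close>

lemma cmod_diff_squared_le: "(cmod (x - y))\<^sup>2 \<le> 2 * (cmod x)\<^sup>2 + 2 * (cmod y)\<^sup>2"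
proof -
  have "(cmod (x - y))\<^sup>2 \<le> (cmod x + cmod y)\<^sup>2"
    by (intro power_mono norm_triangle_ineq4) auto
  also have "\<dots> \<le> 2 * (cmod x)\<^sup>2 + 2 * (cmod y)\<^sup>2"
    using sum_squares_bound[of "cmod x" "cmod y"] by (simp add: power2_sum)
  finally show ?thesis .
qed

lemma h12_diff:
  assumes "h12 u" "h12 v"
  shows "h12 (\<lambda>k. u k - v k)"
  unfolding h12_def
proof (rule summable_comparison_test')
  show "summable (\<lambda>k. 2 * ((1 + real k) * (cmod (u k))\<^sup>2) + 2 * ((1 + real k) * (cmod (v k))\<^sup>2))"
    using assms unfolding h12_def by (intro summable_add summable_mult)
  fix k
  show "norm ((1 + real k) * (cmod (u k - v k))\<^sup>2)
      \<le> 2 * ((1 + real k) * (cmod (u k))\<^sup>2) + 2 * ((1 + real k) * (cmod (v k))\<^sup>2)"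
    using mult_left_mono[OF cmod_diff_squared_le[of "u k" "v k"], of "1 + real k"]
    by (simp add: algebra_simps)
qed

lemma h12_norm_squared: "h12 u \<Longrightarrow> (h12_norm u)\<^sup>2 = (\<Sum>k. (1 + real k) * (cmod (u k))\<^sup>2)"
  unfolding h12_norm_def h12_def by (intro real_sqrt_pow2 suminf_nonneg) auto

lemma h12_partial_sum_le: "h12 u \<Longrightarrow> (\<Sum>k\<le>M. (1 + real k) * (cmod (u k))\<^sup>2) \<le> (h12_norm u)\<^sup>2"
  unfolding h12_norm_squared unfolding h12_def by (intro sum_le_suminf) auto

lemma coeff_diff_le_h12_dist:
  assumes "h12 u" "h12 v"
  shows "cmod (u k - v k) \<le> h12_dist u v"
proof -
  have "(cmod (u k - v k))\<^sup>2 \<le> (1 + real k) * (cmod (u k - v k))\<^sup>2"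
    by (simp add: algebra_simps)
  also have "\<dots> \<le> (\<Sum>j\<le>k. (1 + real j) * (cmod (u j - v j))\<^sup>2)"
    by (rule member_le_sum) auto
  also have "\<dots> \<le> (h12_dist u v)\<^sup>2"
    unfolding h12_dist_def by (intro h12_partial_sum_le h12_diff assms)
  finally show ?thesis
    by (rule power2_le_imp_le)
       (simp add: h12_dist_def h12_norm_def suminf_nonneg h12_diff[OF assms, unfolded h12_def])
qed

text \<open>Continuity in H^{1/2} gives a bound near each time; the bisection principle
  \<open>Bolzano\<close> patches these to one constant on the compact interval.\<close>

lemma szego_solution_locally_bounded:
  assumes "szego_solution u0 u" "0 \<le> T"
  shows "\<exists>B. \<forall>t\<in>{0..T}. \<forall>M. wsum M (\<lambda>k. cmod (u t k)) \<le> B"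
  using assms(2)
proof (induction rule: Bolzano)
  case (trans a b c)
  then obtain B1 B2 where "\<forall>t\<in>{a..b}. \<forall>M. wsum M (\<lambda>k. cmod (u t k)) \<le> B1"
    "\<forall>t\<in>{b..c}. \<forall>M. wsum M (\<lambda>k. cmod (u t k)) \<le> B2" by blast
  then have "\<forall>t\<in>{a..c}. \<forall>M. wsum M (\<lambda>k. cmod (u t k)) \<le> max B1 B2"
    by (metis atLeastAtMost_iff le_max_iff_disj linear)
  then show ?case by blast
next
  case (local x)
  have h: "h12 (u t)" for t using assms(1) by (simp add: szego_solution_def)
  have "((\<lambda>s. h12_dist (u s) (u x)) \<longlongrightarrow> 0) (at x)"
    using assms(1) by (simp add: szego_solution_def)
  then have "\<forall>\<^sub>F s in at x. h12_dist (u s) (u x) < 1"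
    by (rule order_tendstoD) simp
  then obtain d where d: "d > 0" "\<And>s. s \<noteq> x \<Longrightarrow> dist s x < d \<Longrightarrow> h12_dist (u s) (u x) < 1"
    unfolding eventually_at by auto
  have "h12_dist (u x) (u x) = 0" by (simp add: h12_dist_def h12_norm_def)
  with d have d': "h12_dist (u s) (u x) \<le> 1" if "dist s x < d" for s
    using that by (cases "s = x") (auto intro: less_imp_le)
  have bound: "wsum M (\<lambda>k. cmod (u s k)) \<le> 2 * (h12_norm (u x))\<^sup>2 + 2" if "dist s x < d" for s M
  proof -
    have "wsum M (\<lambda>k. cmod (u s k))
        \<le> (\<Sum>k\<le>M. 2 * ((1 + real k) * (cmod (u x k))\<^sup>2) + 2 * ((1 + real k) * (cmod (u s k - u x k))\<^sup>2))"
    proof (rule sum_mono)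
      fix k
      show "(1 + real k) * (cmod (u s k))\<^sup>2
          \<le> 2 * ((1 + real k) * (cmod (u x k))\<^sup>2) + 2 * ((1 + real k) * (cmod (u s k - u x k))\<^sup>2)"
        using mult_left_mono[OF cmod_diff_squared_le[of "u x k" "u x k - u s k"], of "1 + real k"]
        by (simp add: algebra_simps norm_minus_commute)
    qed
    also have "\<dots> = 2 * wsum M (\<lambda>k. cmod (u x k)) + 2 * (\<Sum>k\<le>M. (1 + real k) * (cmod (u s k - u x k))\<^sup>2)"
      by (simp add: sum.distrib sum_distrib_left)
    also have "\<dots> \<le> 2 * (h12_norm (u x))\<^sup>2 + 2 * (h12_dist (u s) (u x))\<^sup>2"
      unfolding h12_dist_def by (intro add_mono mult_left_mono h12_partial_sum_le h12_diff h) auto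
    also have "(h12_dist (u s) (u x))\<^sup>2 \<le> 1"
      using d'[OF that] by (intro power_le_one)
        (auto simp: h12_dist_def h12_norm_def suminf_nonneg h12_diff[OF h h, unfolded h12_def])
    finally show ?thesis by simp
  qed
  show ?case
    by (intro exI[of _ d] conjI d allI impI exI[of _ "2 * (h12_norm (u x))\<^sup>2 + 2"] ballI bound)
       (auto simp: dist_real_def)
qed

text \<open>Gronwall's argument for the squared l^2 distance \<open>f\<close>, run on the supremum
  \<open>m\<close> of \<open>exp (- K * (t - t0)) * sqrt (f t)\<close>. The estimate returns m^2 <=
  m^2 / 2 + (\<eta> / K) m, hence m <= 2 \<eta> / K <= \<eta>. The constants 6 and 72 are 2 * 3 and
  2 * 3 * 12: the 2 comes from differentiating a square, the rest from
  \<open>szego_nl_diff_bound\<close>.\<close>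

lemma szego_energy_bound:
  fixes t0 t1 :: real
  assumes u: "szego_solution u0 u" and v: "szego_solution v0 v" and eq: "u t0 = v t0"
    and R: "\<And>t M. t0 \<le> t \<Longrightarrow> t \<le> t1 \<Longrightarrow> (\<Sum>k\<le>M. (1 + real k) * (cmod (u t k) + cmod (v t k))\<^sup>2) \<le> R\<^sup>2"
    and "R \<ge> 1" "L \<ge> 1" and t: "t0 \<le> t" "t \<le> t1"
  defines "K \<equiv> 6 * harm L * R\<^sup>2"
  shows "cmod (u t k - v t k) \<le> exp (K * (t - t0)) * (72 * R ^ 3 * sqrt (1 / sqrt (1 + real L)))"
proof -
  define w where "w t k = cmod (u t k - v t k)" for t k
  define f where "f t = (\<Sum>k. (w t k)\<^sup>2)" for t
  define \<eta> where "\<eta> = 72 * R ^ 3 * sqrt (1 / sqrt (1 + real L))"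
  have \<eta>: "\<eta> \<ge> 0" using assms by (simp add: \<eta>_def)
  have K: "K \<ge> 6"
  proof -
    have "harm L \<ge> (1::real)"
      using harm_mono[OF \<open>L \<ge> 1\<close>, where ?'a = real] by (simp add: harm_def)
    moreover have "R\<^sup>2 \<ge> 1" using \<open>R \<ge> 1\<close> by (simp add: power2_eq_square mult_ge1_I)
    ultimately have "harm L * R\<^sup>2 \<ge> 1" by (rule mult_ge1_I)
    then show ?thesis unfolding K_def by simp
  qed
  have h: "h12 (u t)" "h12 (v t)" for t
    using u v by (auto simp: szego_solution_def)
  have summ: "summable (\<lambda>k. (w t k)\<^sup>2)" for t
    by (rule summable_comparison_test'[OF h12_diff[OF h, unfolded h12_def, of t t]])
       (auto simp: w_def algebra_simps)
  have partial: "(\<Sum>k\<le>M. (w t k)\<^sup>2) \<le> f t" for t M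
    unfolding f_def by (intro sum_le_suminf summ) auto
  have f0: "f t \<ge> 0" for t unfolding f_def by (intro suminf_nonneg summ) auto
  have fR: "f t \<le> R\<^sup>2" if "t0 \<le> t" "t \<le> t1" for t
    unfolding f_def
  proof (rule suminf_le_const[OF summ])
    fix n
    have "(\<Sum>k<n. (w t k)\<^sup>2) \<le> (\<Sum>k\<le>n. (w t k)\<^sup>2)"
      by (rule sum_mono2) auto
    also have "\<dots> \<le> (\<Sum>k\<le>n. (1 + real k) * (cmod (u t k) + cmod (v t k))\<^sup>2)"
    proof (rule sum_mono)
      fix k
      have "1 * (w t k)\<^sup>2 \<le> (1 + real k) * (cmod (u t k) + cmod (v t k))\<^sup>2"
        unfolding w_def by (intro mult_mono power_mono norm_triangle_ineq4) auto
      then show "(w t k)\<^sup>2 \<le> (1 + real k) * (cmod (u t k) + cmod (v t k))\<^sup>2" by simp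
    qed
    also note R[OF that]
    finally show "(\<Sum>k<n. (w t k)\<^sup>2) \<le> R\<^sup>2" .
  qed
  define x where "x t = exp (- K * (t - t0)) * sqrt (f t)" for t
  define m where "m = (SUP t\<in>{t0..t1}. x t)"
  have "x t \<le> R" if "t \<in> {t0..t1}" for t
  proof -
    have "x t \<le> 1 * sqrt (R\<^sup>2)"
      unfolding x_def using that fR[of t] f0 K by (intro mult_mono real_sqrt_le_mono) auto
    then show ?thesis using \<open>R \<ge> 1\<close> by simp
  qed
  then have bdd: "bdd_above (x ` {t0..t1})" by (rule bdd_aboveI2)
  have xm: "x t \<le> m" if "t \<in> {t0..t1}" for t
    unfolding m_def using that bdd by (rule cSUP_upper)
  have x0: "x t \<ge> 0" for t using f0 by (simp add: x_def)
  have m0: "m \<ge> 0" using xm[of t] x0[of t] t by simp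
  have sf: "sqrt (f t) \<le> exp (K * (t - t0)) * m" if "t \<in> {t0..t1}" for t
  proof -
    have "sqrt (f t) = exp (K * (t - t0)) * x t"
      by (simp add: x_def mult.assoc[symmetric] exp_add[symmetric])
    also have "\<dots> \<le> exp (K * (t - t0)) * m" using xm[OF that] by simp
    finally show ?thesis .
  qed
  \<comment> \<open>A primitive of the bound for the derivative of the partial sums. Only partial
    sums are differentiated, because nothing is known yet about the differentiability of the series
    \<open>f\<close>; the cut-off goes to infinity afterwards.\<close>
  define H where "H t = (exp (K * (t - t0)))\<^sup>2 * m\<^sup>2 / 2 + \<eta> / K * (exp (K * (t - t0)) * m)" for t
  have key: "(\<Sum>k\<le>M. (w t k)\<^sup>2) \<le> H t" if t: "t \<in> {t0..t1}" for t M
  proof -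
    define D where "D s k = 2 * Re (cnj (u s k - v s k) * (- \<i> * (szego_nl (u s) k - szego_nl (v s) k)))" for s k
    have deriv_w: "((\<lambda>s. (w s k)\<^sup>2) has_real_derivative D s k) (at s)" for s k
    proof -
      have 1: "((\<lambda>s. u s k - v s k) has_vector_derivative (- \<i> * (szego_nl (u s) k - szego_nl (v s) k))) (at s)"
        using u v unfolding szego_solution_def
        by (auto intro!: derivative_eq_intros simp: algebra_simps)
      have re: "((\<lambda>s. Re (u s k - v s k)) has_real_derivative
          Re (- \<i> * (szego_nl (u s) k - szego_nl (v s) k))) (at s)"
        and im: "((\<lambda>s. Im (u s k - v s k)) has_real_derivative
          Im (- \<i> * (szego_nl (u s) k - szego_nl (v s) k))) (at s)"
        using bounded_linear.has_vector_derivative[OF bounded_linear_Re 1]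
          bounded_linear.has_vector_derivative[OF bounded_linear_Im 1]
        by (simp_all only: has_real_derivative_iff_has_vector_derivative)
      show ?thesis
        unfolding w_def cmod_power2
        by (rule derivative_eq_intros re im refl)+ (simp add: D_def algebra_simps)
    qed
    have D_le: "(\<Sum>k\<le>M. D s k) \<le> K * ((exp (K * (s - t0)))\<^sup>2 * m\<^sup>2) + \<eta> * (exp (K * (s - t0)) * m)"
      if s: "s \<in> {t0..t1}" for s
    proof -
      have "(\<Sum>k\<le>M. D s k) \<le> (\<Sum>k\<le>M. 2 * (w s k * cmod (szego_nl (u s) k - szego_nl (v s) k)))"
      proof (rule sum_mono)
        fix k
        have "D s k \<le> 2 * cmod (cnj (u s k - v s k) * (- \<i> * (szego_nl (u s) k - szego_nl (v s) k)))"
          unfolding D_def by (intro mult_left_mono complex_Re_le_cmod) simp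
        then show "D s k \<le> 2 * (w s k * cmod (szego_nl (u s) k - szego_nl (v s) k))"
          by (simp add: norm_mult w_def del: complex_cnj_diff)
      qed
      also have "\<dots> = 2 * (\<Sum>k\<le>M. w s k * cmod (szego_nl (u s) k - szego_nl (v s) k))"
        by (simp add: sum_distrib_left)
      also have "\<dots> \<le> 2 * (3 * (harm L * R\<^sup>2 * f s + 12 * R ^ 3 * sqrt (1 / sqrt (1 + real L)) * sqrt (f s)))"
        unfolding w_def using s \<open>R \<ge> 1\<close> partial[of s, unfolded w_def]
        by (intro mult_left_mono szego_nl_diff_bound R) auto
      also have "\<dots> = K * (sqrt (f s))\<^sup>2 + \<eta> * sqrt (f s)"
        using f0[of s] by (simp add: K_def \<eta>_def algebra_simps)
      also have "\<dots> \<le> K * (exp (K * (s - t0)) * m)\<^sup>2 + \<eta> * (exp (K * (s - t0)) * m)"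
        using K \<eta> f0[of s] sf[OF s] by (intro add_mono mult_left_mono power_mono) auto
      finally show ?thesis by (simp add: power_mult_distrib)
    qed
    have "(\<Sum>k\<le>M. (w t k)\<^sup>2) - H t \<le> (\<Sum>k\<le>M. (w t0 k)\<^sup>2) - H t0"
    proof (rule DERIV_nonpos_imp_nonincreasing[of t0 t "\<lambda>t. (\<Sum>k\<le>M. (w t k)\<^sup>2) - H t"])
      show "t0 \<le> t" using t by simp
      fix s assume s: "t0 \<le> s" "s \<le> t"
      have "((\<lambda>t. (\<Sum>k\<le>M. (w t k)\<^sup>2) - H t) has_real_derivative
          ((\<Sum>k\<le>M. D s k) - (K * ((exp (K * (s - t0)))\<^sup>2 * m\<^sup>2) + \<eta> * (exp (K * (s - t0)) * m)))) (at s)"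
      proof (intro DERIV_diff DERIV_sum deriv_w)
        show "(H has_real_derivative K * ((exp (K * (s - t0)))\<^sup>2 * m\<^sup>2) + \<eta> * (exp (K * (s - t0)) * m)) (at s)"
          unfolding H_def using K
          by (auto intro!: derivative_eq_intros simp: power2_eq_square)
      qed
      then show "\<exists>y. ((\<lambda>t. (\<Sum>k\<le>M. (w t k)\<^sup>2) - H t) has_real_derivative y) (at s) \<and> y \<le> 0"
        using D_le[of s] s t by (intro exI conjI) auto
    qed
    moreover have "(\<Sum>k\<le>M. (w t0 k)\<^sup>2) = 0" by (simp add: w_def eq)
    moreover have "H t0 \<ge> 0" unfolding H_def using K \<eta> m0 by simp
    ultimately show ?thesis by linarith
  qed
  have fH: "f t \<le> H t" if "t \<in> {t0..t1}" for t
    unfolding f_def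
  proof (rule suminf_le_const[OF summ])
    fix n
    have "(\<Sum>k<n. (w t k)\<^sup>2) \<le> (\<Sum>k\<le>n. (w t k)\<^sup>2)"
      by (rule sum_mono2) auto
    with key[OF that, of n] show "(\<Sum>k<n. (w t k)\<^sup>2) \<le> H t" by linarith
  qed
  have x2: "(x t)\<^sup>2 \<le> m\<^sup>2 / 2 + \<eta> / K * m" if t: "t \<in> {t0..t1}" for t
  proof -
    define e where "e = exp (K * (t - t0))"
    have e: "e \<ge> 1" using t K by (simp add: e_def)
    have "(x t)\<^sup>2 = f t / e\<^sup>2"
    proof -
      have "x t = sqrt (f t) / e"
        unfolding x_def e_def by (simp only: mult_minus_left exp_minus) (simp add: field_simps)
      then show ?thesis using f0[of t] by (simp add: power_divide)
    qed
    also have "\<dots> \<le> H t / e\<^sup>2"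
      using fH[OF t] by (intro divide_right_mono) auto
    also have "\<dots> = m\<^sup>2 / 2 + \<eta> / K * m / e"
      using e unfolding H_def e_def[symmetric] by (simp add: field_simps power2_eq_square)
    also have "\<dots> \<le> m\<^sup>2 / 2 + \<eta> / K * m"
    proof -
      have "\<eta> / K * m / e \<le> \<eta> / K * m / 1"
        using e \<eta> K m0 by (intro divide_left_mono) auto
      then show ?thesis by simp
    qed
    finally show ?thesis .
  qed
  have "m \<le> sqrt (m\<^sup>2 / 2 + \<eta> / K * m)"
    unfolding m_def
    by (rule cSUP_least) (use t x2 in \<open>auto simp: m_def intro!: real_le_rsqrt\<close>)
  then have "m\<^sup>2 \<le> m\<^sup>2 / 2 + \<eta> / K * m"
    using power_mono[OF _ m0, of _ 2] m0 K \<eta> by (fastforce simp: real_sqrt_pow2)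
  then have "m * m \<le> (2 * \<eta> / K) * m" by (simp add: power2_eq_square)
  then have "m \<le> 2 * \<eta> / K"
    using m0 \<eta> K mult_right_le_imp_le[of m m "2 * \<eta> / K"] by (cases "m = 0") auto
  also have "\<dots> \<le> \<eta>"
  proof -
    have "2 * \<eta> \<le> K * \<eta>" using K \<eta> by (intro mult_right_mono) auto
    then show ?thesis using K by (simp add: field_simps)
  qed
  finally have m\<eta>: "m \<le> \<eta>" .
  have "w t k \<le> sqrt (f t)"
  proof (rule real_le_rsqrt)
    have "(w t k)\<^sup>2 \<le> (\<Sum>j\<le>k. (w t j)\<^sup>2)" by (rule member_le_sum) auto
    then show "(w t k)\<^sup>2 \<le> f t" using partial[of t k] by linarith
  qed
  also have "\<dots> \<le> exp (K * (t - t0)) * m" using sf t by simp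
  also have "\<dots> \<le> exp (K * (t - t0)) * \<eta>" using m\<eta> by simp
  finally show ?thesis by (simp add: w_def \<eta>_def)
qed

text \<open>\<open>K\<close> grows like 6 R^2 ln L, so on an interval of length 1 / (48 R^2) the
  exponential is of order L^{1/8}. The other factor decays like L^{-1/4}, and letting L tend to
  infinity leaves 0.\<close>

lemma szego_unique_short_time:
  assumes u: "szego_solution u0 u" and v: "szego_solution v0 v" and eq: "u t0 = v t0"
    and R: "\<And>t M. t0 \<le> t \<Longrightarrow> t \<le> t1 \<Longrightarrow> (\<Sum>k\<le>M. (1 + real k) * (cmod (u t k) + cmod (v t k))\<^sup>2) \<le> R\<^sup>2"
    and "R \<ge> 1" and t: "t0 \<le> t" "t \<le> t1" "t - t0 \<le> 1 / (48 * R\<^sup>2)"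
  shows "u t = v t"
proof
  fix k
  have "cmod (u t k - v t k) \<le> exp ((1 + ln (real L)) / 8) * (72 * R ^ 3 * sqrt (1 / sqrt (1 + real L)))"
    if L: "L \<ge> 1" for L
  proof -
    have "harm L \<le> 1 + ln (real L)"
    proof -
      obtain n where n: "L = Suc n" using L by (cases L) auto
      have "harm (Suc n) - ln (real (Suc n)) \<le> harm (Suc 0) - ln (real (Suc 0))"
        using decseq_harm_diff_ln by (rule decseqD) simp
      then show ?thesis by (simp add: n harm_def)
    qed
    moreover have "6 * harm L * R\<^sup>2 * (t - t0) \<le> 6 * harm L * R\<^sup>2 * (1 / (48 * R\<^sup>2))"
      using t by (intro mult_left_mono mult_nonneg_nonneg) (auto intro: harm_nonneg)
    moreover have "6 * harm L * R\<^sup>2 * (1 / (48 * R\<^sup>2)) = harm L / 8"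
      using \<open>R \<ge> 1\<close> by (simp add: field_simps)
    ultimately have "exp (6 * harm L * R\<^sup>2 * (t - t0)) \<le> exp ((1 + ln (real L)) / 8)"
      by simp
    then show ?thesis
      using szego_energy_bound[OF u v eq R \<open>R \<ge> 1\<close> that t(1,2), of k] \<open>R \<ge> 1\<close>
      by (smt (verit, ccfv_SIG) mult_right_mono mult_nonneg_nonneg zero_le_power real_sqrt_ge_zero
          divide_nonneg_nonneg of_nat_0_le_iff)
  qed
  moreover have "(\<lambda>L::nat. exp ((1 + ln (real L)) / 8) * (72 * R ^ 3 * sqrt (1 / sqrt (1 + real L)))) \<longlonglongrightarrow> 0"
  proof -
    have "(\<lambda>L::nat. exp ((1 + ln (real L)) / 8) * sqrt (1 / sqrt (1 + real L))) \<longlonglongrightarrow> 0"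
      by real_asymp
    from tendsto_mult_right[OF this, of "72 * R ^ 3"] show ?thesis by (simp add: mult_ac)
  qed
  ultimately have "cmod (u t k - v t k) \<le> 0"
    by (intro tendsto_lowerbound[where F = sequentially]) (auto intro: eventually_sequentiallyI[of 1])
  then show "u t k = v t k" by simp
qed

text \<open>The bound R holds on all of [0, t], so the admissible step \<open>\<tau>\<close> is the
  same everywhere and finitely many short steps reach t. Forward times suffice, as the explicit
  solutions leave the orbit at nonnegative times.\<close>

theorem szego_solution_unique:
  assumes u: "szego_solution u0 u" and v: "szego_solution u0 v" and "0 \<le> t"
  shows "u t = v t"
proof -
  obtain B1 B2 where B: "\<And>s M. s \<in> {0..t} \<Longrightarrow> wsum M (\<lambda>k. cmod (u s k)) \<le> B1"
    "\<And>s M. s \<in> {0..t} \<Longrightarrow> wsum M (\<lambda>k. cmod (v s k)) \<le> B2"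
    using szego_solution_locally_bounded[OF u \<open>0 \<le> t\<close>] szego_solution_locally_bounded[OF v \<open>0 \<le> t\<close>] by blast
  define R where "R = 1 + 2 * \<bar>B1\<bar> + 2 * \<bar>B2\<bar>"
  have R: "R \<ge> 1" by (simp add: R_def)
  have bound: "(\<Sum>k\<le>M. (1 + real k) * (cmod (u s k) + cmod (v s k))\<^sup>2) \<le> R\<^sup>2" if "0 \<le> s" "s \<le> t" for s M
  proof -
    have "(\<Sum>k\<le>M. (1 + real k) * (cmod (u s k) + cmod (v s k))\<^sup>2)
        \<le> (\<Sum>k\<le>M. 2 * ((1 + real k) * (cmod (u s k))\<^sup>2) + 2 * ((1 + real k) * (cmod (v s k))\<^sup>2))"
    proof (rule sum_mono)
      fix k
      have "(cmod (u s k) + cmod (v s k))\<^sup>2 \<le> 2 * (cmod (u s k))\<^sup>2 + 2 * (cmod (v s k))\<^sup>2"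
        using sum_squares_bound[of "cmod (u s k)" "cmod (v s k)"] by (simp add: power2_sum)
      from mult_left_mono[OF this, of "1 + real k"]
      show "(1 + real k) * (cmod (u s k) + cmod (v s k))\<^sup>2
          \<le> 2 * ((1 + real k) * (cmod (u s k))\<^sup>2) + 2 * ((1 + real k) * (cmod (v s k))\<^sup>2)"
        by (simp add: algebra_simps)
    qed
    also have "\<dots> = 2 * wsum M (\<lambda>k. cmod (u s k)) + 2 * wsum M (\<lambda>k. cmod (v s k))"
      by (simp add: sum.distrib sum_distrib_left)
    also have "\<dots> \<le> R" unfolding R_def using B(1)[of s M] B(2)[of s M] that by auto
    also have "\<dots> \<le> R\<^sup>2" using R by (simp add: power2_eq_square)
    finally show ?thesis .
  qed
  define \<tau> where "\<tau> = 1 / (48 * R\<^sup>2)"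
  have \<tau>: "\<tau> > 0" using R by (simp add: \<tau>_def)
  have "u s = v s" if "0 \<le> s" "s \<le> t" "s \<le> real n * \<tau>" for s n
    using that
  proof (induction n arbitrary: s)
    case 0
    then have "s = 0" by simp
    then show ?case using u v by (simp add: szego_solution_def)
  next
    case (Suc n)
    show ?case
    proof (cases "s \<le> real n * \<tau>")
      case True
      then show ?thesis using Suc by blast
    next
      case False
      have n0: "0 \<le> real n * \<tau>" using \<tau> by simp
      have "u (real n * \<tau>) = v (real n * \<tau>)"
        using Suc.IH[of "real n * \<tau>"] Suc.prems False n0 by simp
      moreover have "s - real n * \<tau> \<le> 1 / (48 * R\<^sup>2)"
        using Suc.prems unfolding \<tau>_def[symmetric] by (simp add: algebra_simps)
      ultimately show ?thesis
        using Suc.prems False R n0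
        by (intro szego_unique_short_time[OF u v, of "real n * \<tau>" t R s] bound) linarith+
    qed
  qed
  moreover obtain n where "t / \<tau> \<le> real n" using real_arch_simple by blast
  then have "t \<le> real n * \<tau>" using \<tau> by (simp add: field_simps)
  ultimately show ?thesis using \<open>0 \<le> t\<close> by blast
qed

section \<open>Fourier averages and Taylor coefficients\<close>

lemma sum_roots_of_unity_eq_0:
  fixes m :: int
  assumes "m \<noteq> 0" "\<bar>m\<bar> < int N"
  shows "(\<Sum>j<N. cis (of_int m * (2 * pi * real j / real N))) = 0"
proof -
  define z where "z = cis (of_int m * (2 * pi / real N))"
  have N: "N > 0" using assms by auto
  have "z \<noteq> 1"
  proof
    assume "z = 1"
    then have "cos (of_int m * (2 * pi / real N)) = 1" by (simp add: z_def complex_eq_iff)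
    then obtain x :: int where "of_int m * (2 * pi / real N) = of_int x * (2 * pi)"
      by (auto simp: cos_one_2pi_int mult.assoc)
    then have "real_of_int m = of_int x * real N" using N by (simp add: field_simps)
    then have m: "m = x * int N" by (metis of_int_eq_iff of_int_mult of_int_of_nat_eq)
    then have "\<bar>x\<bar> \<ge> 1" using assms by auto
    then have "1 * int N \<le> \<bar>x\<bar> * int N" by (intro mult_right_mono) auto
    then show False using assms m by (simp add: abs_mult)
  qed
  moreover have "z ^ N = 1"
  proof -
    have "z ^ N = cis (2 * pi * of_int m)" using N unfolding z_def Complex.DeMoivre by (simp add: mult_ac)
    also have "\<dots> = 1" by (simp add: complex_eq_iff cos_int_2pin sin_int_2pin)
    finally show ?thesis .
  qed
  ultimately have "(\<Sum>j<N. z ^ j) = 0" by (simp add: geometric_sum)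
  moreover have "z ^ j = cis (of_int m * (2 * pi * real j / real N))" for j
    unfolding z_def Complex.DeMoivre by (simp add: mult_ac)
  ultimately show ?thesis by simp
qed

abbreviation circle_average :: "('i \<Rightarrow> complex) \<Rightarrow> ('i \<Rightarrow> int) \<Rightarrow> 'i set \<Rightarrow> nat \<Rightarrow> complex" where
  "circle_average p m I N \<equiv>
    (\<Sum>j<N. infsetsum (\<lambda>i. p i * cis (of_int (m i) * (2 * pi * real j / real N))) I) / of_nat N"

text \<open>Averages over N-th roots of unity take the place of the integral over the circle, so
  that extracting a Fourier coefficient is dominated convergence for a sum: each factor
  \<open>e N i\<close> is exactly 0 or 1 as soon as N > |m i|.\<close>

lemma roots_of_unity_average_tendsto:
  fixes p :: "'i \<Rightarrow> complex" and m :: "'i \<Rightarrow> int"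
  assumes "Infinite_Set_Sum.abs_summable_on p I"
  shows "(\<lambda>N. circle_average p m I N)
    \<longlonglongrightarrow> infsetsum (\<lambda>i. if m i = 0 then p i else 0) I"
proof -
  define e where "e N i = (\<Sum>j<N. cis (of_int (m i) * (2 * pi * real j / real N))) / of_nat N" for N i
  have "circle_average p m I N
      = infsetsum (\<lambda>i. p i * e N i) I" for N
  proof -
    have s: "Infinite_Set_Sum.abs_summable_on (\<lambda>i. p i * cis (of_int (m i) * \<theta>)) I" for \<theta>
      using assms by (rule abs_summable_on_comparison_test) (simp add: norm_mult)
    have "(\<Sum>j<N. infsetsum (\<lambda>i. p i * cis (of_int (m i) * (2 * pi * real j / real N))) I)
        = infsetsum (\<lambda>i. \<Sum>j<N. p i * cis (of_int (m i) * (2 * pi * real j / real N))) I"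
      by (rule sum_infsetsum) (rule s)
    also have "\<dots> / of_nat N = infsetsum (\<lambda>i. (\<Sum>j<N. p i * cis (of_int (m i) * (2 * pi * real j / real N))) / of_nat N) I"
      by (intro infsetsum_cdiv[symmetric] abs_summable_sum s)
    finally show ?thesis
      by (simp add: e_def sum_distrib_left)
  qed
  moreover have "(\<lambda>N. infsetsum (\<lambda>i. p i * e N i) I) \<longlonglongrightarrow> infsetsum (\<lambda>i. if m i = 0 then p i else 0) I"
    unfolding infsetsum_def
  proof (rule integral_dominated_convergence[where w = "\<lambda>i. norm (p i)"])
    show "integrable (count_space I) (\<lambda>i. norm (p i))"
      using assms by (intro integrable_norm) (simp add: abs_summable_on_def)
    show "AE i in count_space I. (\<lambda>N. p i * e N i) \<longlonglongrightarrow> (if m i = 0 then p i else 0)"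
    proof (rule AE_I2)
      fix i
      have "e N i = (if m i = 0 then 1 else 0)" if "N > nat \<bar>m i\<bar>" for N
        using that sum_roots_of_unity_eq_0[of "m i" N] by (auto simp: e_def)
      then have "eventually (\<lambda>N. p i * e N i = (if m i = 0 then p i else 0)) sequentially"
        unfolding eventually_sequentially by (intro exI[of _ "Suc (nat \<bar>m i\<bar>)"]) auto
      then show "(\<lambda>N. p i * e N i) \<longlonglongrightarrow> (if m i = 0 then p i else 0)"
        by (rule tendsto_eventually)
    qed
    fix N
    have "norm (e N i) \<le> 1" for i
    proof -
      have "norm (\<Sum>j<N. cis (of_int (m i) * (2 * pi * real j / real N))) \<le> real N"
        by (rule order_trans[OF norm_sum]) simp
      then show ?thesis by (cases "N = 0") (auto simp: e_def norm_divide divide_simps)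
    qed
    then show "AE i in count_space I. norm (p i * e N i) \<le> norm (p i)"
      by (intro AE_I2) (simp add: norm_mult mult_left_le)
  qed auto
  ultimately show ?thesis by simp
qed

section \<open>Functions holomorphic beyond the closed unit disc\<close>

lemma taylor_coeff_sums:
  assumes "f holomorphic_on ball 0 r" "norm z < r"
  shows "(\<lambda>k. taylor_coeff f k * z ^ k) sums f z"
  using holomorphic_power_series[OF assms(1), of z] assms(2) by (simp add: taylor_coeff_def)

lemma norm_taylor_coeff_le:
  assumes "f holomorphic_on ball 0 r" "0 < \<rho>" "\<rho> < r" "\<And>z. norm z = \<rho> \<Longrightarrow> norm (f z) \<le> B"
  shows "norm (taylor_coeff f k) \<le> B / \<rho> ^ k"
proof -
  have "norm ((deriv ^^ k) f 0) \<le> fact k * B / \<rho> ^ k"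
  proof (rule Cauchy_inequality)
    show "f holomorphic_on ball 0 \<rho>"
      using assms by (auto intro: holomorphic_on_subset)
    show "continuous_on (cball 0 \<rho>) f"
      using assms by (auto intro!: holomorphic_on_imp_continuous_on intro: holomorphic_on_subset)
  qed (use assms in auto)
  then show ?thesis
    by (simp add: taylor_coeff_def norm_divide field_simps)
qed

lemma holomorphic_imp_bounded_circle:
  assumes "f holomorphic_on ball 0 r" "\<rho> < r"
  obtains B :: real where "B \<ge> 0" "\<And>z. norm z \<le> \<rho> \<Longrightarrow> norm (f z) \<le> B"
proof -
  have "continuous_on (cball 0 \<rho>) f"
    using assms by (auto intro!: holomorphic_on_imp_continuous_on intro: holomorphic_on_subset)
  then have "bounded (f ` cball 0 \<rho>)"
    by (intro compact_imp_bounded compact_continuous_image) auto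
  then obtain B where "\<forall>z\<in>cball 0 \<rho>. norm (f z) \<le> B" unfolding bounded_iff by auto
  then show thesis by (intro that[of "max B 0"]) (auto simp: le_max_iff_disj)
qed

lemma summable_norm_taylor_coeff:
  assumes "f holomorphic_on ball 0 r" "r > 1"
  shows "summable (\<lambda>k. norm (taylor_coeff f k))"
proof -
  obtain \<rho> where \<rho>: "1 < \<rho>" "\<rho> < r" using dense[OF assms(2)] by blast
  obtain B where B: "B \<ge> 0" "\<And>z. norm z \<le> \<rho> \<Longrightarrow> norm (f z) \<le> B"
    using holomorphic_imp_bounded_circle[OF assms(1) \<rho>(2)] by metis
  have s: "summable (\<lambda>k. B * (1 / \<rho>) ^ k)"
    using \<rho> by (intro summable_mult summable_geometric) auto
  have "norm (taylor_coeff f k) \<le> B * (1 / \<rho>) ^ k" for k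
    using norm_taylor_coeff_le[OF assms(1) _ \<rho>(2) B(2), of k] \<rho> by (simp add: power_one_over)
  then show ?thesis
    by (intro summable_comparison_test'[OF s, of 0]) simp
qed

lemma taylor_coeff_infsetsum:
  assumes "f holomorphic_on ball 0 r" "r > 1"
  shows "Infinite_Set_Sum.abs_summable_on (\<lambda>k. taylor_coeff f k * cis (of_nat k * \<theta>)) UNIV"
    and "infsetsum (\<lambda>k. taylor_coeff f k * cis (of_nat k * \<theta>)) UNIV = f (cis \<theta>)"
proof -
  show *: "Infinite_Set_Sum.abs_summable_on (\<lambda>k. taylor_coeff f k * cis (of_nat k * \<theta>)) UNIV"
    using summable_norm_taylor_coeff[OF assms] by (simp add: abs_summable_on_nat_iff' norm_mult)
  have "infsetsum (\<lambda>k. taylor_coeff f k * cis (of_nat k * \<theta>)) UNIV = (\<Sum>k. taylor_coeff f k * cis \<theta> ^ k)"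
    unfolding infsetsum_nat'[OF *] by (simp add: Complex.DeMoivre)
  also have "\<dots> = f (cis \<theta>)"
    using taylor_coeff_sums[OF assms(1), of "cis \<theta>"] assms(2) by (simp add: sums_iff)
  finally show "infsetsum (\<lambda>k. taylor_coeff f k * cis (of_nat k * \<theta>)) UNIV = f (cis \<theta>)" .
qed

text \<open>Both sides are multiplied by z^{-n} and averaged over the circle. On the left the triple
  series, which converges absolutely, retains the terms with a + c = n + b. On the right F
  contributes its n-th coefficient, while cnj G could contribute only for k = n = 0, where its
  coefficient vanishes with G(0).\<close>

lemma szego_nl_eqI:
  assumes u: "u holomorphic_on ball 0 r" and F: "F holomorphic_on ball 0 r" and G: "G holomorphic_on ball 0 r"
    and r: "r > 1" and G0: "G 0 = 0"
    and eq: "\<And>z. norm z = 1 \<Longrightarrow> u z * cnj (u z) * u z = F z + cnj (G z)"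
  shows "szego_nl (taylor_coeff u) n = taylor_coeff F n"
proof -
  define c where "c = taylor_coeff u"
  have cnj_sum: "Infinite_Set_Sum.abs_summable_on (\<lambda>k. cnj (taylor_coeff f k * cis (of_nat k * \<theta>))) UNIV"
    "infsetsum (\<lambda>k. cnj (taylor_coeff f k * cis (of_nat k * \<theta>))) UNIV = cnj (f (cis \<theta>))"
    if "f holomorphic_on ball 0 r" for f \<theta>
  proof -
    show *: "Infinite_Set_Sum.abs_summable_on (\<lambda>k. cnj (taylor_coeff f k * cis (of_nat k * \<theta>))) UNIV"
      using taylor_coeff_infsetsum(1)[OF that r, of \<theta>]
      by (simp add: abs_summable_on_nat_iff' norm_mult)
    show "infsetsum (\<lambda>k. cnj (taylor_coeff f k * cis (of_nat k * \<theta>))) UNIV = cnj (f (cis \<theta>))"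
      using taylor_coeff_infsetsum[OF that r, of \<theta>] *
      by (simp add: infsetsum_infsum del: complex_cnj_mult)
  qed
  define p where "p = (\<lambda>(a, b, c'). c a * cnj (c b) * c c')"
  define m where "m = (\<lambda>(a, b, c'). int a + int c' - int b - int n)"
  have P: "Infinite_Set_Sum.abs_summable_on (\<lambda>i. p i * cis (of_int (m i) * \<theta>)) UNIV \<and>
      infsetsum (\<lambda>i. p i * cis (of_int (m i) * \<theta>)) UNIV
        = u (cis \<theta>) * cnj (u (cis \<theta>)) * u (cis \<theta>) * cis (- (of_nat n * \<theta>))" for \<theta>
  proof -
    let ?x = "\<lambda>k. c k * cis (of_nat k * \<theta>)"
    note x = taylor_coeff_infsetsum[OF u r, of \<theta>, folded c_def]
    note y = cnj_sum[OF u, of \<theta>, folded c_def]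
    note yx = abs_summable_on_product[OF countableI_type countableI_type y(1) x(1)] infsetsum_product[OF countableI_type countableI_type y(1) x(1)]
    have s: "Infinite_Set_Sum.abs_summable_on (\<lambda>(a, b, c'). ?x a * (cnj (?x b) * ?x c')) UNIV"
      "infsetsum (\<lambda>(a, b, c'). ?x a * (cnj (?x b) * ?x c')) UNIV = u (cis \<theta>) * (cnj (u (cis \<theta>)) * u (cis \<theta>))"
      using abs_summable_on_product[OF countableI_type countableI_type x(1) yx(1)] infsetsum_product[OF countableI_type countableI_type x(1) yx(1)]
      by (simp_all only: UNIV_Times_UNIV x(2) y(2) yx(2)[unfolded UNIV_Times_UNIV case_prod_unfold] case_prod_unfold)
    have eq: "p i * cis (of_int (m i) * \<theta>) = cis (- (of_nat n * \<theta>)) * (case i of (a, b, c') \<Rightarrow> ?x a * (cnj (?x b) * ?x c'))" for i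
    proof -
      obtain a b c' where i: "i = (a, b, c')" by (cases i)
      have "cis (of_int (m i) * \<theta>)
          = cis (of_nat a * \<theta>) * (cis (- (of_nat b * \<theta>)) * cis (of_nat c' * \<theta>)) * cis (- (of_nat n * \<theta>))"
        unfolding cis_mult by (simp add: i m_def algebra_simps)
      then show ?thesis by (simp add: i p_def cis_cnj)
    qed
    show ?thesis
      unfolding eq using s by (auto simp: infsetsum_cmult_right mult_ac intro!: abs_summable_on_cmult_right)
  qed
  have lim1: "(\<lambda>N. circle_average p m UNIV N)
      \<longlonglongrightarrow> infsetsum (\<lambda>i. if m i = 0 then p i else 0) UNIV"
    using P[of 0] by (intro roots_of_unity_average_tendsto) simp
  have "infsetsum (\<lambda>i. if m i = 0 then p i else 0) UNIV = infsetsum p {(a, b, c'). a + c' = n + b}"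
    by (rule infsetsum_cong_neutral) (auto simp: m_def)
  also have "\<dots> = infsum p {(a, b, c'). a + c' = n + b}"
    using P[of 0] by (intro infsetsum_infsum) (auto intro: abs_summable_on_subset)
  also have "\<dots> = szego_nl c n" by (simp add: szego_nl_def p_def)
  finally have nl: "infsetsum (\<lambda>i. if m i = 0 then p i else 0) UNIV = szego_nl c n" .
  define f where "f = taylor_coeff F"
  define g where "g k = cnj (taylor_coeff G k)" for k
  have Fs: "infsetsum (\<lambda>k. f k * cis (of_int (int k - int n) * \<theta>)) UNIV = F (cis \<theta>) * cis (- (of_nat n * \<theta>))" for \<theta>
  proof -
    have "infsetsum (\<lambda>k. f k * cis (of_int (int k - int n) * \<theta>)) UNIV
        = infsetsum (\<lambda>k. f k * cis (of_nat k * \<theta>) * cis (- (of_nat n * \<theta>))) UNIV"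
      by (simp add: mult.assoc cis_mult algebra_simps)
    then show ?thesis
      using taylor_coeff_infsetsum[OF F r, of \<theta>] by (simp add: infsetsum_cmult_left f_def)
  qed
  have Gs: "infsetsum (\<lambda>k. g k * cis (of_int (- int k - int n) * \<theta>)) UNIV = cnj (G (cis \<theta>)) * cis (- (of_nat n * \<theta>))" for \<theta>
  proof -
    have "infsetsum (\<lambda>k. g k * cis (of_int (- int k - int n) * \<theta>)) UNIV
        = infsetsum (\<lambda>k. cnj (taylor_coeff G k * cis (of_nat k * \<theta>)) * cis (- (of_nat n * \<theta>))) UNIV"
      by (simp add: mult.assoc cis_mult cis_cnj g_def algebra_simps)
    then show ?thesis
      using cnj_sum[OF G, of \<theta>] by (simp add: infsetsum_cmult_left del: complex_cnj_mult)
  qed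
  have lim2: "(\<lambda>N. circle_average f (\<lambda>k. int k - int n) UNIV N)
      \<longlonglongrightarrow> infsetsum (\<lambda>k. if int k - int n = 0 then f k else 0) UNIV"
    using taylor_coeff_infsetsum(1)[OF F r, of 0] by (intro roots_of_unity_average_tendsto) (simp add: f_def)
  have lim3: "(\<lambda>N. circle_average g (\<lambda>k. - int k - int n) UNIV N)
      \<longlonglongrightarrow> infsetsum (\<lambda>k. if - int k - int n = 0 then g k else 0) UNIV"
    using cnj_sum(1)[OF G, of 0] by (intro roots_of_unity_average_tendsto) (simp add: g_def)
  have "infsetsum (\<lambda>k. if int k - int n = 0 then f k else 0) UNIV = infsetsum f {n}"
    by (rule infsetsum_cong_neutral) auto
  then have f: "infsetsum (\<lambda>k. if int k - int n = 0 then f k else 0) UNIV = f n" by simp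
  have g: "infsetsum (\<lambda>k. if - int k - int n = 0 then g k else 0) UNIV = 0"
    by (rule infsetsum_all_0) (auto simp: g_def taylor_coeff_def G0)
  have e: "u (cis \<theta>) * cnj (u (cis \<theta>)) * u (cis \<theta>) * x = F (cis \<theta>) * x + cnj (G (cis \<theta>)) * x" for \<theta> x
    using eq[of "cis \<theta>"] by (simp add: distrib_right)
  have "(\<lambda>N. circle_average p m UNIV N)
      \<longlonglongrightarrow> f n + 0"
    using tendsto_add[OF lim2 lim3] unfolding f g Fs Gs P[THEN conjunct2] e
    by (simp add: sum.distrib add_divide_distrib)
  from LIMSEQ_unique[OF lim1 this] nl show ?thesis by (simp add: c_def f_def)
qed

text \<open>Makes uniform convergence on a disc of radius greater than 1 imply convergence in
  H^{1/2}. Cauchy's estimate bounds the k-th coefficient by B / \<rho>^k, and the weighted squares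
  sum to a differentiated geometric series.\<close>

lemma h12_norm_taylor_coeff_le:
  assumes f: "f holomorphic_on ball 0 r" and \<rho>: "1 < \<rho>" "\<rho> < r" and B: "\<And>z. norm z = \<rho> \<Longrightarrow> norm (f z) \<le> B"
  shows "h12 (taylor_coeff f)" and "h12_norm (taylor_coeff f) \<le> B * (\<rho>\<^sup>2 / (\<rho>\<^sup>2 - 1))"
proof -
  define x where "x = 1 / \<rho>\<^sup>2"
  have x: "norm x < 1" using \<rho> by (simp add: x_def norm_divide one_less_power)
  have B0: "B \<ge> 0" using B[of "of_real \<rho>"] \<rho> by (auto intro: order_trans[OF norm_ge_zero])
  have geo: "(\<lambda>k. B\<^sup>2 * (of_nat (Suc k) * x ^ k)) sums (B\<^sup>2 * (1 / (1 - x)\<^sup>2))"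
    by (intro sums_mult geometric_deriv_sums x)
  have le: "(1 + real k) * (cmod (taylor_coeff f k))\<^sup>2 \<le> B\<^sup>2 * (of_nat (Suc k) * x ^ k)" for k
  proof -
    have "(cmod (taylor_coeff f k))\<^sup>2 \<le> (B / \<rho> ^ k)\<^sup>2"
      using norm_taylor_coeff_le[OF f _ \<rho>(2) B, of k] \<rho> by (intro power_mono) auto
    also have "\<dots> = B\<^sup>2 * x ^ k"
      by (simp add: x_def power_divide power_mult[symmetric] mult.commute)
    finally show ?thesis
      using mult_left_mono[of _ _ "1 + real k"] by (fastforce simp: mult_ac)
  qed
  show h: "h12 (taylor_coeff f)"
    unfolding h12_def by (rule summable_comparison_test'[OF sums_summable[OF geo], of 0]) (use le in auto)
  have "(h12_norm (taylor_coeff f))\<^sup>2 \<le> B\<^sup>2 * (1 / (1 - x)\<^sup>2)"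
  proof -
    have "(\<Sum>k. (1 + real k) * (cmod (taylor_coeff f k))\<^sup>2) \<le> (\<Sum>k. B\<^sup>2 * (of_nat (Suc k) * x ^ k))"
      using h le unfolding h12_def by (intro suminf_le sums_summable[OF geo]) auto
    then show ?thesis
      using geo h suminf_nonneg[of "\<lambda>k. (1 + real k) * (cmod (taylor_coeff f k))\<^sup>2"]
      by (simp add: h12_norm_def h12_def sums_iff)
  qed
  also have "\<dots> = (B * (\<rho>\<^sup>2 / (\<rho>\<^sup>2 - 1)))\<^sup>2"
  proof -
    have "1 - x = (\<rho>\<^sup>2 - 1) / \<rho>\<^sup>2" using \<rho> by (simp add: x_def field_simps)
    then show ?thesis by (simp add: power_mult_distrib power_divide)
  qed
  finally show "h12_norm (taylor_coeff f) \<le> B * (\<rho>\<^sup>2 / (\<rho>\<^sup>2 - 1))"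
    by (rule power2_le_imp_le) (use B0 \<rho> in \<open>auto intro!: mult_nonneg_nonneg divide_nonneg_nonneg\<close>)
qed

lemma h12_taylor_coeff:
  assumes "f holomorphic_on ball 0 r" "r > 1"
  shows "h12 (taylor_coeff f)"
proof -
  obtain \<rho> where \<rho>: "1 < \<rho>" "\<rho> < r" using dense[OF assms(2)] by blast
  obtain B where "\<And>z. norm z \<le> \<rho> \<Longrightarrow> norm (f z) \<le> B"
    using holomorphic_imp_bounded_circle[OF assms(1) \<rho>(2)] by metis
  then show ?thesis using h12_norm_taylor_coeff_le(1)[OF assms(1) \<rho>, of B] by simp
qed

lemma taylor_coeff_diff:
  assumes "f holomorphic_on ball 0 r" "g holomorphic_on ball 0 r" "r > 0"
  shows "taylor_coeff (\<lambda>z. f z - g z) k = taylor_coeff f k - taylor_coeff g k"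
  using higher_deriv_diff[OF assms(1,2), of 0 k] assms(3) by (simp add: taylor_coeff_def diff_divide_distrib)

section \<open>Limits of quotients of holomorphic functions\<close>

text \<open>Supplies the radius beyond 1 that Cauchy's estimates require: if there are zeros in a
  compact disc, one of them has least modulus, and this exceeds 1.\<close>

lemma nonzero_on_larger_ball:
  fixes f :: "complex \<Rightarrow> complex"
  assumes "f holomorphic_on ball 0 r" "r > 1" "\<And>z. norm z \<le> 1 \<Longrightarrow> f z \<noteq> 0"
  obtains \<rho> where "1 < \<rho>" "\<rho> < r" "\<And>z. norm z \<le> \<rho> \<Longrightarrow> f z \<noteq> 0"
proof -
  obtain R where R: "1 < R" "R < r" using dense[OF assms(2)] by blast
  define Z where "Z = {z \<in> cball 0 R. f z = 0}"
  have cont: "continuous_on (cball 0 R) f"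
    using assms R by (auto intro!: holomorphic_on_imp_continuous_on intro: holomorphic_on_subset)
  have "closed Z" unfolding Z_def
    using continuous_closed_preimage_constant[OF cont] by auto
  moreover have "Z \<subseteq> cball 0 R" by (auto simp: Z_def)
  ultimately have comp: "compact Z"
    using bounded_subset[OF bounded_cball] by (simp add: compact_eq_bounded_closed)
  show thesis
  proof (cases "Z = {}")
    case True
    then show ?thesis using R that[of R] by (auto simp: Z_def)
  next
    case False
    obtain w where w: "w \<in> Z" "\<And>z. z \<in> Z \<Longrightarrow> norm w \<le> norm z"
      using continuous_attains_inf[OF comp False continuous_on_norm[OF continuous_on_id]] by auto
    have "norm w > 1" using w(1) assms(3)[of w] by (auto simp: Z_def not_le[symmetric])
    then obtain \<rho> where \<rho>: "1 < \<rho>" "\<rho> < norm w" using dense by blast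
    have "norm w \<le> R" using w(1) by (auto simp: Z_def)
    show ?thesis
    proof (rule that[of \<rho>])
      fix z :: complex assume z: "norm z \<le> \<rho>"
      show "f z \<noteq> 0"
        using w(2)[of z] z \<rho> \<open>norm w \<le> R\<close> by (auto simp: Z_def)
    qed (use \<rho> \<open>norm w \<le> R\<close> R in auto)
  qed
qed

lemma uniform_limit_quotient_cball:
  fixes num den :: "'b \<Rightarrow> complex \<Rightarrow> complex"
  assumes hol: "num0 holomorphic_on ball 0 r" "den0 holomorphic_on ball 0 r"
    and lim: "uniform_limit (cball 0 R) num num0 F" "uniform_limit (cball 0 R) den den0 F"
    and R: "0 < R" "R < r" and nz: "\<And>z. norm z \<le> R \<Longrightarrow> den0 z \<noteq> 0"
  shows "uniform_limit (cball 0 R) (\<lambda>s z. num s z / den s z) (\<lambda>z. num0 z / den0 z) F"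
    and "\<forall>\<^sub>F s in F. \<forall>z\<in>cball 0 R. den s z \<noteq> 0"
proof -
  have cont: "continuous_on (cball 0 R) num0" "continuous_on (cball 0 R) den0"
    using R by (auto intro!: holomorphic_on_imp_continuous_on holomorphic_on_subset[OF hol(1)] holomorphic_on_subset[OF hol(2)])
  have "cball (0::complex) R \<noteq> {}" using R by simp
  then obtain w where w: "w \<in> cball 0 R" "\<And>z. z \<in> cball 0 R \<Longrightarrow> norm (den0 w) \<le> norm (den0 z)"
    using continuous_attains_inf[OF compact_cball _ continuous_on_norm[OF cont(2)]] by metis
  define b where "b = norm (den0 w)"
  have b: "b > 0" using w(1) nz by (auto simp: b_def)
  have "bounded (num0 ` cball 0 R)" by (intro compact_imp_bounded compact_continuous_image cont) auto
  then show "uniform_limit (cball 0 R) (\<lambda>s z. num s z / den s z) (\<lambda>z. num0 z / den0 z) F"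
    using lim w(2) b by (intro uniform_lim_divide[where b = b]) (auto simp: b_def)
  have "\<forall>\<^sub>F s in F. \<forall>z\<in>cball 0 R. dist (den s z) (den0 z) < b"
    using lim(2) b by (intro uniform_limitD) auto
  then show "\<forall>\<^sub>F s in F. \<forall>z\<in>cball 0 R. den s z \<noteq> 0"
  proof eventually_elim
    case (elim s)
    show ?case
    proof
      fix z :: complex assume z: "z \<in> cball 0 R"
      show "den s z \<noteq> 0" using elim[rule_format, OF z] w(2)[OF z] by (auto simp: b_def dist_norm)
    qed
  qed
qed

text \<open>Asks for a nonzero denominator only at the origin. When the \<open>b\<close> moduli
  merge, the limiting denominator at the observation time has zeros on the unit circle, where
  convergence in H^{1/2} is out of reach but single coefficients still converge.\<close>

lemma taylor_coeff_quotient_tendsto: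
  fixes num den :: "'b \<Rightarrow> complex \<Rightarrow> complex"
  assumes r: "r > 0" and hol: "\<And>s. num s holomorphic_on ball 0 r" "\<And>s. den s holomorphic_on ball 0 r"
      "num0 holomorphic_on ball 0 r" "den0 holomorphic_on ball 0 r"
    and lim: "\<And>R. R < r \<Longrightarrow> uniform_limit (cball 0 R) num num0 F" "\<And>R. R < r \<Longrightarrow> uniform_limit (cball 0 R) den den0 F"
    and nz: "den0 0 \<noteq> 0"
  shows "((\<lambda>s. taylor_coeff (\<lambda>z. num s z / den s z) k) \<longlongrightarrow> taylor_coeff (\<lambda>z. num0 z / den0 z) k) F"
proof -
  have "isCont den0 0"
    using hol(4) r by (intro holomorphic_on_imp_continuous_on[THEN continuous_on_interior]) auto
  then obtain d where d: "d > 0" "\<And>z. dist 0 z < d \<Longrightarrow> den0 z \<noteq> 0"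
    using continuous_at_avoid[of 0 den0 0] nz by blast
  define R where "R = min (d / 2) (r / 2)"
  have R: "0 < R" "R < r" "R < d" using d r by (auto simp: R_def)
  define \<rho> where "\<rho> = R / 2"
  have \<rho>: "0 < \<rho>" "\<rho> < R" using R by (auto simp: \<rho>_def)
  have nz': "den0 z \<noteq> 0" if "norm z \<le> R" for z using d(2)[of z] that R by simp
  have uq: "uniform_limit (cball 0 R) (\<lambda>s z. num s z / den s z) (\<lambda>z. num0 z / den0 z) F"
    "\<forall>\<^sub>F s in F. \<forall>z\<in>cball 0 R. den s z \<noteq> 0"
    using uniform_limit_quotient_cball[OF hol(3,4) lim(1)[OF R(2)] lim(2)[OF R(2)] R(1,2)] nz' by blast+
  show ?thesis
  proof (rule tendstoI)
    fix e :: real assume e: "e > 0"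
    have "e / 2 * \<rho> ^ k > 0" using e \<rho> by simp
    then have "\<forall>\<^sub>F s in F. \<forall>z\<in>cball 0 R. dist (num s z / den s z) (num0 z / den0 z) < e / 2 * \<rho> ^ k"
      using uniform_limitD[OF uq(1)] by blast
    with uq(2) show "\<forall>\<^sub>F s in F. dist (taylor_coeff (\<lambda>z. num s z / den s z) k) (taylor_coeff (\<lambda>z. num0 z / den0 z) k) < e"
    proof eventually_elim
      case (elim s)
      have h: "(\<lambda>z. num s z / den s z) holomorphic_on ball 0 R" "(\<lambda>z. num0 z / den0 z) holomorphic_on ball 0 R"
        using R elim(1) nz'
        by (auto intro!: holomorphic_on_divide holomorphic_on_subset[OF hol(1)] holomorphic_on_subset[OF hol(2)]
            holomorphic_on_subset[OF hol(3)] holomorphic_on_subset[OF hol(4)])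
      have "norm (taylor_coeff (\<lambda>z. num s z / den s z - num0 z / den0 z) k) \<le> e / 2 * \<rho> ^ k / \<rho> ^ k"
        using elim(2) \<rho> by (intro norm_taylor_coeff_le[OF holomorphic_on_diff[OF h] \<rho>]) (auto simp: dist_norm intro!: less_imp_le)
      also have "\<dots> < e" using e \<rho> by simp
      finally show ?case unfolding taylor_coeff_diff[OF h R(1)] dist_norm .
    qed
  qed
qed

lemma h12_dist_quotient_tendsto_0:
  fixes num den :: "'b \<Rightarrow> complex \<Rightarrow> complex"
  assumes r: "r > 1" and hol: "\<And>s. num s holomorphic_on ball 0 r" "\<And>s. den s holomorphic_on ball 0 r"
      "num0 holomorphic_on ball 0 r" "den0 holomorphic_on ball 0 r"
    and lim: "\<And>R. R < r \<Longrightarrow> uniform_limit (cball 0 R) num num0 F" "\<And>R. R < r \<Longrightarrow> uniform_limit (cball 0 R) den den0 F"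
    and nz: "\<And>z. norm z \<le> 1 \<Longrightarrow> den0 z \<noteq> 0"
  shows "((\<lambda>s. h12_dist (taylor_coeff (\<lambda>z. num s z / den s z)) (taylor_coeff (\<lambda>z. num0 z / den0 z))) \<longlongrightarrow> 0) F" (is "(?d \<longlongrightarrow> 0) F")
proof -
  obtain R where R: "1 < R" "R < r" "\<And>z. norm z \<le> R \<Longrightarrow> den0 z \<noteq> 0"
    using nonzero_on_larger_ball[OF hol(4) r nz] by metis
  obtain \<rho> where \<rho>: "1 < \<rho>" "\<rho> < R" using dense[OF R(1)] by blast
  have R0: "0 < R" using R by simp
  have uq: "uniform_limit (cball 0 R) (\<lambda>s z. num s z / den s z) (\<lambda>z. num0 z / den0 z) F"
    "\<forall>\<^sub>F s in F. \<forall>z\<in>cball 0 R. den s z \<noteq> 0"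
    using uniform_limit_quotient_cball[OF hol(3,4) lim(1)[OF R(2)] lim(2)[OF R(2)] R0 R(2)] R(3) by blast+
  define K where "K = \<rho>\<^sup>2 / (\<rho>\<^sup>2 - 1)"
  have K: "K > 0" using \<rho> by (simp add: K_def one_less_power)
  show ?thesis
  proof (rule tendstoI)
    fix e :: real assume e: "e > 0"
    have "\<forall>\<^sub>F s in F. \<forall>z\<in>cball 0 R. dist (num s z / den s z) (num0 z / den0 z) < e / (2 * K)"
      using uq(1) e K by (intro uniform_limitD) auto
    with uq(2) show "\<forall>\<^sub>F s in F. dist (?d s) 0 < e"
    proof eventually_elim
      case (elim s)
      have h: "(\<lambda>z. num s z / den s z) holomorphic_on ball 0 R" "(\<lambda>z. num0 z / den0 z) holomorphic_on ball 0 R"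
        using R elim(1)
        by (auto intro!: holomorphic_on_divide holomorphic_on_subset[OF hol(1)] holomorphic_on_subset[OF hol(2)]
            holomorphic_on_subset[OF hol(3)] holomorphic_on_subset[OF hol(4)])
      have dist_eq: "?d s
          = h12_norm (taylor_coeff (\<lambda>z. num s z / den s z - num0 z / den0 z))"
        unfolding h12_dist_def using R by (intro arg_cong[where f = h12_norm]) (auto simp: fun_eq_iff taylor_coeff_diff[OF h])
      also have "h12_norm (taylor_coeff (\<lambda>z. num s z / den s z - num0 z / den0 z)) \<le> e / (2 * K) * K"
        unfolding K_def using elim(2) \<rho>
        by (intro h12_norm_taylor_coeff_le(2)[OF holomorphic_on_diff[OF h] \<rho>]) (auto simp: dist_norm K_def intro!: less_imp_le)
      also have "\<dots> < e" using e K by simp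
      finally have "?d s < e" .
      moreover have "?d s \<ge> 0"
        unfolding dist_eq using h12_taylor_coeff[OF holomorphic_on_diff[OF h]] R
        by (simp add: h12_norm_def h12_def suminf_nonneg)
      ultimately show ?case by (simp add: dist_real_def)
    qed
  qed
qed

text \<open>Numerator and denominator of the explicit solution are polynomials in the parameters and
  in the values of the inner functions. On a compact set of arguments uniform continuity turns
  convergence of the parameters into uniform convergence in z.\<close>

lemma uniform_limit_continuous_compose:
  fixes P :: "'p :: heine_borel \<times> 'q :: heine_borel \<Rightarrow> 'c :: metric_space"
  assumes P: "continuous_on UNIV P" and c: "(c \<longlongrightarrow> c0) F" and f: "bounded (f ` S)"
  shows "uniform_limit S (\<lambda>s z. P (c s, f z)) (\<lambda>z. P (c0, f z)) F"
proof (rule uniform_limitI)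
  fix e :: real assume e: "e > 0"
  have comp: "compact (cball c0 1 \<times> closure (f ` S))"
    using f by (intro compact_Times compact_cball) (simp add: compact_closure)
  have "uniformly_continuous_on (cball c0 1 \<times> closure (f ` S)) P"
    by (rule compact_uniformly_continuous[OF continuous_on_subset[OF P] comp]) simp
  then obtain d where d: "d > 0" "\<And>x y. x \<in> cball c0 1 \<times> closure (f ` S) \<Longrightarrow> y \<in> cball c0 1 \<times> closure (f ` S)
      \<Longrightarrow> dist y x < d \<Longrightarrow> dist (P y) (P x) < e"
    using e unfolding uniformly_continuous_on_def by metis
  have "\<forall>\<^sub>F s in F. dist (c s) c0 < min d 1" using c d by (intro tendstoD) auto
  then show "\<forall>\<^sub>F s in F. \<forall>z\<in>S. dist (P (c s, f z)) (P (c0, f z)) < e"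
  proof eventually_elim
    case (elim s)
    show ?case
    proof
      fix z assume z: "z \<in> S"
      then have fz: "f z \<in> closure (f ` S)" by (intro subsetD[OF closure_subset] imageI)
      have "dist (c s, f z) (c0, f z) = dist (c s) c0" by (simp add: dist_Pair_Pair)
      then show "dist (P (c s, f z)) (P (c0, f z)) < e"
        using elim fz by (intro d(2)) (simp_all add: dist_commute[of c0])
    qed
  qed
qed

section \<open>Cauchy matrices and explicit solutions\<close>

text \<open>Coefficientwise differentiation, the notion that \<open>szego_solution\<close> demands.
  Coefficients of products and inverses of formal power series are finite expressions, so no limits
  have to be interchanged.\<close>

definition fps_has_deriv :: "(real \<Rightarrow> complex fps) \<Rightarrow> complex fps \<Rightarrow> real \<Rightarrow> bool" where
  "fps_has_deriv f f' t \<longleftrightarrow> (\<forall>n. ((\<lambda>s. fps_nth (f s) n) has_vector_derivative fps_nth f' n) (at t))"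

lemma fps_has_deriv_const [intro]: "fps_has_deriv (\<lambda>_. f) 0 t"
  by (simp add: fps_has_deriv_def)

lemma fps_has_deriv_fps_const [intro]:
  "(a has_vector_derivative a') (at t) \<Longrightarrow> fps_has_deriv (\<lambda>s. fps_const (a s)) (fps_const a') t"
  by (simp add: fps_has_deriv_def)

lemma fps_has_deriv_add [intro]:
  "fps_has_deriv f f' t \<Longrightarrow> fps_has_deriv g g' t \<Longrightarrow> fps_has_deriv (\<lambda>s. f s + g s) (f' + g') t"
  by (simp add: fps_has_deriv_def has_vector_derivative_add)

lemma fps_has_deriv_diff [intro]:
  "fps_has_deriv f f' t \<Longrightarrow> fps_has_deriv g g' t \<Longrightarrow> fps_has_deriv (\<lambda>s. f s - g s) (f' - g') t"
  by (simp add: fps_has_deriv_def has_vector_derivative_diff)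

lemma fps_has_deriv_mult [intro]:
  assumes "fps_has_deriv f f' t" "fps_has_deriv g g' t"
  shows "fps_has_deriv (\<lambda>s. f s * g s) (f' * g t + f t * g') t"
  unfolding fps_has_deriv_def fps_mult_nth fps_add_nth
proof
  fix n
  have "((\<lambda>s. \<Sum>i=0..n. fps_nth (f s) i * fps_nth (g s) (n - i)) has_vector_derivative
      (\<Sum>i=0..n. fps_nth (f t) i * fps_nth g' (n - i) + fps_nth f' i * fps_nth (g t) (n - i))) (at t)"
    using assms unfolding fps_has_deriv_def by (intro has_vector_derivative_sum has_vector_derivative_mult) auto
  then show "((\<lambda>s. \<Sum>i=0..n. fps_nth (f s) i * fps_nth (g s) (n - i)) has_vector_derivative
      (\<Sum>i=0..n. fps_nth f' i * fps_nth (g t) (n - i)) + (\<Sum>i=0..n. fps_nth (f t) i * fps_nth g' (n - i))) (at t)"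
    by (simp add: sum.distrib add.commute)
qed

lemma fps_has_deriv_unique:
  "fps_has_deriv f f' t \<Longrightarrow> fps_has_deriv f f'' t \<Longrightarrow> f' = f''"
  unfolding fps_has_deriv_def fps_eq_iff by (blast intro: vector_derivative_unique_at)

text \<open>Existence is enough: the actual derivative of the solution is found by differentiating
  the linear systems. The n-th coefficient of the inverse is computed from earlier ones, so
  induction on n applies.\<close>

lemma fps_has_deriv_inverse:
  assumes f: "fps_has_deriv f f' t" and nz: "\<And>s. fps_nth (f s) 0 \<noteq> 0"
  shows "\<exists>g'. fps_has_deriv (\<lambda>s. inverse (f s)) g' t"
proof -
  have rec: "fps_nth (inverse (f s)) n = ((if n = 0 then 1 else 0)
      - (\<Sum>i=1..n. fps_nth (f s) i * fps_nth (inverse (f s)) (n - i))) * inverse (fps_nth (f s) 0)" for s n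
  proof -
    have "fps_nth (f s * inverse (f s)) n = (if n = 0 then 1 else 0)"
      using nz[of s] by (simp add: inverse_mult_eq_1')
    moreover have "fps_nth (f s * inverse (f s)) n = fps_nth (f s) 0 * fps_nth (inverse (f s)) n
        + (\<Sum>i=1..n. fps_nth (f s) i * fps_nth (inverse (f s)) (n - i))"
      by (simp add: fps_mult_nth sum.atLeast_Suc_atMost)
    ultimately show ?thesis using nz[of s] by (simp add: field_simps)
  qed
  have fd: "\<exists>d. ((\<lambda>s. fps_nth (f s) i) has_vector_derivative d) (at t)" for i
    using f unfolding fps_has_deriv_def by blast
  have "\<exists>d. ((\<lambda>s. fps_nth (inverse (f s)) n) has_vector_derivative d) (at t)" for n
  proof (induction n rule: less_induct)
    case (less n)
    have "\<exists>d. ((\<lambda>s. inverse (fps_nth (f s) 0)) has_vector_derivative d) (at t)"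
    proof -
      obtain d where "((\<lambda>s. fps_nth (f s) 0) has_vector_derivative d) (at t)" using fd by blast
      from field_vector_diff_chain_at[OF this DERIV_inverse[OF nz[of t]]] show ?thesis
        by (auto simp: o_def)
    qed
    then obtain d0 where d0: "((\<lambda>s. inverse (fps_nth (f s) 0)) has_vector_derivative d0) (at t)" by blast
    have "\<exists>d. ((\<lambda>s. fps_nth (f s) i * fps_nth (inverse (f s)) (n - i)) has_vector_derivative d) (at t)"
      if "i \<in> {1..n}" for i
      using fd[of i] less[of "n - i"] that by (fastforce intro: has_vector_derivative_mult)
    then obtain d where "\<And>i. i \<in> {1..n} \<Longrightarrow>
        ((\<lambda>s. fps_nth (f s) i * fps_nth (inverse (f s)) (n - i)) has_vector_derivative d i) (at t)"
      by metis
    then have "((\<lambda>s. \<Sum>i=1..n. fps_nth (f s) i * fps_nth (inverse (f s)) (n - i))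
        has_vector_derivative (\<Sum>i=1..n. d i)) (at t)"
      by (intro has_vector_derivative_sum)
    from has_vector_derivative_mult[OF has_vector_derivative_diff[OF has_vector_derivative_const this] d0]
    show ?case by (subst rec) blast
  qed
  then obtain d where "\<And>n. ((\<lambda>s. fps_nth (inverse (f s)) n) has_vector_derivative d n) (at t)" by metis
  then have "fps_has_deriv (\<lambda>s. inverse (f s)) (Abs_fps d) t" by (simp add: fps_has_deriv_def)
  then show ?thesis ..
qed

lemma taylor_coeff_eqI: "f has_fps_expansion F \<Longrightarrow> taylor_coeff f n = fps_nth F n"
  by (simp add: taylor_coeff_def fps_nth_fps_expansion)

section \<open>Algebra of Cauchy matrices\<close>

lemma linear_system_2:
  fixes c11 c12 c21 c22 :: "'a :: field"
  assumes "c11 * c22 - c12 * c21 \<noteq> 0" "c11 * x + c12 * y = 0" "c21 * x + c22 * y = 0"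
  shows "x = 0" "y = 0"
proof -
  have "(c11 * c22 - c12 * c21) * x = c22 * (c11 * x + c12 * y) - c12 * (c21 * x + c22 * y)"
    "(c11 * c22 - c12 * c21) * y = c11 * (c21 * x + c22 * y) - c21 * (c11 * x + c12 * y)"
    by (simp_all add: algebra_simps)
  then show "x = 0" "y = 0" using assms by simp_all
qed

text \<open>The relation \<open>cnj c\<^sub>k\<^sub>j a\<^sub>j + cnj b\<^sub>k c\<^sub>k\<^sub>j = 1\<close> expresses that the matrix
  \<open>c\<^sub>k\<^sub>j = (a\<^sub>j - b\<^sub>k) / (|a\<^sub>j|\<^sup>2 - |b\<^sub>k|\<^sup>2)\<close> is of Cauchy type.\<close>

lemma cauchy_matrix_cubic_identity:
  fixes a1 a2 b1 b2 :: complex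
  assumes C: "cnj c11 * a1 + cnj b1 * c11 = 1" "cnj c12 * a2 + cnj b1 * c12 = 1"
      "cnj c21 * a1 + cnj b2 * c21 = 1" "cnj c22 * a2 + cnj b2 * c22 = 1"
    and det: "c11 * c22 - c12 * c21 \<noteq> 0"
    and \<xi>: "c11 * x1 + c12 * x2 = 1" "c21 * x1 + c22 * x2 = 1"
    and \<eta>: "c11 * y1 + c21 * y2 = 1" "c12 * y1 + c22 * y2 = 1"
    and \<zeta>: "c11 * z1 + c12 * z2 = b1" "c21 * z1 + c22 * z2 = b2"
  defines "u \<equiv> x1 + x2"
  shows "u * cnj u * u = (a1 * cnj a1 * x1 + a2 * cnj a2 * x2 + u * (b1 * y1 + b2 * y2))
      + cnj (a1 * z1 + a2 * z2)"
proof -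
  have row: "cnj c11 * (a1 * x1) + cnj c12 * (a2 * x2) = u - cnj b1"
    "cnj c21 * (a1 * x1) + cnj c22 * (a2 * x2) = u - cnj b2"
  proof -
    have "cnj c11 * (a1 * x1) + cnj c12 * (a2 * x2)
        = (cnj c11 * a1 + cnj b1 * c11) * x1 + (cnj c12 * a2 + cnj b1 * c12) * x2 - cnj b1 * (c11 * x1 + c12 * x2)"
      by (simp add: algebra_simps)
    then show "cnj c11 * (a1 * x1) + cnj c12 * (a2 * x2) = u - cnj b1"
      unfolding C \<xi> u_def by simp
    have "cnj c21 * (a1 * x1) + cnj c22 * (a2 * x2)
        = (cnj c21 * a1 + cnj b2 * c21) * x1 + (cnj c22 * a2 + cnj b2 * c22) * x2 - cnj b2 * (c21 * x1 + c22 * x2)"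
      by (simp add: algebra_simps)
    then show "cnj c21 * (a1 * x1) + cnj c22 * (a2 * x2) = u - cnj b2"
      unfolding C \<xi> u_def by simp
  qed
  have cnjs: "cnj c11 * cnj x1 + cnj c12 * cnj x2 = 1" "cnj c21 * cnj x1 + cnj c22 * cnj x2 = 1"
    "cnj c11 * cnj z1 + cnj c12 * cnj z2 = cnj b1" "cnj c21 * cnj z1 + cnj c22 * cnj z2 = cnj b2"
    unfolding complex_cnj_mult[symmetric] complex_cnj_add[symmetric] \<xi> \<zeta> by simp_all
  have det': "cnj c11 * cnj c22 - cnj c12 * cnj c21 \<noteq> 0"
    using det by (simp flip: complex_cnj_mult complex_cnj_diff)
  \<comment> \<open>Combining \<open>row\<close> with the conjugated systems for \<open>x\<close>
    and \<open>z\<close> shows that the vector with entries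
    \<open>aj * xj - u * cnj xj + cnj zj\<close> is annihilated by the conjugate matrix, and so
    vanishes.\<close>
  have "cnj c11 * (a1 * x1 - u * cnj x1 + cnj z1) + cnj c12 * (a2 * x2 - u * cnj x2 + cnj z2) = 0"
  proof -
    have "cnj c11 * (a1 * x1 - u * cnj x1 + cnj z1) + cnj c12 * (a2 * x2 - u * cnj x2 + cnj z2)
        = (cnj c11 * (a1 * x1) + cnj c12 * (a2 * x2)) - u * (cnj c11 * cnj x1 + cnj c12 * cnj x2)
          + (cnj c11 * cnj z1 + cnj c12 * cnj z2)"
      by (simp add: algebra_simps)
    then show ?thesis unfolding row cnjs by simp
  qed
  moreover have "cnj c21 * (a1 * x1 - u * cnj x1 + cnj z1) + cnj c22 * (a2 * x2 - u * cnj x2 + cnj z2) = 0"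
  proof -
    have "cnj c21 * (a1 * x1 - u * cnj x1 + cnj z1) + cnj c22 * (a2 * x2 - u * cnj x2 + cnj z2)
        = (cnj c21 * (a1 * x1) + cnj c22 * (a2 * x2)) - u * (cnj c21 * cnj x1 + cnj c22 * cnj x2)
          + (cnj c21 * cnj z1 + cnj c22 * cnj z2)"
      by (simp add: algebra_simps)
    then show ?thesis unfolding row cnjs by simp
  qed
  ultimately have "a1 * x1 - u * cnj x1 + cnj z1 = 0" "a2 * x2 - u * cnj x2 + cnj z2 = 0"
    using linear_system_2[OF det'] by blast+
  then have ax: "u * cnj x1 = a1 * x1 + cnj z1" "u * cnj x2 = a2 * x2 + cnj z2"
    by (simp_all add: algebra_simps)
  \<comment> \<open>The matrix is paired with \<open>y\<close> on the left and \<open>x\<close> on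
    the right, and evaluated in both orders.\<close>
  have "y1 + y2 = u"
  proof -
    have "y1 + y2 = y1 * (c11 * x1 + c12 * x2) + y2 * (c21 * x1 + c22 * x2)" unfolding \<xi> by simp
    also have "\<dots> = (c11 * y1 + c21 * y2) * x1 + (c12 * y1 + c22 * y2) * x2" by (simp add: algebra_simps)
    also have "\<dots> = u" unfolding \<eta> by (simp add: u_def)
    finally show ?thesis .
  qed
  \<comment> \<open>Pairing the conjugate of \<open>row\<close> with \<open>y\<close> expresses
    |u|^2 as a part in \<open>y\<close> plus the conjugate of \<open>a1 * x1 + a2 * x2\<close>. The
    factor u is absorbed into the conjugated part by \<open>ax\<close>.\<close>
  moreover have "c11 * cnj (a1 * x1) + c12 * cnj (a2 * x2) = cnj u - b1"
    "c21 * cnj (a1 * x1) + c22 * cnj (a2 * x2) = cnj u - b2"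
    using arg_cong[OF row(1), of cnj] arg_cong[OF row(2), of cnj] by simp_all
  then have "y1 * (c11 * cnj (a1 * x1) + c12 * cnj (a2 * x2)) + y2 * (c21 * cnj (a1 * x1) + c22 * cnj (a2 * x2))
      = y1 * (cnj u - b1) + y2 * (cnj u - b2)" by simp
  then have "(c11 * y1 + c21 * y2) * cnj (a1 * x1) + (c12 * y1 + c22 * y2) * cnj (a2 * x2)
      = (y1 + y2) * cnj u - (b1 * y1 + b2 * y2)"
    by (simp add: algebra_simps)
  ultimately have mod_u: "u * cnj u = b1 * y1 + b2 * y2 + cnj (a1 * x1 + a2 * x2)"
    unfolding \<eta> by (simp add: algebra_simps)
  have "u * cnj (a1 * x1 + a2 * x2) = cnj a1 * (u * cnj x1) + cnj a2 * (u * cnj x2)"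
    by (simp add: algebra_simps)
  also have "\<dots> = a1 * cnj a1 * x1 + a2 * cnj a2 * x2 + cnj (a1 * z1 + a2 * z2)"
    unfolding ax by (simp add: algebra_simps)
  finally show ?thesis
    unfolding mod_u by (simp add: algebra_simps)
qed

lemma cmod_real_combination_squared:
  "(cmod (of_real p * x + of_real q * y))\<^sup>2 = p\<^sup>2 * (cmod x)\<^sup>2 + q\<^sup>2 * (cmod y)\<^sup>2 + 2 * p * q * Re (x * cnj y)"
  unfolding cmod_power2 by (simp add: power2_eq_square algebra_simps)

text \<open>A kernel vector would satisfy \<open>m y = B m (x1, v)\<close> row by row, with
  \<open>yj = aj * xj\<close> and \<open>v = \<psi> * x2\<close>. Taking squared moduli, using
  |B_k|^2 <= \<beta>_k and adding the rows with suitable positive weights leaves a sum of two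
  nonnegative terms that is at most 0. Hence x1 = - v and |\<psi>| = 1, and the second row then
  forces \<open>a2 * cnj \<psi> = a1\<close>, against the strict ordering of the moduli.\<close>

lemma cauchy_matrix_det_nonzero:
  fixes a1 a2 B1 B2 \<psi> :: complex and \<beta>1 \<beta>2 :: real
  defines "\<alpha>1 \<equiv> (cmod a1)\<^sup>2" and "\<alpha>2 \<equiv> (cmod a2)\<^sup>2"
  assumes ord: "\<beta>1 < \<alpha>1" "\<alpha>2 < \<beta>1" "\<beta>2 < \<alpha>2" "0 \<le> \<beta>2"
    and B: "(cmod B1)\<^sup>2 \<le> \<beta>1" "(cmod B2)\<^sup>2 \<le> \<beta>2" and \<psi>: "cmod \<psi> \<le> 1"
  shows "(a1 - B1) / of_real (\<alpha>1 - \<beta>1) * ((a2 - \<psi> * B2) / of_real (\<alpha>2 - \<beta>2))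
      - (a2 - \<psi> * B1) / of_real (\<alpha>2 - \<beta>1) * ((a1 - B2) / of_real (\<alpha>1 - \<beta>2)) \<noteq> 0"
proof
  define m11 m12 m21 m22 where "m11 = 1 / (\<alpha>1 - \<beta>1)" and "m12 = 1 / (\<alpha>2 - \<beta>1)"
    and "m21 = 1 / (\<alpha>1 - \<beta>2)" and "m22 = 1 / (\<alpha>2 - \<beta>2)"
  define c11 c12 c21 c22 where "c11 = (a1 - B1) / of_real (\<alpha>1 - \<beta>1)" and "c12 = (a2 - \<psi> * B1) / of_real (\<alpha>2 - \<beta>1)"
    and "c21 = (a1 - B2) / of_real (\<alpha>1 - \<beta>2)" and "c22 = (a2 - \<psi> * B2) / of_real (\<alpha>2 - \<beta>2)"
  assume "(a1 - B1) / of_real (\<alpha>1 - \<beta>1) * ((a2 - \<psi> * B2) / of_real (\<alpha>2 - \<beta>2))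
      - (a2 - \<psi> * B1) / of_real (\<alpha>2 - \<beta>1) * ((a1 - B2) / of_real (\<alpha>1 - \<beta>2)) = 0"
  then have det: "c11 * c22 - c12 * c21 = 0" by (simp add: c11_def c12_def c21_def c22_def)
  define x1 x2 where "x1 = - c12" and "x2 = c11"
  have x2: "x2 \<noteq> 0"
  proof
    assume "x2 = 0"
    then have "a1 = B1" using ord by (simp add: x2_def c11_def)
    then show False using B ord by (simp add: \<alpha>1_def)
  qed
  have kern: "c11 * x1 + c12 * x2 = 0" "c21 * x1 + c22 * x2 = 0"
    using det by (simp_all add: x1_def x2_def algebra_simps)
  define y1 y2 where "y1 = a1 * x1" and "y2 = a2 * x2"
  define v where "v = \<psi> * x2"
  have k1: "of_real m11 * y1 + of_real m12 * y2 = B1 * (of_real m11 * x1 + of_real m12 * v)"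
    and k2: "of_real m21 * y1 + of_real m22 * y2 = B2 * (of_real m21 * x1 + of_real m22 * v)"
    using kern unfolding c11_def c12_def c21_def c22_def m11_def m12_def m21_def m22_def y1_def y2_def v_def
    by (simp_all add: diff_divide_distrib algebra_simps)
  have le1: "(cmod (of_real m11 * y1 + of_real m12 * y2))\<^sup>2 \<le> \<beta>1 * (cmod (of_real m11 * x1 + of_real m12 * v))\<^sup>2"
    and le2: "(cmod (of_real m21 * y1 + of_real m22 * y2))\<^sup>2 \<le> \<beta>2 * (cmod (of_real m21 * x1 + of_real m22 * v))\<^sup>2"
    unfolding k1 k2 norm_mult power_mult_distrib using B by (intro mult_right_mono; simp)+
  \<comment> \<open>The solution of the transposed system with right side (1, 1) for the real Cauchy
    matrix \<open>m\<close>. Interlacing makes both weights positive, and with respect to them the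
    columns of \<open>m\<close> are orthogonal, so the mixed terms in \<open>y\<close>
    cancel.\<close>
  define \<tau>1 \<tau>2 where "\<tau>1 = (\<alpha>1 - \<beta>1) * (\<beta>1 - \<alpha>2) / (\<beta>1 - \<beta>2)" and "\<tau>2 = (\<alpha>1 - \<beta>2) * (\<alpha>2 - \<beta>2) / (\<beta>1 - \<beta>2)"
  have \<tau>: "\<tau>1 > 0" "\<tau>2 > 0" using ord by (auto simp: \<tau>1_def \<tau>2_def)
  define T1 T2 where "T1 = \<tau>1 * m11\<^sup>2 + \<tau>2 * m21\<^sup>2" and "T2 = \<tau>1 * m12\<^sup>2 + \<tau>2 * m22\<^sup>2"
  have T: "T1 > 0" "T2 > 0"
    using \<tau> ord by (auto simp: T1_def T2_def m11_def m12_def m21_def m22_def intro!: add_pos_pos mult_pos_pos)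
  have nz: "\<alpha>1 - \<beta>1 \<noteq> 0" "\<alpha>2 - \<beta>1 \<noteq> 0" "\<alpha>1 - \<beta>2 \<noteq> 0" "\<alpha>2 - \<beta>2 \<noteq> 0" "\<beta>1 - \<beta>2 \<noteq> 0"
    using ord by auto
  have \<tau>m: "\<tau>1 * m11 = (\<beta>1 - \<alpha>2) / (\<beta>1 - \<beta>2)" "\<tau>1 * m12 = - (\<alpha>1 - \<beta>1) / (\<beta>1 - \<beta>2)"
      "\<tau>2 * m21 = (\<alpha>2 - \<beta>2) / (\<beta>1 - \<beta>2)" "\<tau>2 * m22 = (\<alpha>1 - \<beta>2) / (\<beta>1 - \<beta>2)"
    using nz by (auto simp: \<tau>1_def \<tau>2_def m11_def m12_def m21_def m22_def divide_simps) (simp_all add: algebra_simps)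
  have off: "\<tau>1 * m11 * m12 = - 1 / (\<beta>1 - \<beta>2)" "\<tau>2 * m21 * m22 = 1 / (\<beta>1 - \<beta>2)"
    using nz unfolding \<tau>m by (auto simp: m12_def m22_def divide_simps)
  have \<beta>m: "m11 * \<beta>1 = m11 * \<alpha>1 - 1" "m12 * \<beta>1 = m12 * \<alpha>2 - 1" "m21 * \<beta>2 = m21 * \<alpha>1 - 1" "m22 * \<beta>2 = m22 * \<alpha>2 - 1"
    using nz by (auto simp: m11_def m12_def m21_def m22_def field_simps)
  have one: "\<tau>1 * m11 + \<tau>2 * m21 = 1" "\<tau>1 * m12 + \<tau>2 * m22 = 1"
    using nz unfolding \<tau>m by (simp_all add: add_divide_distrib[symmetric])
  have d1: "\<beta>1 * \<tau>1 * m11\<^sup>2 + \<beta>2 * \<tau>2 * m21\<^sup>2 = \<alpha>1 * T1 - 1"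
  proof -
    have "\<beta>1 * \<tau>1 * m11\<^sup>2 + \<beta>2 * \<tau>2 * m21\<^sup>2 = (\<tau>1 * m11) * (m11 * \<beta>1) + (\<tau>2 * m21) * (m21 * \<beta>2)"
      by (simp add: power2_eq_square algebra_simps)
    also have "\<dots> = \<alpha>1 * T1 - (\<tau>1 * m11 + \<tau>2 * m21)"
      unfolding \<beta>m T1_def by (simp add: power2_eq_square algebra_simps)
    finally show ?thesis unfolding one .
  qed
  have d2: "\<beta>1 * \<tau>1 * m12\<^sup>2 + \<beta>2 * \<tau>2 * m22\<^sup>2 = \<alpha>2 * T2 - 1"
  proof -
    have "\<beta>1 * \<tau>1 * m12\<^sup>2 + \<beta>2 * \<tau>2 * m22\<^sup>2 = (\<tau>1 * m12) * (m12 * \<beta>1) + (\<tau>2 * m22) * (m22 * \<beta>2)"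
      by (simp add: power2_eq_square algebra_simps)
    also have "\<dots> = \<alpha>2 * T2 - (\<tau>1 * m12 + \<tau>2 * m22)"
      unfolding \<beta>m T2_def by (simp add: power2_eq_square algebra_simps)
    finally show ?thesis unfolding one .
  qed
  have d3: "\<beta>1 * (\<tau>1 * m11 * m12) + \<beta>2 * (\<tau>2 * m21 * m22) = - 1" "\<tau>1 * m11 * m12 + \<tau>2 * m21 * m22 = 0"
  proof -
    have "\<beta>1 * (- 1 / (\<beta>1 - \<beta>2)) + \<beta>2 * (1 / (\<beta>1 - \<beta>2)) = - ((\<beta>1 - \<beta>2) / (\<beta>1 - \<beta>2))"
      unfolding diff_divide_distrib by simp
    then show "\<beta>1 * (\<tau>1 * m11 * m12) + \<beta>2 * (\<tau>2 * m21 * m22) = - 1"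
      unfolding off using nz by simp
    show "\<tau>1 * m11 * m12 + \<tau>2 * m21 * m22 = 0" unfolding off by simp
  qed
  let ?Q1 = "\<tau>1 * (cmod (of_real m11 * y1 + of_real m12 * y2))\<^sup>2 + \<tau>2 * (cmod (of_real m21 * y1 + of_real m22 * y2))\<^sup>2"
  let ?Q2 = "\<tau>1 * (\<beta>1 * (cmod (of_real m11 * x1 + of_real m12 * v))\<^sup>2) + \<tau>2 * (\<beta>2 * (cmod (of_real m21 * x1 + of_real m22 * v))\<^sup>2)"
  have Q1: "?Q1
      = T1 * (cmod y1)\<^sup>2 + T2 * (cmod y2)\<^sup>2"
  proof -
    have "?Q1
      = T1 * (cmod y1)\<^sup>2 + T2 * (cmod y2)\<^sup>2 + 2 * Re (y1 * cnj y2) * (\<tau>1 * m11 * m12 + \<tau>2 * m21 * m22)"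
      unfolding cmod_real_combination_squared T1_def T2_def by (simp add: algebra_simps)
    then show ?thesis unfolding d3 by simp
  qed
  have Q2: "?Q2
      = \<alpha>1 * T1 * (cmod x1)\<^sup>2 + \<alpha>2 * T2 * (cmod v)\<^sup>2 - (cmod (x1 + v))\<^sup>2"
  proof -
    have "?Q2
      = (\<beta>1 * \<tau>1 * m11\<^sup>2 + \<beta>2 * \<tau>2 * m21\<^sup>2) * (cmod x1)\<^sup>2 + (\<beta>1 * \<tau>1 * m12\<^sup>2 + \<beta>2 * \<tau>2 * m22\<^sup>2) * (cmod v)\<^sup>2
        + 2 * Re (x1 * cnj v) * (\<beta>1 * (\<tau>1 * m11 * m12) + \<beta>2 * (\<tau>2 * m21 * m22))"
      unfolding cmod_real_combination_squared by (simp add: algebra_simps)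
    also have "\<dots> = \<alpha>1 * T1 * (cmod x1)\<^sup>2 + \<alpha>2 * T2 * (cmod v)\<^sup>2 - ((cmod x1)\<^sup>2 + (cmod v)\<^sup>2 + 2 * Re (x1 * cnj v))"
      unfolding d1 d2 d3 by (simp add: algebra_simps)
    also have "(cmod x1)\<^sup>2 + (cmod v)\<^sup>2 + 2 * Re (x1 * cnj v) = (cmod (x1 + v))\<^sup>2"
      using cmod_real_combination_squared[of 1 x1 1 v] by simp
    finally show ?thesis .
  qed
  have ny: "(cmod y1)\<^sup>2 = \<alpha>1 * (cmod x1)\<^sup>2" "(cmod y2)\<^sup>2 = \<alpha>2 * (cmod x2)\<^sup>2"
    by (simp_all add: y1_def y2_def norm_mult power_mult_distrib \<alpha>1_def \<alpha>2_def)
  have "?Q1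
      \<le> ?Q2"
    using le1 le2 \<tau> by (intro add_mono mult_left_mono) auto
  then have main: "\<alpha>2 * T2 * ((cmod x2)\<^sup>2 - (cmod v)\<^sup>2) + (cmod (x1 + v))\<^sup>2 \<le> 0"
    unfolding Q1 Q2 ny by (simp add: algebra_simps)
  have v_le: "(cmod v)\<^sup>2 \<le> (cmod x2)\<^sup>2"
    unfolding v_def norm_mult using \<psi> by (intro power_mono) (auto simp: mult_left_le_one_le)
  have \<alpha>2: "\<alpha>2 > 0" using ord by linarith
  have p1: "\<alpha>2 * T2 * ((cmod x2)\<^sup>2 - (cmod v)\<^sup>2) \<ge> 0" using v_le T \<alpha>2 by simp
  have p2: "(cmod (x1 + v))\<^sup>2 \<ge> 0" by simp
  have "(cmod (x1 + v))\<^sup>2 = 0" using main p1 p2 by linarith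
  then have x1v: "x1 = - v" by (simp add: eq_neg_iff_add_eq_0)
  have "\<alpha>2 * T2 * ((cmod x2)\<^sup>2 - (cmod v)\<^sup>2) = 0" using main p1 p2 by linarith
  then have "(cmod x2)\<^sup>2 = (cmod v)\<^sup>2" using T \<alpha>2 by simp
  then have "(cmod \<psi>)\<^sup>2 = 1\<^sup>2"
    using x2 by (simp add: v_def norm_mult power_mult_distrib)
  then have \<psi>1: "cmod \<psi> = 1" by (rule power2_eq_imp_eq) auto
  define a2' where "a2' = a2 * cnj \<psi>"
  have \<psi>\<psi>: "\<psi> * cnj \<psi> = 1" using \<psi>1 by (simp add: complex_norm_square[symmetric])
  have na2': "(cmod a2')\<^sup>2 = \<alpha>2" by (simp add: a2'_def norm_mult \<psi>1 \<alpha>2_def)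
  have y2': "y2 = a2' * v"
  proof -
    have "a2' * v = a2 * (\<psi> * cnj \<psi>) * x2" by (simp add: a2'_def v_def mult_ac)
    then show ?thesis by (simp only: \<psi>\<psi> y2_def mult_1_right)
  qed
  have v0: "v \<noteq> 0" using x2 \<psi>1 by (auto simp: v_def)
  \<comment> \<open>The case of equality. The second row is the useful one because
    \<open>m21\<close> and \<open>m22\<close> are both positive; its squared modulus gives
    \<open>m21 * m22 * |a2' - a1|^2 <= 0\<close>.\<close>
  have "of_real m22 * a2' - of_real m21 * a1 = B2 * (of_real m22 - of_real m21)"
  proof -
    have "v * (of_real m22 * a2' - of_real m21 * a1) = v * (B2 * (of_real m22 - of_real m21))"
      using k2 unfolding y2' y1_def x1v by (simp add: algebra_simps)
    then show ?thesis using v0 by simp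
  qed
  then have "(cmod (of_real m22 * a2' + of_real (- m21) * a1))\<^sup>2 = (cmod B2)\<^sup>2 * (m22 - m21)\<^sup>2"
    by (simp add: norm_mult power_mult_distrib flip: of_real_diff)
  then have "m22\<^sup>2 * \<alpha>2 + m21\<^sup>2 * \<alpha>1 - 2 * m22 * m21 * Re (a2' * cnj a1) = (cmod B2)\<^sup>2 * (m22 - m21)\<^sup>2"
    unfolding cmod_real_combination_squared na2' by (simp add: \<alpha>1_def)
  also have "\<dots> \<le> \<beta>2 * (m22 - m21)\<^sup>2" using B by (intro mult_right_mono) auto
  finally have "m22 * (m22 * \<alpha>2 - m22 * \<beta>2) + m21 * (m21 * \<alpha>1 - m21 * \<beta>2) + 2 * m22 * (m21 * \<beta>2) - 2 * m22 * m21 * Re (a2' * cnj a1) \<le> 0"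
    by (simp add: power2_eq_square algebra_simps)
  then have "m22 + m21 + 2 * m22 * (m21 * \<beta>2) - 2 * m22 * m21 * Re (a2' * cnj a1) \<le> 0"
    unfolding \<beta>m by simp
  moreover have "m22 + m21 + 2 * m22 * (m21 * \<beta>2) = m21 * m22 * (\<alpha>1 + \<alpha>2)"
    using nz by (simp add: m21_def m22_def divide_simps)
  moreover have "(cmod (a2' - a1))\<^sup>2 = \<alpha>1 + \<alpha>2 - 2 * Re (a2' * cnj a1)"
    using cmod_real_combination_squared[of 1 a2' "-1" a1] by (simp add: na2' \<alpha>1_def)
  ultimately have "m21 * m22 * (cmod (a2' - a1))\<^sup>2 \<le> 0"
    by (simp only: right_diff_distrib) (simp add: mult_ac)
  moreover have "m21 * m22 > 0" using ord by (simp add: m21_def m22_def)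
  ultimately have "a2' = a1"
    by (metis mult_le_0_iff norm_eq_zero not_le power2_less_eq_zero_iff right_minus_eq)
  then show False using na2' ord by (simp add: \<alpha>1_def)
qed

text \<open>Numerator and denominator of Cramer's rule for the Cauchy system below. The entries \<open>e\<close> and \<open>f\<close> are scalings of
  the first row and of the second column; they keep the quotient meaningful when two moduli coincide and
  some of the \<open>m\<^sub>k\<^sub>j\<close> blow up.\<close>

type_synonym cauchy_data = "((complex \<times> complex \<times> complex \<times> complex \<times> complex \<times> complex)
    \<times> (complex \<times> complex \<times> complex \<times> complex)) \<times> (complex \<times> complex \<times> complex)"

definition cauchy_num :: "cauchy_data \<Rightarrow> complex" where
  "cauchy_num = (\<lambda>(((m11, m12, m21, m22, e, f), (a1, a2, b1, b2)), (x1, x2, \<psi>)).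
    (e * (m22 * (a2 - \<psi> * (b2 * x2))) - m12 * (a2 - \<psi> * (b1 * x1)))
    + f * (\<psi> * (m11 * (a1 - b1 * x1) - e * (m21 * (a1 - b2 * x2)))))"

definition cauchy_den :: "cauchy_data \<Rightarrow> complex" where
  "cauchy_den = (\<lambda>(((m11, m12, m21, m22, e, f), (a1, a2, b1, b2)), (x1, x2, \<psi>)).
    m11 * (a1 - b1 * x1) * (m22 * (a2 - \<psi> * (b2 * x2))) - m12 * (a2 - \<psi> * (b1 * x1)) * (m21 * (a1 - b2 * x2)))"

abbreviation cauchy_quot :: "cauchy_data \<Rightarrow> complex" where
  "cauchy_quot p \<equiv> cauchy_num p / cauchy_den p"

section \<open>Dependence of the Cramer quotient on its parameters\<close>

lemma cauchy_quotient_regular: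
  assumes hol: "X1 holomorphic_on ball 0 r" "X2 holomorphic_on ball 0 r" "\<Psi> holomorphic_on ball 0 r"
    and c: "(c \<longlongrightarrow> c0) F"
  shows "(\<lambda>z. cauchy_num (p, X1 z, X2 z, \<Psi> z)) holomorphic_on ball 0 r"
    and "(\<lambda>z. cauchy_den (p, X1 z, X2 z, \<Psi> z)) holomorphic_on ball 0 r"
    and "R < r \<Longrightarrow> uniform_limit (cball 0 R) (\<lambda>s z. cauchy_num (c s, X1 z, X2 z, \<Psi> z)) (\<lambda>z. cauchy_num (c0, X1 z, X2 z, \<Psi> z)) F"
    and "R < r \<Longrightarrow> uniform_limit (cball 0 R) (\<lambda>s z. cauchy_den (c s, X1 z, X2 z, \<Psi> z)) (\<lambda>z. cauchy_den (c0, X1 z, X2 z, \<Psi> z)) F"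
proof -
  show "(\<lambda>z. cauchy_num (p, X1 z, X2 z, \<Psi> z)) holomorphic_on ball 0 r"
    unfolding cauchy_num_def case_prod_unfold fst_conv snd_conv by (intro holomorphic_intros hol)
  show "(\<lambda>z. cauchy_den (p, X1 z, X2 z, \<Psi> z)) holomorphic_on ball 0 r"
    unfolding cauchy_den_def case_prod_unfold fst_conv snd_conv by (intro holomorphic_intros hol)
  have cont: "continuous_on UNIV cauchy_num" "continuous_on UNIV cauchy_den"
    unfolding cauchy_num_def cauchy_den_def case_prod_unfold by (intro continuous_intros)+
  have bf: "bounded ((\<lambda>z. (X1 z, X2 z, \<Psi> z)) ` cball 0 R)" if "R < r"
  proof (intro compact_imp_bounded compact_continuous_image compact_cball)
    show "continuous_on (cball 0 R) (\<lambda>z. (X1 z, X2 z, \<Psi> z))"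
      using that
      by (intro continuous_intros holomorphic_on_imp_continuous_on holomorphic_on_subset[OF hol(1)]
          holomorphic_on_subset[OF hol(2)] holomorphic_on_subset[OF hol(3)]) auto
  qed
  show "R < r \<Longrightarrow> uniform_limit (cball 0 R) (\<lambda>s z. cauchy_num (c s, X1 z, X2 z, \<Psi> z)) (\<lambda>z. cauchy_num (c0, X1 z, X2 z, \<Psi> z)) F"
    by (rule uniform_limit_continuous_compose[OF cont(1) c bf])
  show "R < r \<Longrightarrow> uniform_limit (cball 0 R) (\<lambda>s z. cauchy_den (c s, X1 z, X2 z, \<Psi> z)) (\<lambda>z. cauchy_den (c0, X1 z, X2 z, \<Psi> z)) F"
    by (rule uniform_limit_continuous_compose[OF cont(2) c bf])
qed

lemma cauchy_quotient_h12_tendsto: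
  assumes r: "r > 1" and hol: "X1 holomorphic_on ball 0 r" "X2 holomorphic_on ball 0 r" "\<Psi> holomorphic_on ball 0 r"
    and c: "(c \<longlongrightarrow> c0) F" and nz: "\<And>z. cmod z \<le> 1 \<Longrightarrow> cauchy_den (c0, X1 z, X2 z, \<Psi> z) \<noteq> 0"
  shows "((\<lambda>s. h12_dist (taylor_coeff (\<lambda>z. cauchy_quot (c s, X1 z, X2 z, \<Psi> z)))
      (taylor_coeff (\<lambda>z. cauchy_quot (c0, X1 z, X2 z, \<Psi> z)))) \<longlongrightarrow> 0) F"
  by (rule h12_dist_quotient_tendsto_0[OF r cauchy_quotient_regular(1)[OF hol c] cauchy_quotient_regular(2)[OF hol c]
      cauchy_quotient_regular(1)[OF hol c] cauchy_quotient_regular(2)[OF hol c]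
      cauchy_quotient_regular(3)[OF hol c] cauchy_quotient_regular(4)[OF hol c] nz])

lemma cauchy_quotient_coeff_tendsto:
  assumes r: "r > 0" and hol: "X1 holomorphic_on ball 0 r" "X2 holomorphic_on ball 0 r" "\<Psi> holomorphic_on ball 0 r"
    and c: "(c \<longlongrightarrow> c0) F" and nz: "cauchy_den (c0, X1 0, X2 0, \<Psi> 0) \<noteq> 0"
  shows "((\<lambda>s. taylor_coeff (\<lambda>z. cauchy_quot (c s, X1 z, X2 z, \<Psi> z)) k)
      \<longlongrightarrow> taylor_coeff (\<lambda>z. cauchy_quot (c0, X1 z, X2 z, \<Psi> z)) k) F"
  by (rule taylor_coeff_quotient_tendsto[OF r cauchy_quotient_regular(1)[OF hol c] cauchy_quotient_regular(2)[OF hol c]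
      cauchy_quotient_regular(1)[OF hol c] cauchy_quotient_regular(2)[OF hol c]
      cauchy_quotient_regular(3)[OF hol c] cauchy_quotient_regular(4)[OF hol c] nz])

lemma has_vector_derivative_rotation:
  "((\<lambda>s. a * cis (\<alpha> * s)) has_vector_derivative \<i> * of_real \<alpha> * (a * cis (\<alpha> * t))) (at t)"
proof -
  have "((\<lambda>s. a * cis (\<alpha> * s)) has_vector_derivative a * (\<alpha> *\<^sub>R (\<i> * cis (\<alpha> * t)))) (at t)"
    by (auto intro!: derivative_eq_intros simp: has_vector_derivative_def)
  then show ?thesis by (simp add: scaleR_conv_of_real mult_ac)
qed

text \<open>The moduli of \<open>a\<^sub>1, a\<^sub>2\<close> are singular values of the Hankel operator of the solution and those of
  \<open>b\<^sub>1, b\<^sub>2\<close> belong to the shifted Hankel operator; they interlace and are conserved, while the phases rotate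
  uniformly.\<close>

locale szego_data =
  fixes a1 a2 b1 b2 :: complex and X1 X2 \<Psi> :: "complex \<Rightarrow> complex" and r :: real
  assumes r: "1 < r"
    and hol: "X1 holomorphic_on ball 0 r" "X2 holomorphic_on ball 0 r" "\<Psi> holomorphic_on ball 0 r"
    and X0: "X1 0 = 0" "X2 0 = 0"
    and disc: "\<And>z. cmod z \<le> 1 \<Longrightarrow> cmod (X1 z) \<le> 1" "\<And>z. cmod z \<le> 1 \<Longrightarrow> cmod (X2 z) \<le> 1"
      "\<And>z. cmod z \<le> 1 \<Longrightarrow> cmod (\<Psi> z) \<le> 1"
    and circ: "\<And>z. cmod z = 1 \<Longrightarrow> cmod (X1 z) = 1" "\<And>z. cmod z = 1 \<Longrightarrow> cmod (X2 z) = 1"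
      "\<And>z. cmod z = 1 \<Longrightarrow> cmod (\<Psi> z) = 1"
    and ord: "cmod b2 < cmod a2" "cmod a2 < cmod b1" "cmod b1 < cmod a1"
begin

definition "\<alpha>1 = (cmod a1)\<^sup>2"
definition "\<alpha>2 = (cmod a2)\<^sup>2"
definition "\<beta>1 = (cmod b1)\<^sup>2"
definition "\<beta>2 = (cmod b2)\<^sup>2"

definition "A1 t = a1 * cis (\<alpha>1 * t)"
definition "A2 t = a2 * cis (\<alpha>2 * t)"
definition "B1 t = b1 * cis (\<beta>1 * t)"
definition "B2 t = b2 * cis (\<beta>2 * t)"

definition "m11 = complex_of_real (1 / (\<alpha>1 - \<beta>1))"
definition "m12 = complex_of_real (1 / (\<alpha>2 - \<beta>1))"
definition "m21 = complex_of_real (1 / (\<alpha>1 - \<beta>2))"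
definition "m22 = complex_of_real (1 / (\<alpha>2 - \<beta>2))"

definition "c11 t z = m11 * (A1 t - B1 t * X1 z)"
definition "c12 t z = m12 * (A2 t - \<Psi> z * (B1 t * X1 z))"
definition "c21 t z = m21 * (A1 t - B2 t * X2 z)"
definition "c22 t z = m22 * (A2 t - \<Psi> z * (B2 t * X2 z))"
definition "\<Delta> t z = c11 t z * c22 t z - c12 t z * c21 t z"

text \<open>Cramer's rule for three systems: \<open>c \<xi> = (1, 1)\<close>, the transposed system
  for \<open>\<eta>\<close> with right side \<open>(1, \<Psi>)\<close>, and
  \<open>c \<zeta> = (B1 X1, B2 X2)\<close>. The \<open>\<eta>\<close> serve to differentiate
  \<open>U\<close> in time; the \<open>\<zeta>\<close> vanish at the origin together with
  \<open>X1\<close> and \<open>X2\<close>, which gives G(0) = 0.\<close>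

definition "\<xi>1 t z = (c22 t z - c12 t z) / \<Delta> t z"
definition "\<xi>2 t z = (c11 t z - c21 t z) / \<Delta> t z"
definition "\<eta>1 t z = (c22 t z - \<Psi> z * c21 t z) / \<Delta> t z"
definition "\<eta>2 t z = (\<Psi> z * c11 t z - c12 t z) / \<Delta> t z"
definition "\<zeta>1 t z = (B1 t * X1 z * c22 t z - B2 t * X2 z * c12 t z) / \<Delta> t z"
definition "\<zeta>2 t z = (B2 t * X2 z * c11 t z - B1 t * X1 z * c21 t z) / \<Delta> t z"

definition "U t z = ((c22 t z - c12 t z) + \<Psi> z * (c11 t z - c21 t z)) / \<Delta> t z"
definition "F t z = of_real \<alpha>1 * \<xi>1 t z + of_real \<alpha>2 * (\<Psi> z * \<xi>2 t z)
    + U t z * (B1 t * X1 z * \<eta>1 t z + B2 t * X2 z * \<eta>2 t z)"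
definition "G t z = A1 t * \<zeta>1 t z + A2 t * \<zeta>2 t z"

lemma ord_squares: "\<beta>1 < \<alpha>1" "\<alpha>2 < \<beta>1" "\<beta>2 < \<alpha>2" "0 \<le> \<beta>2"
  using ord by (auto simp: \<alpha>1_def \<alpha>2_def \<beta>1_def \<beta>2_def intro!: power_strict_mono)

lemma cmod_AB: "(cmod (A1 t))\<^sup>2 = \<alpha>1" "(cmod (A2 t))\<^sup>2 = \<alpha>2" "(cmod (B1 t))\<^sup>2 = \<beta>1" "(cmod (B2 t))\<^sup>2 = \<beta>2"
  by (simp_all add: A1_def A2_def B1_def B2_def \<alpha>1_def \<alpha>2_def \<beta>1_def \<beta>2_def norm_mult)

lemma det_nonzero:
  assumes "cmod z \<le> 1"
  shows "\<Delta> t z \<noteq> 0"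
proof -
  have "(cmod (B1 t * X1 z))\<^sup>2 \<le> \<beta>1" "(cmod (B2 t * X2 z))\<^sup>2 \<le> \<beta>2"
    using disc(1,2)[OF assms] ord_squares
    by (auto simp: norm_mult power_mult_distrib cmod_AB intro!: mult_left_le power_le_one)
  from cauchy_matrix_det_nonzero[of \<beta>1 "A1 t" "A2 t" \<beta>2, unfolded cmod_AB, OF ord_squares this disc(3)[OF assms]]
  show ?thesis
    by (simp add: \<Delta>_def c11_def c12_def c21_def c22_def m11_def m12_def m21_def m22_def)
qed

lemma linear_systems:
  assumes "\<Delta> t z \<noteq> 0"
  shows "c11 t z * \<xi>1 t z + c12 t z * \<xi>2 t z = 1" "c21 t z * \<xi>1 t z + c22 t z * \<xi>2 t z = 1"
    "c11 t z * \<eta>1 t z + c21 t z * \<eta>2 t z = 1" "c12 t z * \<eta>1 t z + c22 t z * \<eta>2 t z = \<Psi> z"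
    "c11 t z * \<zeta>1 t z + c12 t z * \<zeta>2 t z = B1 t * X1 z" "c21 t z * \<zeta>1 t z + c22 t z * \<zeta>2 t z = B2 t * X2 z"
    "U t z = \<xi>1 t z + \<Psi> z * \<xi>2 t z"
  using assms unfolding \<xi>1_def \<xi>2_def \<eta>1_def \<eta>2_def \<zeta>1_def \<zeta>2_def U_def
  by (simp_all add: field_simps) (simp_all add: \<Delta>_def algebra_simps)

text \<open>On the circle cnj \<Psi> is the inverse of \<Psi>. Multiplying the second column by
  \<open>p = cnj \<Psi>\<close> and replacing \<open>\<xi>2\<close> by \<open>\<Psi> \<xi>2\<close>
  produces a matrix of exact Cauchy type with parameters A1, p A2 and B_k X_k, whose moduli are
  those of the data.\<close>

lemma circle_identity:
  assumes z: "cmod z = 1"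
  shows "U t z * cnj (U t z) * U t z = F t z + cnj (G t z)"
proof -
  have det: "\<Delta> t z \<noteq> 0" using det_nonzero z by simp
  note lin = linear_systems[OF det]
  define p where "p = cnj (\<Psi> z)"
  have p: "p * \<Psi> z = 1" "\<Psi> z * p = 1"
    using circ(3)[OF z] by (simp_all add: p_def mult.commute complex_norm_square[symmetric])
  note sq = complex_norm_square[symmetric]
  have BB: "(B1 t * X1 z) * cnj (B1 t * X1 z) = of_real \<beta>1" "(B2 t * X2 z) * cnj (B2 t * X2 z) = of_real \<beta>2"
    using circ(1,2)[OF z] by (simp_all only: sq norm_mult cmod_AB) (simp_all add: power_mult_distrib cmod_AB)
  have AA: "A1 t * cnj (A1 t) = of_real \<alpha>1" "(p * A2 t) * cnj (p * A2 t) = of_real \<alpha>2" "A2 t * cnj (A2 t) = of_real \<alpha>2"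
    using circ(3)[OF z] by (simp_all only: sq norm_mult cmod_AB) (simp_all add: power_mult_distrib cmod_AB p_def)
  have C: "cnj (of_real m * (a - b)) * a + cnj b * (of_real m * (a - b)) = 1"
    if "a * cnj a = of_real \<alpha>" "b * cnj b = of_real \<beta>" "m * (\<alpha> - \<beta>) = 1" for a b m \<alpha> \<beta>
  proof -
    have "cnj (of_real m * (a - b)) * a + cnj b * (of_real m * (a - b)) = of_real m * (a * cnj a - b * cnj b)"
      by (simp add: algebra_simps)
    also have "\<dots> = of_real (m * (\<alpha> - \<beta>))" unfolding that(1,2) by simp
    finally show ?thesis by (simp only: that(3) of_real_1)
  qed
  have c': "p * c12 t z = m12 * (p * A2 t - B1 t * X1 z)" "p * c22 t z = m22 * (p * A2 t - B2 t * X2 z)"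
  proof -
    have "p * c12 t z = m12 * (p * A2 t - (p * \<Psi> z) * (B1 t * X1 z))"
      "p * c22 t z = m22 * (p * A2 t - (p * \<Psi> z) * (B2 t * X2 z))"
      by (simp_all add: c12_def c22_def algebra_simps)
    then show "p * c12 t z = m12 * (p * A2 t - B1 t * X1 z)" "p * c22 t z = m22 * (p * A2 t - B2 t * X2 z)"
      unfolding p by simp_all
  qed
  have main: "(\<xi>1 t z + \<Psi> z * \<xi>2 t z) * cnj (\<xi>1 t z + \<Psi> z * \<xi>2 t z) * (\<xi>1 t z + \<Psi> z * \<xi>2 t z)
      = (A1 t * cnj (A1 t) * \<xi>1 t z + (p * A2 t) * cnj (p * A2 t) * (\<Psi> z * \<xi>2 t z)
        + (\<xi>1 t z + \<Psi> z * \<xi>2 t z) * (B1 t * X1 z * \<eta>1 t z + B2 t * X2 z * \<eta>2 t z))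
      + cnj (A1 t * \<zeta>1 t z + (p * A2 t) * (\<Psi> z * \<zeta>2 t z))"
  proof (rule cauchy_matrix_cubic_identity)
    show "cnj (c11 t z) * A1 t + cnj (B1 t * X1 z) * c11 t z = 1"
      "cnj (c21 t z) * A1 t + cnj (B2 t * X2 z) * c21 t z = 1"
      unfolding c11_def c21_def m11_def m21_def
      using C[OF AA(1) BB(1), of "1 / (\<alpha>1 - \<beta>1)"] C[OF AA(1) BB(2), of "1 / (\<alpha>1 - \<beta>2)"] ord_squares by auto
    show "cnj (p * c12 t z) * (p * A2 t) + cnj (B1 t * X1 z) * (p * c12 t z) = 1"
      "cnj (p * c22 t z) * (p * A2 t) + cnj (B2 t * X2 z) * (p * c22 t z) = 1"
      unfolding c' m12_def m22_def
      using C[OF AA(2) BB(1), of "1 / (\<alpha>2 - \<beta>1)"] C[OF AA(2) BB(2), of "1 / (\<alpha>2 - \<beta>2)"] ord_squares by auto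
    have "c11 t z * (p * c22 t z) - p * c12 t z * c21 t z = p * \<Delta> t z"
      by (simp add: \<Delta>_def algebra_simps)
    then show "c11 t z * (p * c22 t z) - p * c12 t z * c21 t z \<noteq> 0" using det p by auto
    have pp: "p * x * (\<Psi> z * y) = x * y" for x y
    proof -
      have "p * x * (\<Psi> z * y) = (p * \<Psi> z) * (x * y)" by (simp add: mult_ac)
      then show ?thesis unfolding p by simp
    qed
    show "c11 t z * \<xi>1 t z + p * c12 t z * (\<Psi> z * \<xi>2 t z) = 1"
      "c21 t z * \<xi>1 t z + p * c22 t z * (\<Psi> z * \<xi>2 t z) = 1"
      "c11 t z * \<zeta>1 t z + p * c12 t z * (\<Psi> z * \<zeta>2 t z) = B1 t * X1 z"
      "c21 t z * \<zeta>1 t z + p * c22 t z * (\<Psi> z * \<zeta>2 t z) = B2 t * X2 z"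
      unfolding pp by (rule lin)+
    show "c11 t z * \<eta>1 t z + c21 t z * \<eta>2 t z = 1" by (rule lin)
    have "p * c12 t z * \<eta>1 t z + p * c22 t z * \<eta>2 t z = p * (c12 t z * \<eta>1 t z + c22 t z * \<eta>2 t z)"
      by (simp add: algebra_simps)
    then show "p * c12 t z * \<eta>1 t z + p * c22 t z * \<eta>2 t z = 1" unfolding lin p .
  qed
  have e: "(p * A2 t) * (\<Psi> z * \<zeta>2 t z) = A2 t * \<zeta>2 t z"
  proof -
    have "(p * A2 t) * (\<Psi> z * \<zeta>2 t z) = (p * \<Psi> z) * (A2 t * \<zeta>2 t z)" by (simp add: mult_ac)
    then show ?thesis unfolding p by simp
  qed
  show ?thesis using main unfolding e AA lin(7)[symmetric] F_def G_def .
qed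

lemma holomorphic_entries:
  "c11 t holomorphic_on ball 0 r" "c12 t holomorphic_on ball 0 r" "c21 t holomorphic_on ball 0 r"
  "c22 t holomorphic_on ball 0 r" "\<Delta> t holomorphic_on ball 0 r"
  unfolding c11_def c12_def c21_def c22_def \<Delta>_def by (intro holomorphic_intros hol)+

lemma holomorphic_solution:
  obtains \<rho> where "\<rho> > 1" "U t holomorphic_on ball 0 \<rho>" "F t holomorphic_on ball 0 \<rho>" "G t holomorphic_on ball 0 \<rho>"
proof -
  obtain \<rho> where \<rho>: "1 < \<rho>" "\<rho> < r" "\<And>z. cmod z \<le> \<rho> \<Longrightarrow> \<Delta> t z \<noteq> 0"
    using nonzero_on_larger_ball[OF holomorphic_entries(5) r det_nonzero] by metis
  have h: "f holomorphic_on ball 0 \<rho>" if "f holomorphic_on ball 0 r" for f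
    by (rule holomorphic_on_subset[OF that]) (use \<rho>(2) in auto)
  note hs = h[OF holomorphic_entries(1)] h[OF holomorphic_entries(2)] h[OF holomorphic_entries(3)]
    h[OF holomorphic_entries(4)] h[OF holomorphic_entries(5)] h[OF hol(1)] h[OF hol(2)] h[OF hol(3)]
  have nz: "z \<in> ball 0 \<rho> \<Longrightarrow> \<Delta> t z \<noteq> 0" for z using \<rho>(3)[of z] by simp
  have U: "U t holomorphic_on ball 0 \<rho>"
    unfolding U_def by (intro holomorphic_intros hs nz)
  have "F t holomorphic_on ball 0 \<rho>"
    unfolding F_def \<xi>1_def \<xi>2_def \<eta>1_def \<eta>2_def by (intro holomorphic_intros U hs nz)
  moreover have "G t holomorphic_on ball 0 \<rho>"
    unfolding G_def \<zeta>1_def \<zeta>2_def by (intro holomorphic_intros hs nz)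
  ultimately show thesis using U \<rho>(1) by (intro that)
qed

lemma szego_nl_U: "szego_nl (taylor_coeff (U t)) n = taylor_coeff (F t) n"
proof -
  obtain \<rho> where "\<rho> > 1" "U t holomorphic_on ball 0 \<rho>" "F t holomorphic_on ball 0 \<rho>" "G t holomorphic_on ball 0 \<rho>"
    by (rule holomorphic_solution)
  moreover have "G t 0 = 0" by (simp add: G_def \<zeta>1_def \<zeta>2_def X0)
  ultimately show ?thesis using circle_identity by (intro szego_nl_eqI[of "U t" \<rho> "F t" "G t"]) auto
qed

lemma has_vector_derivative_AB:
  "(A1 has_vector_derivative \<i> * of_real \<alpha>1 * A1 t) (at t)" "(A2 has_vector_derivative \<i> * of_real \<alpha>2 * A2 t) (at t)"
  "(B1 has_vector_derivative \<i> * of_real \<beta>1 * B1 t) (at t)" "(B2 has_vector_derivative \<i> * of_real \<beta>2 * B2 t) (at t)"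
  unfolding A1_def A2_def B1_def B2_def by (rule has_vector_derivative_rotation)+

text \<open>Differentiating \<open>c \<xi> = (1, 1)\<close> gives
  \<open>c \<xi>' = - c' \<xi>\<close>, and pairing with the transposed solution
  \<open>\<eta>\<close> yields U' = - \<eta> . (c' \<xi>). The derivative of \<xi> itself is never
  computed; only its existence is used.\<close>

lemma U_has_vector_derivative:
  "((\<lambda>s. taylor_coeff (U s) n) has_vector_derivative (- \<i> * taylor_coeff (F t) n)) (at t)"
proof -
  define f1 f2 fp where "f1 = fps_expansion X1 0" and "f2 = fps_expansion X2 0" and "fp = fps_expansion \<Psi> 0"
  have ex: "X1 has_fps_expansion f1" "X2 has_fps_expansion f2" "\<Psi> has_fps_expansion fp"
    unfolding f1_def f2_def fp_def using hol r by (auto intro!: has_fps_expansion_fps_expansion[of "ball 0 r"])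
  define C11 where "C11 s = fps_const m11 * (fps_const (A1 s) - fps_const (B1 s) * f1)" for s
  define C12 where "C12 s = fps_const m12 * (fps_const (A2 s) - fp * (fps_const (B1 s) * f1))" for s
  define C21 where "C21 s = fps_const m21 * (fps_const (A1 s) - fps_const (B2 s) * f2)" for s
  define C22 where "C22 s = fps_const m22 * (fps_const (A2 s) - fp * (fps_const (B2 s) * f2))" for s
  define D where "D s = C11 s * C22 s - C12 s * C21 s" for s
  have exC: "c11 s has_fps_expansion C11 s" "c12 s has_fps_expansion C12 s" "c21 s has_fps_expansion C21 s"
    "c22 s has_fps_expansion C22 s" for s
    unfolding c11_def c12_def c21_def c22_def C11_def C12_def C21_def C22_def
    by (intro fps_expansion_intros ex)+
  have exD: "\<Delta> s has_fps_expansion D s" for s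
    unfolding \<Delta>_def D_def by (intro fps_expansion_intros exC)
  have D0: "fps_nth (D s) 0 \<noteq> 0" for s
    using has_fps_expansion_imp_0_eq_fps_nth_0[OF exD[of s]] det_nonzero[of 0 s] by simp
  define I where "I s = inverse (D s)" for s
  have exI: "(\<lambda>z. inverse (\<Delta> s z)) has_fps_expansion I s" for s
    unfolding I_def by (intro fps_expansion_intros exD D0)
  have DI: "D s * I s = 1" for s unfolding I_def using D0[of s] by (rule inverse_mult_eq_1')
  define P1 where "P1 s = (C22 s - C12 s) * I s" for s
  define P2 where "P2 s = (C11 s - C21 s) * I s" for s
  define Q1 where "Q1 s = (C22 s - fp * C21 s) * I s" for s
  define Q2 where "Q2 s = (fp * C11 s - C12 s) * I s" for s
  define V where "V s = P1 s + fp * P2 s" for s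
  have exP: "\<xi>1 s has_fps_expansion P1 s" "\<xi>2 s has_fps_expansion P2 s"
    "\<eta>1 s has_fps_expansion Q1 s" "\<eta>2 s has_fps_expansion Q2 s" for s
    unfolding \<xi>1_def \<xi>2_def \<eta>1_def \<eta>2_def P1_def P2_def Q1_def Q2_def divide_inverse
    by (intro fps_expansion_intros exC ex exI)+
  have exU: "U s has_fps_expansion V s" for s
  proof -
    have "U s = (\<lambda>z. \<xi>1 s z + \<Psi> z * \<xi>2 s z)"
      by (simp add: U_def \<xi>1_def \<xi>2_def fun_eq_iff add_divide_distrib)
    then show ?thesis unfolding V_def by (simp only:) (intro fps_expansion_intros exP ex)
  qed
  define W where "W = fps_const (of_real \<alpha>1) * P1 t + fps_const (of_real \<alpha>2) * (fp * P2 t)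
      + V t * (fps_const (B1 t) * f1 * Q1 t + fps_const (B2 t) * f2 * Q2 t)"
  have exF: "F t has_fps_expansion W"
    unfolding F_def W_def by (intro fps_expansion_intros exP exU ex)
  have lin: "C11 s * P1 s + C12 s * P2 s = 1" "C21 s * P1 s + C22 s * P2 s = 1"
    "C11 s * Q1 s + C21 s * Q2 s = 1" "C12 s * Q1 s + C22 s * Q2 s = fp" for s
  proof -
    have "C11 s * P1 s + C12 s * P2 s = D s * I s" "C21 s * P1 s + C22 s * P2 s = D s * I s"
      "C11 s * Q1 s + C21 s * Q2 s = D s * I s" "C12 s * Q1 s + C22 s * Q2 s = fp * (D s * I s)"
      unfolding P1_def P2_def Q1_def Q2_def D_def by (simp_all add: algebra_simps)
    then show "C11 s * P1 s + C12 s * P2 s = 1" "C21 s * P1 s + C22 s * P2 s = 1"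
      "C11 s * Q1 s + C21 s * Q2 s = 1" "C12 s * Q1 s + C22 s * Q2 s = fp"
      unfolding DI by simp_all
  qed
  \<comment> \<open>The speeds are chosen for this formula: differentiating produces
    \<open>\<i> k (\<alpha> a - \<beta> b f g)\<close>, and because
    \<open>k (\<alpha> - \<beta>) = 1\<close> this is \<open>\<i>\<close> times \<alpha> times the
    entry plus a term of rank one without any denominator.\<close>
  have deriv_entry: "fps_has_deriv (\<lambda>s. fps_const (of_real (1 / (\<alpha> - \<beta>))) * (fps_const (a s) - g * (fps_const (b s) * f)))
      (fps_const \<i> * (fps_const (of_real (1 / (\<alpha> - \<beta>))) * (fps_const (a t) - g * (fps_const (b t) * f)) * fps_const (of_real \<alpha>)
        + fps_const (b t) * f * g)) t"
    if "(a has_vector_derivative \<i> * of_real \<alpha> * a t) (at t)" "(b has_vector_derivative \<i> * of_real \<beta> * b t) (at t)" "\<alpha> \<noteq> \<beta>"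
    for a b :: "real \<Rightarrow> complex" and \<alpha> \<beta> :: real and f g :: "complex fps"
  proof -
    define k p q j :: "complex fps" where "k = fps_const (of_real (1 / (\<alpha> - \<beta>)))" and "p = fps_const (of_real \<alpha>)"
      and "q = fps_const (of_real \<beta>)" and "j = fps_const \<i>"
    have one: "k * (p - q) = 1"
    proof -
      have "k * (p - q) = fps_const (of_real (1 / (\<alpha> - \<beta>) * (\<alpha> - \<beta>)))"
        unfolding k_def p_def q_def by (simp only: fps_const_mult fps_const_sub of_real_diff of_real_mult)
      then show ?thesis using that(3) by simp
    qed
    have "fps_has_deriv (\<lambda>s. k * (fps_const (a s) - g * (fps_const (b s) * f)))
       (0 * (fps_const (a t) - g * (fps_const (b t) * f)) + k *
        (fps_const (\<i> * of_real \<alpha> * a t) - (0 * (fps_const (b t) * f)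
          + g * (fps_const (\<i> * of_real \<beta> * b t) * f + fps_const (b t) * 0)))) t"
      by (intro fps_has_deriv_mult fps_has_deriv_diff fps_has_deriv_const fps_has_deriv_fps_const that)
    also have "fps_const (\<i> * of_real \<alpha> * a t) = j * p * fps_const (a t)"
      unfolding j_def p_def by (simp only: fps_const_mult)
    also have "fps_const (\<i> * of_real \<beta> * b t) = j * q * fps_const (b t)"
      unfolding j_def q_def by (simp only: fps_const_mult)
    also have "0 * (fps_const (a t) - g * (fps_const (b t) * f)) + k *
        (j * p * fps_const (a t) - (0 * (fps_const (b t) * f)
          + g * (j * q * fps_const (b t) * f + fps_const (b t) * 0)))
      = j * (k * (fps_const (a t) - g * (fps_const (b t) * f)) * p + fps_const (b t) * f * g * (k * (p - q)))"
      by (simp only: algebra_simps mult_zero_left mult_zero_right add_0_left add_0_right)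
    finally show ?thesis unfolding one mult_1_right unfolding k_def p_def j_def .
  qed
  define E where "E g C a B = fps_const \<i> * (C * fps_const (of_real a) + B * g)" for g C B :: "complex fps" and a :: real
  have dC: "fps_has_deriv C11 (E 1 (C11 t) \<alpha>1 (fps_const (B1 t) * f1)) t" "fps_has_deriv C12 (E fp (C12 t) \<alpha>2 (fps_const (B1 t) * f1)) t"
    "fps_has_deriv C21 (E 1 (C21 t) \<alpha>1 (fps_const (B2 t) * f2)) t" "fps_has_deriv C22 (E fp (C22 t) \<alpha>2 (fps_const (B2 t) * f2)) t"
    using deriv_entry[OF has_vector_derivative_AB(1,3), of 1 f1] deriv_entry[OF has_vector_derivative_AB(2,3), of fp f1]
      deriv_entry[OF has_vector_derivative_AB(1,4), of 1 f2] deriv_entry[OF has_vector_derivative_AB(2,4), of fp f2] ord_squares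
    unfolding E_def C11_def C12_def C21_def C22_def m11_def m12_def m21_def m22_def by simp_all
  define C11' C12' C21' C22' where "C11' = E 1 (C11 t) \<alpha>1 (fps_const (B1 t) * f1)"
    and "C12' = E fp (C12 t) \<alpha>2 (fps_const (B1 t) * f1)"
    and "C21' = E 1 (C21 t) \<alpha>1 (fps_const (B2 t) * f2)" and "C22' = E fp (C22 t) \<alpha>2 (fps_const (B2 t) * f2)"
  note dC' = dC[folded C11'_def C12'_def C21'_def C22'_def]
  have "fps_has_deriv D (C11' * C22 t + C11 t * C22' - (C12' * C21 t + C12 t * C21')) t"
    unfolding D_def[abs_def] by (intro fps_has_deriv_diff fps_has_deriv_mult dC')
  then have "\<exists>I'. fps_has_deriv I I' t"
    unfolding I_def[abs_def] by (rule fps_has_deriv_inverse[OF _ D0])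
  then obtain I' where dI: "fps_has_deriv I I' t" ..
  obtain P1' P2' where dP: "fps_has_deriv P1 P1' t" "fps_has_deriv P2 P2' t"
    using fps_has_deriv_mult[OF fps_has_deriv_diff[OF dC'(4) dC'(2)] dI] fps_has_deriv_mult[OF fps_has_deriv_diff[OF dC'(1) dC'(3)] dI]
    unfolding P1_def[abs_def] P2_def[abs_def] by blast
  have dV: "fps_has_deriv V (P1' + (0 * P2 t + fp * P2')) t"
    unfolding V_def[abs_def] by (intro fps_has_deriv_add fps_has_deriv_mult fps_has_deriv_const dP)
  have e1: "C11' * P1 t + C11 t * P1' + (C12' * P2 t + C12 t * P2') = 0"
    using fps_has_deriv_unique[OF fps_has_deriv_add[OF fps_has_deriv_mult[OF dC'(1) dP(1)] fps_has_deriv_mult[OF dC'(2) dP(2)], unfolded lin]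
      fps_has_deriv_const] .
  have e2: "C21' * P1 t + C21 t * P1' + (C22' * P2 t + C22 t * P2') = 0"
    using fps_has_deriv_unique[OF fps_has_deriv_add[OF fps_has_deriv_mult[OF dC'(3) dP(1)] fps_has_deriv_mult[OF dC'(4) dP(2)], unfolded lin]
      fps_has_deriv_const] .
  \<comment> \<open>The transposed system writes the coefficients 1 and \<open>fp\<close> through
    the matrix entries, after which the differentiated systems \<open>e1\<close> and
    \<open>e2\<close> eliminate \<open>P1'\<close> and \<open>P2'\<close>.\<close>
  have "P1' + fp * P2' = (C11 t * Q1 t + C21 t * Q2 t) * P1' + (C12 t * Q1 t + C22 t * Q2 t) * P2'"
    unfolding lin by simp
  also have "\<dots> = Q1 t * (C11' * P1 t + C11 t * P1' + (C12' * P2 t + C12 t * P2'))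
      + Q2 t * (C21' * P1 t + C21 t * P1' + (C22' * P2 t + C22 t * P2'))
      - (Q1 t * (C11' * P1 t + C12' * P2 t) + Q2 t * (C21' * P1 t + C22' * P2 t))"
    by (simp add: algebra_simps)
  also have "\<dots> = - (Q1 t * (C11' * P1 t + C12' * P2 t) + Q2 t * (C21' * P1 t + C22' * P2 t))"
    unfolding e1 e2 by simp
  also have "\<dots> = - (fps_const \<i> * ((C11 t * Q1 t + C21 t * Q2 t) * fps_const (of_real \<alpha>1) * P1 t
      + (C12 t * Q1 t + C22 t * Q2 t) * fps_const (of_real \<alpha>2) * P2 t
      + (P1 t + fp * P2 t) * (fps_const (B1 t) * f1 * Q1 t + fps_const (B2 t) * f2 * Q2 t)))"
    unfolding C11'_def C12'_def C21'_def C22'_def E_def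
    by (simp add: algebra_simps del: fps_const_mult fps_const_neg fps_const_add fps_const_sub)
  also have "\<dots> = - (fps_const \<i> * W)"
    unfolding lin W_def V_def
    by (simp add: algebra_simps del: fps_const_mult fps_const_neg fps_const_add fps_const_sub)
  finally have "fps_has_deriv V (- (fps_const \<i> * W)) t" using dV by simp
  then show ?thesis
    unfolding fps_has_deriv_def taylor_coeff_eqI[OF exU] taylor_coeff_eqI[OF exF] by simp
qed

text \<open>The scalings multiply numerator and denominator by the same \<open>e * f\<close>. Taking
  \<open>e\<close> or \<open>f\<close> equal to a vanishing gap cancels the two reciprocals in the
  first row or in the second column that blow up.\<close>

lemma U_eq_cauchy_quotient:
  assumes "e \<noteq> 0" "f \<noteq> 0"
  shows "U t z = cauchy_quot (((e * m11, e * f * m12, m21, f * m22, e, f), (A1 t, A2 t, B1 t, B2 t)), X1 z, X2 z, \<Psi> z)"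
proof -
  have "cauchy_num (((e * m11, e * f * m12, m21, f * m22, e, f), (A1 t, A2 t, B1 t, B2 t)), X1 z, X2 z, \<Psi> z)
      = (e * f) * ((c22 t z - c12 t z) + \<Psi> z * (c11 t z - c21 t z))"
    "cauchy_den (((e * m11, e * f * m12, m21, f * m22, e, f), (A1 t, A2 t, B1 t, B2 t)), X1 z, X2 z, \<Psi> z)
      = (e * f) * \<Delta> t z"
    by (simp_all add: cauchy_num_def cauchy_den_def \<Delta>_def c11_def c12_def c21_def c22_def algebra_simps)
  then show ?thesis using assms by (simp add: U_def)
qed

lemma U_continuous: "((\<lambda>s. h12_dist (taylor_coeff (U s)) (taylor_coeff (U t))) \<longlongrightarrow> 0) (at t)"
proof -
  define c where "c s = ((1 * m11, 1 * 1 * m12, m21, 1 * m22, 1 :: complex, 1 :: complex), (A1 s, A2 s, B1 s, B2 s))" for s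
  have eq: "U s = (\<lambda>z. cauchy_quot (c s, X1 z, X2 z, \<Psi> z))" for s
    unfolding c_def by (rule ext, rule U_eq_cauchy_quotient) auto
  have "(c \<longlongrightarrow> c t) (at t)"
    unfolding c_def using has_vector_derivative_AB
    by (intro tendsto_Pair tendsto_const) (auto intro!: has_vector_derivative_continuous simp flip: isCont_def)
  moreover have "cauchy_den (c t, X1 z, X2 z, \<Psi> z) \<noteq> 0" if "cmod z \<le> 1" for z
    using det_nonzero[OF that, of t]
    by (simp add: cauchy_den_def c_def \<Delta>_def c11_def c12_def c21_def c22_def)
  ultimately show ?thesis
    unfolding eq by (intro cauchy_quotient_h12_tendsto[OF r hol])
qed

theorem szego_solution_U: "szego_solution (taylor_coeff (U 0)) (\<lambda>t. taylor_coeff (U t))"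
proof -
  have "h12 (taylor_coeff (U t))" for t
    by (rule holomorphic_solution[of t]) (rule h12_taylor_coeff)
  then show ?thesis
    unfolding szego_solution_def using U_continuous U_has_vector_derivative szego_nl_U by auto
qed

end

section \<open>Orbital instability\<close>

lemma taylor_coeff_cong:
  assumes "f holomorphic_on ball 0 r" "r > 0" "\<And>z. cmod z < r \<Longrightarrow> f z = g z"
  shows "taylor_coeff f = taylor_coeff g"
proof
  fix k
  have "g holomorphic_on ball 0 r" using assms(1,3) by (auto intro: holomorphic_transform)
  then show "taylor_coeff f k = taylor_coeff g k"
    using higher_deriv_transform_within_open[of f "ball 0 r" g 0 k] assms by (simp add: taylor_coeff_def)
qed

text \<open>One coefficient bounds the distance to every rotated copy of \<phi> from below.
  Uniqueness carries the bound from the explicit solution to all solutions, and discarding the first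
  \<open>n0\<close> terms turns "eventually" into "for all n".\<close>

lemma orbitally_unstableI:
  assumes eps: "\<epsilon> > 0" and \<phi>: "\<phi> holomorphic_on ball 0 r" "r > 1"
    and lim: "(\<lambda>n. h12_dist (u0 n) (taylor_coeff \<phi>)) \<longlonglongrightarrow> 0"
    and sol: "\<forall>\<^sub>F n in sequentially. szego_solution (u0 n) (u n) \<and> t n \<ge> 0
      \<and> (\<forall>a b. \<epsilon> \<le> cmod (u n (t n) k) - cmod (taylor_coeff (rot a b \<phi>) k))"
  shows "orbitally_unstable \<phi>"
proof -
  obtain n0 where n0: "\<And>n. n \<ge> n0 \<Longrightarrow> szego_solution (u0 n) (u n)" "\<And>n. n \<ge> n0 \<Longrightarrow> t n \<ge> 0"
    "\<And>n a b. n \<ge> n0 \<Longrightarrow> \<epsilon> \<le> cmod (u n (t n) k) - cmod (taylor_coeff (rot a b \<phi>) k)"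
    using sol unfolding eventually_sequentially by blast
  have rot: "h12 (taylor_coeff (rot a b \<phi>))" for a b
  proof (rule h12_taylor_coeff[OF _ \<phi>(2)])
    have "(\<lambda>z. \<phi> (exp (\<i> * of_real b) * z)) holomorphic_on ball 0 r"
      using holomorphic_on_compose_gen[of "\<lambda>z. exp (\<i> * of_real b) * z" "ball 0 r" \<phi> "ball 0 r"] \<phi>(1)
      by (auto simp: o_def norm_mult image_subset_iff intro!: holomorphic_intros)
    then show "rot a b \<phi> holomorphic_on ball 0 r"
      unfolding rot_def by (intro holomorphic_intros)
  qed
  have sup: "(SUP t. INF ab. ereal (h12_dist (v t) (taylor_coeff (rot (fst ab) (snd ab) \<phi>)))) \<ge> ereal \<epsilon>"
    if n: "n \<ge> n0" and v: "szego_solution (u0 n) v" for n v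
  proof (rule SUP_upper2[of "t n"], simp, rule INF_greatest)
    fix ab :: "real \<times> real"
    have "v (t n) = u n (t n)" by (rule szego_solution_unique[OF v n0(1)[OF n] n0(2)[OF n]])
    then have "\<epsilon> \<le> cmod (v (t n) k) - cmod (taylor_coeff (rot (fst ab) (snd ab) \<phi>) k)"
      using n0(3)[OF n] by simp
    also have "\<dots> \<le> cmod (v (t n) k - taylor_coeff (rot (fst ab) (snd ab) \<phi>) k)"
      by (rule norm_triangle_ineq2)
    also have "\<dots> \<le> h12_dist (v (t n)) (taylor_coeff (rot (fst ab) (snd ab) \<phi>))"
      using v by (intro coeff_diff_le_h12_dist rot) (simp add: szego_solution_def)
    finally show "ereal \<epsilon> \<le> ereal (h12_dist (v (t n)) (taylor_coeff (rot (fst ab) (snd ab) \<phi>)))" by simp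
  qed
  show ?thesis
    unfolding orbitally_unstable_def
  proof (intro exI[of _ \<epsilon>] conjI exI[of _ "\<lambda>n. u0 (n + n0)"] allI impI)
    show "h12 (u0 (n + n0))" for n
      using n0(1)[of "n + n0"] unfolding szego_solution_def by (metis le_add2)
    show "(\<lambda>n. h12_dist (u0 (n + n0)) (taylor_coeff \<phi>)) \<longlonglongrightarrow> 0"
      using lim by (rule LIMSEQ_ignore_initial_segment)
    show "\<exists>u. szego_solution (u0 (n + n0)) u" for n using n0(1)[of "n + n0"] by auto
    show "(SUP t. INF ab. ereal (h12_dist (v t) (taylor_coeff (rot (fst ab) (snd ab) \<phi>)))) \<ge> ereal \<epsilon>"
      if "szego_solution (u0 (n + n0)) v" for n v
      by (rule sup[OF _ that]) simp
  qed (rule eps)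
qed

lemma taylor_coeff_0: "taylor_coeff f 0 = f 0"
  by (simp add: taylor_coeff_def)

lemma cis_phase_exists:
  assumes "cmod w = 1" "h > 0"
  obtains t where "t \<ge> 0" "cis (h * t) = w"
proof -
  have "cis (Arg2pi w) = w"
    using Arg2pi_eq[of w] assms by (simp add: cis_conv_exp)
  then show thesis
    using assms Arg2pi_ge_0[of w] by (intro that[of "Arg2pi w / h"]) auto
qed

text \<open>The moduli of \<open>a\<^sub>1\<close> and \<open>a\<^sub>2\<close> merge in the limit; the phase of \<open>a\<^sub>1 / a\<^sub>2\<close> drifts with a speed
  proportional to their distance, and once \<open>a\<^sub>1\<close> and \<open>a\<^sub>2\<close> are aligned
  the mean value of the solution is as large as it can be.\<close>

lemma orbitally_unstable_merging_a:
  fixes \<Lambda> :: real and w1 w2 v1 b2 :: complex and X1 X2 \<phi> :: "complex \<Rightarrow> complex"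
  assumes r: "r > 1"
    and hol: "X1 holomorphic_on ball 0 r" "X2 holomorphic_on ball 0 r" "\<phi> holomorphic_on ball 0 r"
    and X0: "X1 0 = 0" "X2 0 = 0"
    and disc: "\<And>z. cmod z \<le> 1 \<Longrightarrow> cmod (X1 z) \<le> 1" "\<And>z. cmod z \<le> 1 \<Longrightarrow> cmod (X2 z) \<le> 1"
    and circ: "\<And>z. cmod z = 1 \<Longrightarrow> cmod (X1 z) = 1" "\<And>z. cmod z = 1 \<Longrightarrow> cmod (X2 z) = 1"
    and unit: "cmod w1 = 1" "cmod w2 = 1" "cmod v1 = 1" and \<Lambda>: "\<Lambda> > 0" "cmod b2 < \<Lambda>"
    and nz: "\<And>z. cmod z \<le> 1 \<Longrightarrow> (w1 - v1 * X1 z) * (\<Lambda> * w2 - b2 * X2 z) + (w2 - v1 * X1 z) * (\<Lambda> * w1 - b2 * X2 z) \<noteq> 0"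
    and \<phi>: "\<And>z. cmod z < r \<Longrightarrow> \<phi> z = (\<Lambda>\<^sup>2 - (cmod b2)\<^sup>2) * (w1 + w2 - 2 * v1 * X1 z)
        / ((w1 - v1 * X1 z) * (\<Lambda> * w2 - b2 * X2 z) + (w2 - v1 * X1 z) * (\<Lambda> * w1 - b2 * X2 z))"
    and \<phi>0: "cmod (\<phi> 0) < \<Lambda> - (cmod b2)\<^sup>2 / \<Lambda>"
  shows "orbitally_unstable \<phi>"
proof -
  define \<delta> where "\<delta> n = 1 / real (Suc n)" for n
  define a1 where "a1 n = of_real (\<Lambda> + \<delta> n) * w1" for n
  define a2 where "a2 n = of_real (\<Lambda> - \<delta> n) * w2" for n
  \<comment> \<open>The square of this modulus is the mean of the squares of \<Lambda> + \<delta>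
    and \<Lambda> - \<delta>. Interlacing then holds with two equal gaps 2 \<Lambda> \<delta>, and
    \<open>m11\<close>, \<open>m12\<close> are opposite.\<close>
  define b1 where "b1 n = of_real (sqrt (\<Lambda>\<^sup>2 + (\<delta> n)\<^sup>2)) * v1" for n
  define \<beta> where "\<beta> = (cmod b2)\<^sup>2"
  define V where "V n = szego_data.U (a1 n) (a2 n) (b1 n) b2 X1 X2 (\<lambda>_. 1)" for n
  have \<delta>0: "\<delta> n > 0" for n by (simp add: \<delta>_def)
  have \<delta>lim: "\<delta> \<longlonglongrightarrow> 0" unfolding \<delta>_def by (rule LIMSEQ_Suc[OF lim_1_over_n])
  have small: "\<forall>\<^sub>F n in sequentially. \<delta> n < \<Lambda> - cmod b2"
    using \<Lambda> by (intro order_tendstoD[OF \<delta>lim]) auto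
  have norms: "cmod (a1 n) = \<Lambda> + \<delta> n" "cmod (a2 n) = \<Lambda> - \<delta> n" "cmod (b1 n) = sqrt (\<Lambda>\<^sup>2 + (\<delta> n)\<^sup>2)"
    if "\<delta> n < \<Lambda> - cmod b2" for n
  proof -
    have "\<delta> n < \<Lambda>" using that norm_ge_zero[of b2] by linarith
    then show "cmod (a1 n) = \<Lambda> + \<delta> n" "cmod (a2 n) = \<Lambda> - \<delta> n" "cmod (b1 n) = sqrt (\<Lambda>\<^sup>2 + (\<delta> n)\<^sup>2)"
      using \<Lambda> \<delta>0[of n] unit by (simp_all add: a1_def a2_def b1_def norm_mult del: of_real_add of_real_diff)
  qed
  have data: "szego_data (a1 n) (a2 n) (b1 n) b2 X1 X2 (\<lambda>_. 1) r" if s: "\<delta> n < \<Lambda> - cmod b2" for n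
  proof (rule szego_data.intro)
    show "cmod (a2 n) < cmod (b1 n)"
      unfolding norms[OF s] using \<Lambda> \<delta>0[of n] by (intro real_less_rsqrt) (simp add: power2_eq_square algebra_simps)
    show "cmod (b1 n) < cmod (a1 n)"
      unfolding norms[OF s] using \<Lambda> \<delta>0[of n] by (intro real_less_lsqrt) (auto simp: power2_eq_square algebra_simps)
    show "cmod b2 < cmod (a2 n)"
      unfolding norms[OF s] using s by linarith
  qed (use r hol X0 disc circ in auto)
  \<comment> \<open>The first row is scaled by the gap 2 \<Lambda> \<delta>, which turns the
    singular entries \<open>m11\<close>, \<open>m12\<close> into 1 and -1; the scaling itself tends
    to 0 in \<open>c0\<close>.\<close>
  define c where "c n = ((1 :: complex, -1 :: complex, of_real (1 / ((\<Lambda> + \<delta> n)\<^sup>2 - \<beta>)) :: complex,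
      of_real (1 / ((\<Lambda> - \<delta> n)\<^sup>2 - \<beta>)) :: complex, of_real (2 * \<Lambda> * \<delta> n) :: complex, 1 :: complex), (a1 n, a2 n, b1 n, b2))" for n
  define k where "k = complex_of_real (1 / (\<Lambda>\<^sup>2 - \<beta>))"
  define c0 where "c0 = ((1 :: complex, -1 :: complex, k, k, 0 :: complex, 1 :: complex),
      (of_real \<Lambda> * w1, of_real \<Lambda> * w2, of_real \<Lambda> * v1, b2))"
  have \<beta>: "\<Lambda>\<^sup>2 - \<beta> > 0" unfolding \<beta>_def using \<Lambda> by (simp add: power_strict_mono)
  have UE: "V n 0 = (\<lambda>z. cauchy_quot (c n, X1 z, X2 z, 1))"
    if s: "\<delta> n < \<Lambda> - cmod b2" for n
  proof
    fix z
    interpret szego_data "a1 n" "a2 n" "b1 n" b2 X1 X2 "\<lambda>_. 1" r by (rule data[OF s])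
    have sq: "\<alpha>1 - \<beta>1 = 2 * \<Lambda> * \<delta> n" "\<alpha>2 - \<beta>1 = - (2 * \<Lambda> * \<delta> n)"
      by (simp_all add: \<alpha>1_def \<alpha>2_def \<beta>1_def norms[OF s] power2_eq_square algebra_simps)
    have "of_real (2 * \<Lambda> * \<delta> n) * m11 = 1" "of_real (2 * \<Lambda> * \<delta> n) * 1 * m12 = - 1"
      unfolding m11_def m12_def sq using \<Lambda> \<delta>0[of n] by (simp_all flip: of_real_mult)
    moreover have "A1 0 = a1 n" "A2 0 = a2 n" "B1 0 = b1 n" "B2 0 = b2"
      by (simp_all add: A1_def A2_def B1_def B2_def)
    moreover have "m21 = of_real (1 / ((\<Lambda> + \<delta> n)\<^sup>2 - \<beta>))" "m22 = of_real (1 / ((\<Lambda> - \<delta> n)\<^sup>2 - \<beta>))"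
      by (simp_all add: m21_def m22_def \<alpha>1_def \<alpha>2_def \<beta>2_def \<beta>_def norms[OF s])
    ultimately show "V n 0 z = cauchy_quot (c n, X1 z, X2 z, 1)"
      using U_eq_cauchy_quotient[of "of_real (2 * \<Lambda> * \<delta> n)" 1 0 z] \<Lambda> \<delta>0[of n]
      unfolding V_def c_def by simp
  qed
  have clim: "c \<longlonglongrightarrow> c0"
  proof -
    have "(\<lambda>n. complex_of_real (1 / ((\<Lambda> + \<delta> n)\<^sup>2 - \<beta>))) \<longlonglongrightarrow> of_real (1 / ((\<Lambda> + 0)\<^sup>2 - \<beta>))"
      "(\<lambda>n. complex_of_real (1 / ((\<Lambda> - \<delta> n)\<^sup>2 - \<beta>))) \<longlonglongrightarrow> of_real (1 / ((\<Lambda> - 0)\<^sup>2 - \<beta>))"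
      using \<beta> by (intro tendsto_of_real tendsto_intros \<delta>lim; simp)+
    then have 1: "(\<lambda>n. complex_of_real (1 / ((\<Lambda> + \<delta> n)\<^sup>2 - \<beta>))) \<longlonglongrightarrow> k"
      "(\<lambda>n. complex_of_real (1 / ((\<Lambda> - \<delta> n)\<^sup>2 - \<beta>))) \<longlonglongrightarrow> k"
      by (simp_all add: k_def)
    have "(\<lambda>n. complex_of_real (2 * \<Lambda> * \<delta> n)) \<longlonglongrightarrow> of_real (2 * \<Lambda> * 0)" by (intro tendsto_of_real tendsto_intros \<delta>lim)
    then have 2: "(\<lambda>n. complex_of_real (2 * \<Lambda> * \<delta> n)) \<longlonglongrightarrow> 0" by simp
    have "a1 \<longlonglongrightarrow> of_real (\<Lambda> + 0) * w1" "a2 \<longlonglongrightarrow> of_real (\<Lambda> - 0) * w2" "b1 \<longlonglongrightarrow> of_real (sqrt (\<Lambda>\<^sup>2 + 0\<^sup>2)) * v1"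
      unfolding a1_def a2_def b1_def by (intro tendsto_of_real tendsto_intros \<delta>lim)+
    then have 3: "a1 \<longlonglongrightarrow> of_real \<Lambda> * w1" "a2 \<longlonglongrightarrow> of_real \<Lambda> * w2" "b1 \<longlonglongrightarrow> of_real \<Lambda> * v1"
      using \<Lambda> by simp_all
    show ?thesis
      unfolding c_def[abs_def] c0_def by (intro tendsto_Pair tendsto_const 1 2 3)
  qed
  have den0: "cauchy_den (c0, x, y, 1) = of_real \<Lambda> * k * ((w1 - v1 * x) * (\<Lambda> * w2 - b2 * y) + (w2 - v1 * x) * (\<Lambda> * w1 - b2 * y))"
    and num0: "cauchy_num (c0, x, y, 1) = of_real \<Lambda> * (w1 + w2 - 2 * v1 * x)" for x y
    by (simp_all add: cauchy_den_def cauchy_num_def c0_def algebra_simps)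
  have k: "k \<noteq> 0" "k * (\<Lambda>\<^sup>2 - (cmod b2)\<^sup>2) = 1"
    using \<beta> by (simp_all add: k_def \<beta>_def flip: of_real_power of_real_diff of_real_mult)
  have quot0: "\<phi> z = cauchy_quot (c0, X1 z, X2 z, 1)" if "cmod z < r" for z
  proof -
    have eq: "p * q / s = of_real \<Lambda> * q / (of_real \<Lambda> * k * s)" if "k * p = 1" for p q s :: complex
    proof -
      have p: "p = 1 / k" using that k(1) by (simp add: field_simps)
      show ?thesis unfolding p using \<Lambda>(1) k(1) by simp
    qed
    show ?thesis unfolding \<phi>[OF that] den0 num0 by (rule eq[OF k(2)])
  qed
  have tc: "taylor_coeff \<phi> = taylor_coeff (\<lambda>z. cauchy_quot (c0, X1 z, X2 z, 1))"
    using taylor_coeff_cong[OF hol(3) _ quot0] r by simp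
  have "(\<lambda>n. h12_dist (taylor_coeff (\<lambda>z. cauchy_quot (c n, X1 z, X2 z, 1))) (taylor_coeff \<phi>)) \<longlonglongrightarrow> 0"
    unfolding tc using k(1) \<Lambda> nz
    by (intro cauchy_quotient_h12_tendsto[OF r hol(1,2) holomorphic_on_const clim]) (simp add: den0)
  moreover have "\<forall>\<^sub>F n in sequentially.
      h12_dist (taylor_coeff (\<lambda>z. cauchy_quot (c n, X1 z, X2 z, 1))) (taylor_coeff \<phi>)
      = h12_dist (taylor_coeff (V n 0)) (taylor_coeff \<phi>)"
    using small by eventually_elim (simp add: UE)
  ultimately have lim: "(\<lambda>n. h12_dist (taylor_coeff (V n 0)) (taylor_coeff \<phi>)) \<longlonglongrightarrow> 0"
    by (rule Lim_transform_eventually)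
  have ex: "\<exists>t\<ge>0. cmod (taylor_coeff (V n t) 0) = \<Lambda> - \<beta> * \<Lambda> / (\<Lambda>\<^sup>2 - (\<delta> n)\<^sup>2)" if s: "\<delta> n < \<Lambda> - cmod b2" for n
  proof -
    interpret szego_data "a1 n" "a2 n" "b1 n" b2 X1 X2 "\<lambda>_. 1" r by (rule data[OF s])
    define h where "h = 2 * \<Lambda> * \<delta> n"
    have h: "h > 0" using \<Lambda> \<delta>0[of n] by (simp add: h_def)
    have sq: "\<alpha>1 - \<beta>1 = h" "\<alpha>2 - \<beta>1 = - h" "\<alpha>1 - \<alpha>2 = 2 * h"
      by (simp_all add: h_def \<alpha>1_def \<alpha>2_def \<beta>1_def norms[OF s] power2_eq_square algebra_simps)
    \<comment> \<open>The relative phase of \<open>a1\<close> and \<open>a2\<close> rotates with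
      speed \<open>\<alpha>1 - \<alpha>2 = 2 * h > 0\<close>. However small this is, the phase
      reaches w2 / w1 at some nonnegative time, and then both carry the same phase \<omega>.\<close>
    have "cmod (w2 / w1) = 1" using unit by (simp add: norm_divide)
    then obtain t where t: "t \<ge> 0" "cis (2 * h * t) = w2 / w1"
      using cis_phase_exists[of "w2 / w1" "2 * h"] h by auto
    have w1: "w1 \<noteq> 0" using unit by auto
    define \<omega> where "\<omega> = w1 * cis (\<alpha>1 * t)"
    have \<omega>: "cmod \<omega> = 1" using unit by (simp add: \<omega>_def norm_mult)
    have "w2 * cis (\<alpha>2 * t) = \<omega>"
    proof -
      have "\<omega> = w1 * (cis (2 * h * t) * cis (\<alpha>2 * t))"
        unfolding \<omega>_def cis_mult sq(3)[symmetric] by (simp add: algebra_simps)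
      then show ?thesis using w1 by (simp add: t(2))
    qed
    moreover have "a1 n * x = of_real (\<Lambda> + \<delta> n) * (w1 * x)" "a2 n * x = of_real (\<Lambda> - \<delta> n) * (w2 * x)" for x
      by (simp_all add: a1_def a2_def mult.assoc)
    ultimately have A: "A1 t = of_real (\<Lambda> + \<delta> n) * \<omega>" "A2 t = of_real (\<Lambda> - \<delta> n) * \<omega>"
      unfolding A1_def A2_def by (simp_all only: \<omega>_def)
    define P Q where "P = \<alpha>1 - \<beta>2" and "Q = \<alpha>2 - \<beta>2"
    have PQ: "P = Q + 2 * h" "Q > 0" "P > 0" using sq ord_squares by (auto simp: P_def Q_def)
    define x y where "x = \<Lambda> + \<delta> n" and "y = \<Lambda> - \<delta> n"
    have xy: "x > 0" "y > 0" using \<Lambda> \<delta>0[of n] s norm_ge_zero[of b2] unfolding x_def y_def by linarith+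
    \<comment> \<open>At the origin the terms with \<open>X1\<close>, \<open>X2\<close> disappear
      and \<omega> factors out, so that only a quotient of real numbers remains.\<close>
    have "szego_data.U (a1 n) (a2 n) (b1 n) b2 X1 X2 (\<lambda>_. 1) t 0 * \<omega> = of_real ((P / x + Q / y) / 2)"
    proof -
      let ?n = "(1 / Q + 1 / h) * y + (1 / h - 1 / P) * x" and ?d = "1 / h * x * (1 / Q * y) + 1 / h * y * (1 / P * x)"
      have "?n / ?d = (P / x + Q / y) / 2"
      proof -
        have "?n = ((Q + h) * y * P + (P - h) * x * Q) / (h * P * Q)"
          using PQ(2,3) h by (simp add: field_simps)
        moreover have "?d = (P + Q) * x * y / (h * P * Q)"
          using PQ(2,3) h by (simp add: field_simps)
        ultimately have "?n / ?d
            = ((Q + h) * y * P + (P - h) * x * Q) / ((P + Q) * x * y)"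
          using PQ(2,3) h by simp
        also have "\<dots> = ((Q + h) * (y * P + x * Q)) / ((Q + h) * (2 * (x * y)))"
          unfolding PQ(1) by (simp add: algebra_simps)
        also have "\<dots> = (y * P + x * Q) / (2 * (x * y))"
          using PQ(2) h by (intro mult_divide_mult_cancel_left) simp
        finally show ?thesis using xy by (simp add: field_simps)
      qed
      then have e: "(complex_of_real ?n) / of_real ?d
          = of_real ((P / x + Q / y) / 2)"
        by (simp only: of_real_divide[symmetric])
      have "\<omega> \<noteq> 0" using \<omega> by auto
      have num: "c22 t 0 - c12 t 0 + 1 * (c11 t 0 - c21 t 0) = of_real ?n * \<omega>"
        unfolding c11_def c12_def c21_def c22_def m11_def m12_def m21_def m22_def A X0 sq x_def[symmetric] y_def[symmetric] P_def[symmetric] Q_def[symmetric]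
        by (simp add: algebra_simps)
      have den: "\<Delta> t 0 = of_real ?d * (\<omega> * \<omega>)"
        unfolding \<Delta>_def c11_def c12_def c21_def c22_def m11_def m12_def m21_def m22_def A X0 sq x_def[symmetric] y_def[symmetric] P_def[symmetric] Q_def[symmetric]
        by (simp add: algebra_simps)
      show ?thesis
        unfolding U_def num den e[symmetric] using \<open>\<omega> \<noteq> 0\<close> by simp
    qed
    then have "cmod (V n t 0) * cmod \<omega> = \<bar>(P / x + Q / y) / 2\<bar>"
      unfolding V_def norm_mult[symmetric] by (simp only: norm_of_real)
    then have "cmod (V n t 0) = (P / x + Q / y) / 2" using \<omega> PQ(2,3) xy by simp
    also have "\<dots> = \<Lambda> - \<beta> * \<Lambda> / (\<Lambda>\<^sup>2 - (\<delta> n)\<^sup>2)"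
    proof -
      have PQ': "P = x\<^sup>2 - \<beta>" "Q = y\<^sup>2 - \<beta>"
        by (simp_all add: P_def Q_def \<alpha>1_def \<alpha>2_def \<beta>2_def \<beta>_def norms[OF s] x_def y_def)
      have "(P / x + Q / y) / 2 = (x + y) / 2 - \<beta> * ((x + y) / 2) / (x * y)"
        unfolding PQ' using xy by (simp add: field_simps power2_eq_square)
      moreover have "(x + y) / 2 = \<Lambda>" "x * y = \<Lambda>\<^sup>2 - (\<delta> n)\<^sup>2" by (simp_all add: x_def y_def power2_eq_square algebra_simps)
      ultimately show ?thesis by simp
    qed
    finally show ?thesis using t(1) by (auto simp: taylor_coeff_0)
  qed
  define t where "t n = (SOME t. t \<ge> 0 \<and> cmod (taylor_coeff (V n t) 0) = \<Lambda> - \<beta> * \<Lambda> / (\<Lambda>\<^sup>2 - (\<delta> n)\<^sup>2))" for n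
  have t: "t n \<ge> 0" "cmod (taylor_coeff (V n (t n)) 0) = \<Lambda> - \<beta> * \<Lambda> / (\<Lambda>\<^sup>2 - (\<delta> n)\<^sup>2)" if "\<delta> n < \<Lambda> - cmod b2" for n
    using someI_ex[OF ex[OF that, unfolded Bex_def]] unfolding t_def by auto
  define \<epsilon> where "\<epsilon> = (\<Lambda> - \<beta> / \<Lambda> - cmod (\<phi> 0)) / 2"
  have \<epsilon>: "\<epsilon> > 0" using \<phi>0 by (simp add: \<epsilon>_def \<beta>_def)
  have "(\<lambda>n. \<Lambda> - \<beta> * \<Lambda> / (\<Lambda>\<^sup>2 - (\<delta> n)\<^sup>2)) \<longlonglongrightarrow> \<Lambda> - \<beta> * \<Lambda> / (\<Lambda>\<^sup>2 - 0\<^sup>2)"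
    using \<Lambda> by (intro tendsto_intros \<delta>lim) simp
  moreover have "\<Lambda> - \<beta> * \<Lambda> / (\<Lambda>\<^sup>2 - 0\<^sup>2) > cmod (\<phi> 0) + \<epsilon>"
  proof -
    have e: "\<beta> * \<Lambda> / (\<Lambda>\<^sup>2 - 0\<^sup>2) = \<beta> / \<Lambda>" using \<Lambda>(1) by (simp add: power2_eq_square)
    have "x + (y - x) / 2 < y" if "0 < (y - x) / 2" for x y :: real using that by (simp add: field_simps)
    then show ?thesis using \<epsilon> unfolding e \<epsilon>_def by blast
  qed
  ultimately have large: "\<forall>\<^sub>F n in sequentially. \<Lambda> - \<beta> * \<Lambda> / (\<Lambda>\<^sup>2 - (\<delta> n)\<^sup>2) > cmod (\<phi> 0) + \<epsilon>"
    by (rule order_tendstoD)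
  have rot0: "cmod (taylor_coeff (rot a b \<phi>) 0) = cmod (\<phi> 0)" for a b
    by (simp add: taylor_coeff_0 rot_def norm_mult)
  show ?thesis
  proof (rule orbitally_unstableI[OF \<epsilon> hol(3) r lim, where u = "\<lambda>n t. taylor_coeff (V n t)" and t = t and k = 0])
    show "\<forall>\<^sub>F n in sequentially. szego_solution (taylor_coeff (V n 0)) (\<lambda>t. taylor_coeff (V n t)) \<and> t n \<ge> 0
      \<and> (\<forall>a b. \<epsilon> \<le> cmod (taylor_coeff (V n (t n)) 0) - cmod (taylor_coeff (rot a b \<phi>) 0))"
      using small large
    proof eventually_elim
      case (elim n)
      show ?case
        using szego_data.szego_solution_U[OF data[OF elim(1)]] t[OF elim(1)] elim(2) rot0
        unfolding V_def by auto
    qed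
  qed
qed

text \<open>Here the moduli of \<open>b\<^sub>1\<close> and \<open>b\<^sub>2\<close> merge, and the first Fourier coefficient, which vanishes on the orbit,
  becomes large. The perturbation \<open>h n\<close> is tuned to the time \<open>\<tau> n\<close> so that all phases except that of \<open>a\<^sub>1\<close> are
  known exactly at that time.\<close>

lemma orbitally_unstable_merging_b:
  fixes \<alpha> q :: complex and N :: nat
  assumes \<alpha>: "\<alpha> \<noteq> 0" and q: "0 < cmod q" "cmod q < 1" and N: "N \<ge> 2"
  shows "orbitally_unstable (\<lambda>z. \<alpha> / (1 - q * z ^ N))"
proof -
  define \<phi> where "\<phi> z = \<alpha> / (1 - q * z ^ N)" for z
  \<comment> \<open>\<Lambda> and \<mu> are the two nonzero singular values of the Hankel operator
    of \<phi>. The phases of \<open>a1\<close> and \<open>a2\<close> are then fixed by \<kappa> / a1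
    = \<alpha> and a1 a2 q = \<mu>^2, which make the limiting quotient equal to \<phi>.\<close>
  define \<Lambda> where "\<Lambda> = cmod \<alpha> / (1 - (cmod q)\<^sup>2)"
  define \<mu> where "\<mu> = cmod q * \<Lambda>"
  define \<kappa> where "\<kappa> = \<Lambda>\<^sup>2 - \<mu>\<^sup>2"
  define a1 where "a1 = of_real \<kappa> / \<alpha>"
  define a2 where "a2 = of_real (\<mu>\<^sup>2) / (a1 * q)"
  have q2: "(cmod q)\<^sup>2 < 1" using q by (simp add: power_less_one_iff)
  have \<Lambda>: "\<Lambda> > 0" using \<alpha> q2 by (simp add: \<Lambda>_def)
  have \<mu>: "0 < \<mu>" "\<mu> < \<Lambda>" using q \<Lambda> by (auto simp: \<mu>_def)
  have \<kappa>: "\<kappa> = \<Lambda> * cmod \<alpha>" "\<kappa> > 0"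
  proof -
    have "\<kappa> = \<Lambda> * (\<Lambda> * (1 - (cmod q)\<^sup>2))" by (simp add: \<kappa>_def \<mu>_def power2_eq_square algebra_simps)
    then show "\<kappa> = \<Lambda> * cmod \<alpha>" using q2 by (simp add: \<Lambda>_def)
    then show "\<kappa> > 0" using \<Lambda> \<alpha> by simp
  qed
  have na1: "cmod a1 = \<Lambda>" unfolding a1_def norm_divide norm_of_real using \<alpha> \<kappa> by (simp add: \<Lambda> less_imp_le)
  have na2: "cmod a2 = \<mu>"
  proof -
    have "cmod a2 = \<mu>\<^sup>2 / \<mu>" unfolding a2_def norm_divide norm_mult na1 norm_of_real by (simp add: \<mu>_def mult.commute)
    then show ?thesis using \<mu> by (simp add: power2_eq_square)
  qed
  have a0: "a1 \<noteq> 0" "a2 \<noteq> 0" using na1 na2 \<Lambda> \<mu> by auto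
  \<comment> \<open>Tuned so that h \<tau> = pi / 2 while \<mu>^2 \<tau> is a multiple of 2 pi. At
    time \<tau> the parameter \<open>a2\<close> has its initial phase again, whereas
    \<open>b1\<close> and \<open>b2\<close>, which start with opposite signs, have turned by i and
    -i and now point the same way.\<close>
  define h where "h n = \<mu>\<^sup>2 / (4 * real (Suc n))" for n
  define \<tau> where "\<tau> n = 2 * pi * real (Suc n) / \<mu>\<^sup>2" for n
  define b1 where "b1 n = complex_of_real (sqrt (\<mu>\<^sup>2 + h n))" for n
  define b2 where "b2 n = - complex_of_real (sqrt (\<mu>\<^sup>2 - h n))" for n
  define \<Psi> where "\<Psi> = (\<lambda>z :: complex. z ^ (N - 2))"
  define V where "V n = szego_data.U a1 a2 (b1 n) (b2 n) (\<lambda>z. z) (\<lambda>z. z) \<Psi>" for n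
  have \<mu>2: "\<mu>\<^sup>2 > 0" using \<mu> by simp
  have h: "0 < h n" "h n < \<mu>\<^sup>2" for n
  proof -
    show "0 < h n" using \<mu>2 by (simp add: h_def)
    have "\<mu>\<^sup>2 * 1 < \<mu>\<^sup>2 * (4 * real (Suc n))" using \<mu>2 by (intro mult_strict_left_mono) auto
    then show "h n < \<mu>\<^sup>2" by (simp add: h_def field_simps)
  qed
  have hlim: "h \<longlonglongrightarrow> 0"
  proof -
    have "(\<lambda>n. \<mu>\<^sup>2 / 4 * (1 / real (Suc n))) \<longlonglongrightarrow> \<mu>\<^sup>2 / 4 * 0"
      by (intro tendsto_intros LIMSEQ_Suc[OF lim_1_over_n])
    then show ?thesis by (simp add: h_def[abs_def] field_simps)
  qed
  have small: "\<forall>\<^sub>F n in sequentially. h n < \<kappa>"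
    using \<kappa>(2) by (intro order_tendstoD[OF hlim]) auto
  have nb: "cmod (b1 n) = sqrt (\<mu>\<^sup>2 + h n)" "cmod (b2 n) = sqrt (\<mu>\<^sup>2 - h n)" for n
    using h[of n] \<mu>2 by (simp_all add: b1_def b2_def)
  have \<Psi>: "\<Psi> holomorphic_on A" for A unfolding \<Psi>_def by (intro holomorphic_intros)
  have data: "szego_data a1 a2 (b1 n) (b2 n) (\<lambda>z. z) (\<lambda>z. z) \<Psi> r" if s: "h n < \<kappa>" and r: "r > 1" for n r
  proof (rule szego_data.intro)
    show "cmod (b2 n) < cmod a2"
      unfolding nb na2 using \<mu> h[of n] by (intro real_less_lsqrt) auto
    show "cmod a2 < cmod (b1 n)"
      unfolding nb na2 using \<mu> h[of n] by (intro real_less_rsqrt) auto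
    show "cmod (b1 n) < cmod a1"
      unfolding nb na1 using \<Lambda> s by (intro real_less_lsqrt) (auto simp: \<kappa>_def)
  qed (use r \<Psi> in \<open>auto simp: \<Psi>_def norm_power power_le_one intro!: holomorphic_intros\<close>)
  define M where "M n = (complex_of_real (1 / (\<kappa> - h n)), -1 :: complex, complex_of_real (1 / (\<kappa> + h n)), 1 :: complex,
      1 :: complex, complex_of_real (h n))" for n
  define M0 where "M0 = (complex_of_real (1 / \<kappa>), -1 :: complex, complex_of_real (1 / \<kappa>), 1 :: complex, 1 :: complex, 0 :: complex)"
  have Mlim: "M \<longlonglongrightarrow> M0"
  proof -
    have "(\<lambda>n. complex_of_real (1 / (\<kappa> - h n))) \<longlonglongrightarrow> of_real (1 / (\<kappa> - 0))"
      "(\<lambda>n. complex_of_real (1 / (\<kappa> + h n))) \<longlonglongrightarrow> of_real (1 / (\<kappa> + 0))"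
      using \<kappa>(2) by (intro tendsto_of_real tendsto_intros hlim; simp)+
    moreover have "(\<lambda>n. complex_of_real (h n)) \<longlonglongrightarrow> of_real 0"
      by (intro tendsto_of_real hlim)
    ultimately show ?thesis unfolding M_def[abs_def] M0_def by (intro tendsto_Pair tendsto_const) simp_all
  qed
  have VE: "V n t = (\<lambda>z. cauchy_quot ((M n, x1, x2, y1, y2), z, z, \<Psi> z))"
    if s: "h n < \<kappa>" and x: "x1 = a1 * cis (\<Lambda>\<^sup>2 * t)" "x2 = a2 * cis (\<mu>\<^sup>2 * t)"
      "y1 = b1 n * cis ((\<mu>\<^sup>2 + h n) * t)" "y2 = b2 n * cis ((\<mu>\<^sup>2 - h n) * t)" for n t x1 x2 y1 y2
  proof
    fix z
    interpret szego_data a1 a2 "b1 n" "b2 n" "\<lambda>z. z" "\<lambda>z. z" \<Psi> 2 by (rule data[OF s]) simp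
    have sq: "\<alpha>1 = \<Lambda>\<^sup>2" "\<alpha>2 = \<mu>\<^sup>2" "\<beta>1 = \<mu>\<^sup>2 + h n" "\<beta>2 = \<mu>\<^sup>2 - h n"
      using h[of n] \<mu>2 unfolding \<alpha>1_def \<alpha>2_def \<beta>1_def \<beta>2_def na1 na2 nb by auto
    have "A1 t = x1" "A2 t = x2" "B1 t = y1" "B2 t = y2"
      unfolding A1_def A2_def B1_def B2_def sq x by auto
    moreover have "m11 = of_real (1 / (\<kappa> - h n))" "m21 = of_real (1 / (\<kappa> + h n))"
      "of_real (h n) * m12 = - 1" "of_real (h n) * m22 = 1"
      using h[of n] unfolding m11_def m12_def m21_def m22_def sq \<kappa>_def by (simp_all add: algebra_simps flip: of_real_mult)
    ultimately show "V n t z = cauchy_quot ((M n, x1, x2, y1, y2), z, z, \<Psi> z)"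
      using U_eq_cauchy_quotient[of 1 "of_real (h n)" t z] h[of n] unfolding V_def M_def by simp
  qed
  have blim: "(\<lambda>n. complex_of_real (sqrt (\<mu>\<^sup>2 + h n))) \<longlonglongrightarrow> of_real \<mu>" "(\<lambda>n. complex_of_real (sqrt (\<mu>\<^sup>2 - h n))) \<longlonglongrightarrow> of_real \<mu>"
  proof -
    have "(\<lambda>n. complex_of_real (sqrt (\<mu>\<^sup>2 + h n))) \<longlonglongrightarrow> of_real (sqrt (\<mu>\<^sup>2 + 0))"
      "(\<lambda>n. complex_of_real (sqrt (\<mu>\<^sup>2 - h n))) \<longlonglongrightarrow> of_real (sqrt (\<mu>\<^sup>2 - 0))"
      by (intro tendsto_of_real tendsto_intros hlim)+
    then show "(\<lambda>n. complex_of_real (sqrt (\<mu>\<^sup>2 + h n))) \<longlonglongrightarrow> of_real \<mu>" "(\<lambda>n. complex_of_real (sqrt (\<mu>\<^sup>2 - h n))) \<longlonglongrightarrow> of_real \<mu>"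
      using \<mu> by simp_all
  qed
  have zz: "\<Psi> z * (z * z) = z ^ N" for z
  proof -
    have "N - 2 + 2 = N" using N by simp
    from power_add[of z "N - 2" 2, unfolded this power2_eq_square] show ?thesis by (simp only: \<Psi>_def)
  qed
  define c0 where "c0 = (M0, a1, a2, complex_of_real \<mu>, - complex_of_real \<mu>)"
  have nz: "1 - q * z ^ N \<noteq> 0" if "cmod z \<le> 1" for z
  proof
    assume "1 - q * z ^ N = 0"
    then have "cmod q * cmod z ^ N = 1" by (simp flip: norm_power norm_mult)
    moreover have "cmod q * cmod z ^ N \<le> cmod q * 1" using that by (intro mult_left_mono power_le_one) auto
    ultimately show False using q by simp
  qed
  have "(\<lambda>z. 1 - q * z ^ N) holomorphic_on ball 0 2" "1 < (2::real)" by (auto intro!: holomorphic_intros)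
  from nonzero_on_larger_ball[OF this nz] obtain r
    where r: "1 < r" "\<And>z. cmod z \<le> r \<Longrightarrow> 1 - q * z ^ N \<noteq> 0"
    by metis
  have hol\<phi>: "\<phi> holomorphic_on ball 0 r"
    unfolding \<phi>_def using r(2) by (intro holomorphic_intros) auto
  have num0: "cauchy_num (c0, z, z, \<Psi> z) = 2 * a2" for z
    by (simp add: cauchy_num_def c0_def M0_def)
  have den0: "cauchy_den (c0, z, z, \<Psi> z) = 2 * of_real (1 / \<kappa>) * (a1 * a2) * (1 - q * z ^ N)" for z
  proof -
    have "cauchy_den (c0, z, z, \<Psi> z) = 2 * of_real (1 / \<kappa>) * (a1 * a2 - of_real (\<mu>\<^sup>2) * (\<Psi> z * (z * z)))"
      by (simp add: cauchy_den_def c0_def M0_def algebra_simps power2_eq_square)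
    also have "of_real (\<mu>\<^sup>2) = a1 * a2 * q"
      unfolding a2_def using a0(1) q by (auto simp: field_simps)
    also have "2 * of_real (1 / \<kappa>) * (a1 * a2 - a1 * a2 * q * (\<Psi> z * (z * z)))
        = 2 * of_real (1 / \<kappa>) * (a1 * a2) * (1 - q * z ^ N)"
      unfolding zz by (simp only: right_diff_distrib mult_1_right mult.assoc)
    finally show ?thesis .
  qed
  have quot0: "cauchy_quot (c0, z, z, \<Psi> z) = \<phi> z" for z
  proof -
    have "2 * a2 / (2 * of_real (1 / \<kappa>) * (a1 * a2) * D) = (of_real \<kappa> / a1) / D" for D :: complex
      using a0 \<kappa>(2) by (simp add: field_simps)
    moreover have "of_real \<kappa> / a1 = \<alpha>" unfolding a1_def using \<alpha> \<kappa>(2) by simp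
    ultimately show ?thesis unfolding num0 den0 \<phi>_def by simp
  qed
  have "(\<lambda>n. (M n, a1, a2, b1 n, b2 n)) \<longlonglongrightarrow> c0"
    unfolding c0_def b1_def b2_def by (intro tendsto_Pair tendsto_const tendsto_minus Mlim blim)
  then have "(\<lambda>n. h12_dist (taylor_coeff (\<lambda>z. cauchy_quot ((M n, a1, a2, b1 n, b2 n), z, z, \<Psi> z)))
      (taylor_coeff (\<lambda>z. cauchy_quot (c0, z, z, \<Psi> z)))) \<longlonglongrightarrow> 0"
    using a0 \<kappa>(2) nz by (intro cauchy_quotient_h12_tendsto[OF r(1) holomorphic_on_ident holomorphic_on_ident \<Psi>]) (auto simp: den0)
  moreover have "\<forall>\<^sub>F n in sequentially. h12_dist (taylor_coeff (\<lambda>z. cauchy_quot ((M n, a1, a2, b1 n, b2 n), z, z, \<Psi> z)))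
      (taylor_coeff (\<lambda>z. cauchy_quot (c0, z, z, \<Psi> z)))
      = h12_dist (taylor_coeff (V n 0)) (taylor_coeff \<phi>)"
    using small by eventually_elim (simp add: VE[where t = 0] quot0)
  ultimately have lim: "(\<lambda>n. h12_dist (taylor_coeff (V n 0)) (taylor_coeff \<phi>)) \<longlonglongrightarrow> 0"
    by (rule Lim_transform_eventually)
  \<comment> \<open>The phase \<Lambda>^2 \<tau> of \<open>a1\<close> is not controlled; a
    subsequence along which it converges suffices, since the modulus of the limiting coefficient
    does not depend on the limit w.\<close>
  have "seq_compact (sphere (0::complex) 1)" by (intro compact_imp_seq_compact compact_sphere)
  then obtain w s where w: "w \<in> sphere (0::complex) 1" and s: "strict_mono s" "((\<lambda>n. cis (\<Lambda>\<^sup>2 * \<tau> n)) \<circ> s) \<longlonglongrightarrow> w"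
    unfolding seq_compact_def by (metis mem_sphere_0 norm_cis)
  have cis\<tau>: "cis (\<mu>\<^sup>2 * \<tau> n) = 1" "cis ((\<mu>\<^sup>2 + h n) * \<tau> n) = \<i>" "cis ((\<mu>\<^sup>2 - h n) * \<tau> n) = - \<i>" for n
  proof -
    have 1: "\<mu>\<^sup>2 * \<tau> n = 2 * pi * real (Suc n)" using \<mu> by (simp add: \<tau>_def)
    have sub: "\<mu>\<^sup>2 / (4 * x) * (2 * pi * x / \<mu>\<^sup>2) = pi / 2" if "x > 0" for x
      using \<mu> that by (simp add: field_simps)
    have 2: "h n * \<tau> n = pi / 2" unfolding \<tau>_def h_def by (rule sub) simp
    show 3: "cis (\<mu>\<^sup>2 * \<tau> n) = 1" unfolding 1 by (rule cis_multiple_2pi) simp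
    show "cis ((\<mu>\<^sup>2 + h n) * \<tau> n) = \<i>" "cis ((\<mu>\<^sup>2 - h n) * \<tau> n) = - \<i>"
      unfolding distrib_right left_diff_distrib cis_mult[symmetric] cis_divide[symmetric] 2 3 by simp_all
  qed
  define c1 where "c1 = (M0, a1 * w, a2, \<i> * of_real \<mu>, \<i> * of_real \<mu>)"
  define d where "d n = (M n, a1 * cis (\<Lambda>\<^sup>2 * \<tau> n), a2, \<i> * of_real (sqrt (\<mu>\<^sup>2 + h n)), \<i> * of_real (sqrt (\<mu>\<^sup>2 - h n)))" for n
  have VE\<tau>: "V n (\<tau> n) = (\<lambda>z. cauchy_quot (d n, z, z, \<Psi> z))" if "h n < \<kappa>" for n
    unfolding d_def by (rule VE[OF that]) (simp_all add: cis\<tau> b1_def b2_def)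
  have dlim: "(\<lambda>n. d (s n)) \<longlonglongrightarrow> c1"
    unfolding d_def c1_def
    using s(2) LIMSEQ_subseq_LIMSEQ[OF Mlim s(1)] LIMSEQ_subseq_LIMSEQ[OF blim(1) s(1)] LIMSEQ_subseq_LIMSEQ[OF blim(2) s(1)]
    by (intro tendsto_Pair tendsto_const tendsto_mult) (simp_all add: o_def)
  have w0: "w \<noteq> 0" "cmod w = 1" using w by auto
  \<comment> \<open>With \<open>b1\<close> and \<open>b2\<close> aligned, numerator and denominator
    share the factor \<open>e\<close>. As |a2| = \<mu>, this factor has no zero in the open disc but
    does vanish on the circle, so the cancellation is carried out for |z| < 1 only.\<close>
  have quot1: "cauchy_quot (c1, z, z, \<Psi> z) = of_real \<kappa> / (a1 * w - \<i> * of_real \<mu> * z)"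
    if z: "cmod z < 1" for z
  proof -
    define e where "e = a2 - \<Psi> z * (\<i> * of_real \<mu> * z)"
    have "e \<noteq> 0"
    proof
      assume "e = 0"
      then have "cmod a2 = cmod (\<Psi> z) * (\<mu> * cmod z)" using \<mu> by (simp add: e_def norm_mult)
      also have "\<dots> \<le> 1 * (\<mu> * cmod z)"
        using z \<mu> by (intro mult_right_mono) (auto simp: \<Psi>_def norm_power power_le_one)
      also have "\<dots> < \<mu> * 1" using z \<mu> by simp
      finally show False by (simp add: na2)
    qed
    moreover have "cauchy_num (c1, z, z, \<Psi> z) = 2 * e"
      "cauchy_den (c1, z, z, \<Psi> z) = 2 * of_real (1 / \<kappa>) * (a1 * w - \<i> * of_real \<mu> * z) * e"
      by (simp_all add: cauchy_num_def cauchy_den_def c1_def M0_def e_def algebra_simps add_divide_distrib)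
    moreover have "2 * e / (2 * of_real (1 / \<kappa>) * D * e) = of_real \<kappa> / D" if "e \<noteq> 0" for D
      using that \<kappa>(2) by simp
    ultimately show ?thesis by (simp only: not_False_eq_True)
  qed
  have den1: "a1 * w - \<i> * of_real \<mu> * z \<noteq> 0" if z: "cmod z < 1" for z
  proof
    assume "a1 * w - \<i> * of_real \<mu> * z = 0"
    then have "cmod (a1 * w) = cmod (\<i> * of_real \<mu> * z)" by simp
    then have "\<Lambda> = \<mu> * cmod z" using \<mu> w0 by (simp add: norm_mult na1)
    moreover have "\<mu> * cmod z \<le> \<mu> * 1" using z \<mu> by (intro mult_left_mono) auto
    ultimately show False using \<mu> by simp
  qed
  define l where "l = of_real \<kappa> * (\<i> * of_real \<mu>) / (a1 * w)\<^sup>2"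
  have "taylor_coeff (\<lambda>z. of_real \<kappa> / (a1 * w - \<i> * of_real \<mu> * z)) 1 = l"
  proof -
    have "((\<lambda>z. of_real \<kappa> / (a1 * w - \<i> * of_real \<mu> * z)) has_field_derivative l) (at 0)"
      unfolding l_def using a0 w0 by (auto intro!: derivative_eq_intros simp: power2_eq_square)
    then show ?thesis by (simp add: taylor_coeff_def DERIV_imp_deriv)
  qed
  moreover have "taylor_coeff (\<lambda>z. of_real \<kappa> / (a1 * w - \<i> * of_real \<mu> * z))
      = taylor_coeff (\<lambda>z. cauchy_quot (c1, z, z, \<Psi> z))"
    using den1 quot1 by (intro taylor_coeff_cong[of _ 1]) (auto intro!: holomorphic_intros)
  moreover have "(\<lambda>n. taylor_coeff (\<lambda>z. cauchy_quot (d (s n), z, z, \<Psi> z)) 1)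
      \<longlonglongrightarrow> taylor_coeff (\<lambda>z. cauchy_quot (c1, z, z, \<Psi> z)) 1"
    using a0 w0 \<kappa>(2) by (intro cauchy_quotient_coeff_tendsto[OF zero_less_one holomorphic_on_ident holomorphic_on_ident \<Psi> dlim])
      (simp add: cauchy_den_def c1_def M0_def)
  ultimately have "(\<lambda>n. taylor_coeff (\<lambda>z. cauchy_quot (d (s n), z, z, \<Psi> z)) 1) \<longlonglongrightarrow> l"
    by simp
  then have "(\<lambda>n. cmod (taylor_coeff (\<lambda>z. cauchy_quot (d (s n), z, z, \<Psi> z)) 1)) \<longlonglongrightarrow> cmod l"
    by (rule tendsto_norm)
  moreover define \<epsilon> where "\<epsilon> = cmod l / 2"
  have \<epsilon>: "\<epsilon> > 0" using \<kappa>(2) \<mu> a0 w0 by (simp add: \<epsilon>_def l_def)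
  then have "\<epsilon> < cmod l" by (simp add: \<epsilon>_def)
  ultimately have large: "\<forall>\<^sub>F n in sequentially.
      \<epsilon> < cmod (taylor_coeff (\<lambda>z. cauchy_quot (d (s n), z, z, \<Psi> z)) 1)"
    by (rule order_tendstoD(1))
  have small': "\<forall>\<^sub>F n in sequentially. h (s n) < \<kappa>"
    using small s(1) by (rule eventually_subseq[rotated])
  have rot1: "taylor_coeff (rot a b \<phi>) 1 = 0" for a b
  proof -
    have "(rot a b \<phi> has_field_derivative 0) (at 0)"
      unfolding rot_def \<phi>_def using N by (auto intro!: derivative_eq_intros simp: power_0_left)
    then show ?thesis by (simp add: taylor_coeff_def DERIV_imp_deriv)
  qed
  have "orbitally_unstable \<phi>"
  proof (rule orbitally_unstableI[OF \<epsilon> hol\<phi> r(1), where ?u0.0 = "\<lambda>n. taylor_coeff (V (s n) 0)"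
        and u = "\<lambda>n t. taylor_coeff (V (s n) t)" and t = "\<lambda>n. \<tau> (s n)" and k = 1])
    show "(\<lambda>n. h12_dist (taylor_coeff (V (s n) 0)) (taylor_coeff \<phi>)) \<longlonglongrightarrow> 0"
      using LIMSEQ_subseq_LIMSEQ[OF lim s(1)] by (simp add: o_def)
    show "\<forall>\<^sub>F n in sequentially. szego_solution (taylor_coeff (V (s n) 0)) (\<lambda>t. taylor_coeff (V (s n) t)) \<and> \<tau> (s n) \<ge> 0
      \<and> (\<forall>a b. \<epsilon> \<le> cmod (taylor_coeff (V (s n) (\<tau> (s n))) 1) - cmod (taylor_coeff (rot a b \<phi>) 1))"
      using small' large
    proof eventually_elim
      case (elim n)
      have "\<tau> (s n) \<ge> 0" by (simp add: \<tau>_def)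
      then show ?case
        using szego_data.szego_solution_U[OF data[OF elim(1), of 2]] elim(2) rot1 VE\<tau>[OF elim(1)]
        by (auto simp: V_def)
    qed
  qed
  then show ?thesis by (simp add: \<phi>_def[abs_def])
qed

section \<open>Blaschke products and the rational family\<close>

lemma blaschke_factor_identity:
  "(cmod (1 - p * z))\<^sup>2 - (cmod (z - cnj p))\<^sup>2 = (1 - (cmod p)\<^sup>2) * (1 - (cmod z)\<^sup>2)"
  unfolding cmod_power2 by (simp add: power2_eq_square algebra_simps)

lemma one_minus_mult_nonzero:
  assumes "cmod p < 1" "cmod z \<le> 1"
  shows "1 - p * z \<noteq> 0"
proof
  assume "1 - p * z = 0"
  then have "cmod p * cmod z = 1" by (simp flip: norm_mult)
  moreover have "cmod p * cmod z \<le> cmod p * 1" using assms by (intro mult_left_mono) auto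
  ultimately show False using assms by simp
qed

lemma blaschke_factor_norm:
  assumes "cmod p < 1"
  shows "cmod z \<le> 1 \<Longrightarrow> cmod ((z - cnj p) / (1 - p * z)) \<le> 1"
    and "cmod z = 1 \<Longrightarrow> cmod ((z - cnj p) / (1 - p * z)) = 1"
proof -
  have p: "(cmod p)\<^sup>2 \<le> 1" using assms by (simp add: power_le_one)
  show "cmod ((z - cnj p) / (1 - p * z)) \<le> 1" if "cmod z \<le> 1"
  proof -
    have "0 \<le> (1 - (cmod p)\<^sup>2) * (1 - (cmod z)\<^sup>2)"
      using p that by (intro mult_nonneg_nonneg) (auto simp: power_le_one)
    then have "(cmod (z - cnj p))\<^sup>2 \<le> (cmod (1 - p * z))\<^sup>2"
      using blaschke_factor_identity[of p z] by linarith
    then have "cmod (z - cnj p) \<le> cmod (1 - p * z)" by (rule power2_le_imp_le) simp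
    then show ?thesis using one_minus_mult_nonzero[OF assms that] by (simp add: norm_divide)
  qed
  show "cmod ((z - cnj p) / (1 - p * z)) = 1" if "cmod z = 1"
  proof -
    have "(cmod (z - cnj p))\<^sup>2 = (cmod (1 - p * z))\<^sup>2"
      using blaschke_factor_identity[of p z] that by simp
    then have "cmod (z - cnj p) = cmod (1 - p * z)" by (rule power2_eq_imp_eq) auto
    then show ?thesis using one_minus_mult_nonzero[OF assms, of z] that by (simp add: norm_divide)
  qed
qed

text \<open>A disc automorphism sends B(0) to 0 and gives an admissible X with B = (\<beta> + X) /
  (1 + cnj \<beta> X). This matches the limit in \<open>orbitally_unstable_merging_a\<close> with b2
  = 0: comparing coefficients prescribes w1 + w2 and w1 w2. The required gap |\<phi>(0)| <
  |\<alpha>| is |B(0)| < 1.\<close>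

lemma orbitally_unstable_inner:
  fixes B :: "complex \<Rightarrow> complex" and \<alpha> :: complex
  assumes \<alpha>: "\<alpha> \<noteq> 0" and r1: "r1 > 1" and B: "B holomorphic_on ball 0 r1" "\<And>z. cmod z \<le> 1 \<Longrightarrow> cmod (B z) \<le> 1"
    "\<And>z. cmod z = 1 \<Longrightarrow> cmod (B z) = 1" and B0: "cmod (B 0) < 1"
  shows "orbitally_unstable (\<lambda>z. \<alpha> * B z)"
proof -
  define \<beta> where "\<beta> = B 0"
  have \<beta>: "cmod (cnj \<beta>) < 1" using B0 by (simp add: \<beta>_def)
  have nzB: "1 - cnj \<beta> * B z \<noteq> 0" if "cmod z \<le> 1" for z
    by (rule one_minus_mult_nonzero[OF \<beta> B(2)[OF that]])
  have holB1: "(\<lambda>z. 1 - cnj \<beta> * B z) holomorphic_on ball 0 r1" by (intro holomorphic_intros B(1))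
  obtain r where r: "1 < r" "r < r1" "\<And>z. cmod z \<le> r \<Longrightarrow> 1 - cnj \<beta> * B z \<noteq> 0"
    using nonzero_on_larger_ball[OF holB1 r1 nzB] by metis
  have holB: "B holomorphic_on ball 0 r" using r by (intro holomorphic_on_subset[OF B(1)]) auto
  define X where "X z = (B z - \<beta>) / (1 - cnj \<beta> * B z)" for z
  have holX: "X holomorphic_on ball 0 r"
    unfolding X_def using r(3) by (intro holomorphic_intros holB) auto
  have X0: "X 0 = 0" by (simp add: X_def \<beta>_def)
  have X: "cmod z \<le> 1 \<Longrightarrow> cmod (X z) \<le> 1" "cmod z = 1 \<Longrightarrow> cmod (X z) = 1" for z
    using blaschke_factor_norm[OF \<beta>, of "B z"] B(2,3)[of z] by (auto simp: X_def)
  define \<Lambda> where "\<Lambda> = cmod \<alpha>"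
  define s where "s = cmod \<beta>"
  \<comment> \<open>The phase of \<beta>; the value 1 at \<beta> = 0 keeps both |e| = 1 and
    \<open>\<beta> = of_real s * e\<close> valid.\<close>
  define e where "e = (if \<beta> = 0 then 1 else \<beta> / of_real s)"
  define v where "v = \<alpha> / of_real \<Lambda>"
  have \<Lambda>: "\<Lambda> > 0" using \<alpha> by (simp add: \<Lambda>_def)
  have s: "0 \<le> s" "s < 1" using \<beta> by (auto simp: s_def)
  have e: "cmod e = 1" "\<beta> = of_real s * e" by (auto simp: e_def s_def norm_divide)
  have v: "cmod v = 1" "\<alpha> = of_real \<Lambda> * v" using \<Lambda> by (auto simp: v_def \<Lambda>_def norm_divide)
  have ee: "e * cnj e = 1" "v * cnj v = 1"
    using e(1) v(1) by (simp_all add: complex_norm_square[symmetric])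
  \<comment> \<open>The common phase is normalised by c v = cnj e, which turns the constant of the
    limiting quotient into \<alpha>. The unit number \<sigma> with real part s then yields w1 + w2 =
    2 c s and w1 w2 = c^2.\<close>
  define c where "c = cnj v * cnj e"
  define \<sigma> where "\<sigma> = Complex s (sqrt (1 - s\<^sup>2))"
  have s2: "s\<^sup>2 \<le> 1" using s by (simp add: power_le_one)
  have \<sigma>: "cmod \<sigma> = 1" "\<sigma> + cnj \<sigma> = 2 * of_real s" "\<sigma> * cnj \<sigma> = 1"
  proof -
    show 1: "cmod \<sigma> = 1" using s2 by (simp add: \<sigma>_def complex_norm)
    show "\<sigma> + cnj \<sigma> = 2 * of_real s" by (simp add: \<sigma>_def complex_eq_iff)
    show "\<sigma> * cnj \<sigma> = 1" using 1 by (simp add: complex_norm_square[symmetric])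
  qed
  have c: "cmod c = 1" using e v by (simp add: c_def norm_mult)
  define w1 w2 v1 where "w1 = c * \<sigma>" and "w2 = c * cnj \<sigma>" and "v1 = - (c * cnj e)"
  have \<beta>': "cnj \<beta> = of_real s * cnj e" by (simp add: e(2))
  have sum: "w1 + w2 = 2 * c * of_real s"
  proof -
    have "w1 + w2 = c * (\<sigma> + cnj \<sigma>)" by (simp add: w1_def w2_def algebra_simps)
    then show ?thesis unfolding \<sigma> by simp
  qed
  have prod: "w1 * w2 = c * c"
  proof -
    have "w1 * w2 = c * c * (\<sigma> * cnj \<sigma>)" by (simp add: w1_def w2_def mult_ac)
    then show ?thesis unfolding \<sigma> by simp
  qed
  have den: "(w1 - v1 * x) * (\<Lambda> * w2 - 0 * y) + (w2 - v1 * x) * (\<Lambda> * w1 - 0 * y) = 2 * \<Lambda> * (c * c) * (1 + cnj \<beta> * x)" for x y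
  proof -
    have "(w1 - v1 * x) * (\<Lambda> * w2 - 0 * y) + (w2 - v1 * x) * (\<Lambda> * w1 - 0 * y) = \<Lambda> * (2 * (w1 * w2) - v1 * x * (w1 + w2))"
      by (simp add: algebra_simps)
    then show ?thesis unfolding sum prod v1_def \<beta>' by (simp add: algebra_simps)
  qed
  have num: "w1 + w2 - 2 * v1 * x = 2 * c * cnj e * (\<beta> + x)" for x
  proof -
    have key: "\<beta> * cnj e = of_real s" unfolding e(2) mult.assoc ee by simp
    have "2 * c * cnj e * (\<beta> + x) = 2 * c * (\<beta> * cnj e) + 2 * c * cnj e * x"
      by (simp add: algebra_simps)
    then show ?thesis unfolding key sum v1_def by simp
  qed
  show ?thesis
  proof (rule orbitally_unstable_merging_a[where ?w1.0 = w1 and ?w2.0 = w2 and ?v1.0 = v1 and ?b2.0 = 0 and ?X1.0 = X and ?X2.0 = X and \<Lambda> = \<Lambda>, OF r(1)])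
    show "(\<lambda>z. \<alpha> * B z) holomorphic_on ball 0 r" by (intro holomorphic_intros holB)
    show "cmod w1 = 1" "cmod w2 = 1" "cmod v1 = 1"
      using c \<sigma> e by (simp_all add: w1_def w2_def v1_def norm_mult)
    show "(w1 - v1 * X z) * (\<Lambda> * w2 - 0 * X z) + (w2 - v1 * X z) * (\<Lambda> * w1 - 0 * X z) \<noteq> 0" if "cmod z \<le> 1" for z
    proof -
      have "1 - (- cnj \<beta>) * X z \<noteq> 0" using X(1)[OF that] \<beta> by (intro one_minus_mult_nonzero) auto
      then show ?thesis unfolding den using \<Lambda> c by auto
    qed
    show "\<alpha> * B z = (\<Lambda>\<^sup>2 - (cmod 0)\<^sup>2) * (w1 + w2 - 2 * v1 * X z)
        / ((w1 - v1 * X z) * (\<Lambda> * w2 - 0 * X z) + (w2 - v1 * X z) * (\<Lambda> * w1 - 0 * X z))" if "cmod z < r" for z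
    proof -
      define d where "d = 1 - cnj \<beta> * B z"
      have d: "d \<noteq> 0" using r(3)[of z] that by (simp add: d_def)
      define g where "g = 1 - cnj \<beta> * \<beta>"
      have g: "g \<noteq> 0" unfolding g_def using \<beta> by (intro one_minus_mult_nonzero) auto
      have 1: "\<beta> + X z = g * B z / d" "1 + cnj \<beta> * X z = g / d"
      proof -
        have "\<beta> + X z = (\<beta> * d + (B z - \<beta>)) / d" "1 + cnj \<beta> * X z = (d + cnj \<beta> * (B z - \<beta>)) / d"
          using d unfolding X_def d_def[symmetric] by (simp_all add: add_divide_distrib)
        moreover have "\<beta> * d + (B z - \<beta>) = g * B z" "d + cnj \<beta> * (B z - \<beta>) = g"
          by (simp_all add: d_def g_def algebra_simps)
        ultimately show "\<beta> + X z = g * B z / d" "1 + cnj \<beta> * X z = g / d" by (simp_all only:)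
      qed
      have c0: "c \<noteq> 0" using c by auto
      have "cnj e = c * v" unfolding c_def using ee by (simp add: mult_ac)
      then have "(\<Lambda>\<^sup>2 - (cmod 0)\<^sup>2) * (2 * c * cnj e * (g * B z / d)) / (2 * \<Lambda> * (c * c) * (g / d)) = \<Lambda> * v * B z"
        using d g c0 \<Lambda> by (simp add: power2_eq_square field_simps)
      then show ?thesis unfolding den num 1 v(2)[symmetric] by simp
    qed
    show "cmod (\<alpha> * B 0) < \<Lambda> - (cmod 0)\<^sup>2 / \<Lambda>"
      using B0 \<Lambda> by (simp add: norm_mult \<Lambda>_def)
  qed (use holX X0 X \<Lambda> in auto)
qed

text \<open>N >= 1 enters through |B(0)|, the product of the |p_j|: a single factor below 1 places
  it strictly inside the disc.\<close>

lemma orbitally_unstable_blaschke: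
  fixes \<alpha> :: complex and N :: nat and p :: "nat \<Rightarrow> complex"
  assumes \<alpha>: "\<alpha> \<noteq> 0" and N: "N \<ge> 1" and p: "\<And>j. j < N \<Longrightarrow> cmod (p j) < 1"
  shows "orbitally_unstable (\<lambda>z. \<alpha> * (\<Prod>j<N. (z - cnj (p j)) / (1 - p j * z)))"
proof -
  have nz: "(\<Prod>j<N. 1 - p j * z) \<noteq> 0" if "cmod z \<le> 1" for z
    using one_minus_mult_nonzero[OF p _] that by auto
  have "(\<lambda>z. \<Prod>j<N. 1 - p j * z) holomorphic_on ball 0 2" "1 < (2::real)" by (auto intro!: holomorphic_intros)
  from nonzero_on_larger_ball[OF this nz] obtain r
    where r: "1 < r" "\<And>z. cmod z \<le> r \<Longrightarrow> (\<Prod>j<N. 1 - p j * z) \<noteq> 0"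
    by metis
  show ?thesis
  proof (rule orbitally_unstable_inner[OF \<alpha> r(1)])
    show "(\<lambda>z. \<Prod>j<N. (z - cnj (p j)) / (1 - p j * z)) holomorphic_on ball 0 r"
      using r(2) by (intro holomorphic_intros) (force dest: less_imp_le)
    show "cmod (\<Prod>j<N. (z - cnj (p j)) / (1 - p j * z)) \<le> 1" if "cmod z \<le> 1" for z
      unfolding prod_norm[symmetric] using blaschke_factor_norm(1)[OF p that] by (intro prod_le_1) auto
    show "cmod (\<Prod>j<N. (z - cnj (p j)) / (1 - p j * z)) = 1" if "cmod z = 1" for z
      unfolding prod_norm[symmetric] using blaschke_factor_norm(2)[OF p that] by (intro prod.neutral) auto
    have "cmod (\<Prod>j<N. (0 - cnj (p j)) / (1 - p j * 0)) = (\<Prod>j<N. cmod (p j))"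
      by (simp flip: prod_norm)
    also have "\<dots> = cmod (p 0) * (\<Prod>j\<in>{..<N} - {0}. cmod (p j))"
      using N by (intro prod.remove) auto
    also have "\<dots> \<le> cmod (p 0) * 1"
      using p by (intro mult_left_mono prod_le_1) (auto intro: less_imp_le)
    also have "\<dots> < 1" using p[of 0] N by simp
    finally show "cmod (\<Prod>j<N. (0 - cnj (p j)) / (1 - p j * 0)) < 1" .
  qed
qed

text \<open>Opposite phases w1 = 1, w2 = -1 cancel in the numerator and leave a multiple of z^l,
  while X1 X2 = z^N supplies the denominator. The value of \<Lambda> comes from \<Lambda>^2 - |b|^2
  = \<Lambda> |\<alpha>| with |b| = \<Lambda> |q|. Since l >= 1 the mean of \<phi> is 0, whereas the
  aligned solution has mean close to |\<alpha>|.\<close>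

lemma orbitally_unstable_power_quotient:
  fixes \<alpha> q :: complex and N l :: nat
  assumes \<alpha>: "\<alpha> \<noteq> 0" and q: "cmod q < 1" and l: "1 \<le> l" "l < N"
  shows "orbitally_unstable (\<lambda>z. \<alpha> * z ^ l / (1 - q * z ^ N))"
proof -
  have nz: "1 - q * z ^ N \<noteq> 0" if "cmod z \<le> 1" for z
    using that by (intro one_minus_mult_nonzero[OF q]) (simp add: norm_power power_le_one)
  have "(\<lambda>z. 1 - q * z ^ N) holomorphic_on ball 0 2" "1 < (2::real)" by (auto intro!: holomorphic_intros)
  from nonzero_on_larger_ball[OF this nz] obtain r
    where r: "1 < r" "\<And>z. cmod z \<le> r \<Longrightarrow> 1 - q * z ^ N \<noteq> 0"
    by metis
  define \<Lambda> where "\<Lambda> = cmod \<alpha> / (1 - (cmod q)\<^sup>2)"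
  have q2: "(cmod q)\<^sup>2 < 1" using q by (simp add: power_less_one_iff)
  have \<Lambda>: "\<Lambda> > 0" using \<alpha> q2 by (simp add: \<Lambda>_def)
  define v where "v = \<alpha> / of_real (cmod \<alpha>)"
  have v: "cmod v = 1" "v \<noteq> 0" using \<alpha> by (auto simp: v_def norm_divide)
  define b where "b = of_real \<Lambda> * q / v"
  have b: "cmod b = \<Lambda> * cmod q" using v \<Lambda> by (simp add: b_def norm_mult norm_divide)
  have zz: "z ^ l * z ^ (N - l) = z ^ N" for z :: complex
    using l by (simp flip: power_add)
  have den: "(1 - v * z ^ l) * (of_real \<Lambda> * - 1 - b * z ^ (N - l)) + (- 1 - v * z ^ l) * (of_real \<Lambda> * 1 - b * z ^ (N - l))
      = - 2 * \<Lambda> * (1 - q * z ^ N)" for z :: complex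
  proof -
    have "(1 - v * z ^ l) * (of_real \<Lambda> * - 1 - b * z ^ (N - l)) + (- 1 - v * z ^ l) * (of_real \<Lambda> * 1 - b * z ^ (N - l))
        = - 2 * \<Lambda> + 2 * (v * b) * (z ^ l * z ^ (N - l))"
      by (simp add: algebra_simps)
    also have "v * b = \<Lambda> * q" using v by (simp add: b_def)
    also have "- 2 * \<Lambda> + 2 * (\<Lambda> * q) * (z ^ l * z ^ (N - l)) = - 2 * \<Lambda> * (1 - q * z ^ N)"
      unfolding zz by (simp add: algebra_simps)
    finally show ?thesis .
  qed
  have \<Lambda>v: "of_real (\<Lambda>\<^sup>2 - (cmod b)\<^sup>2) * v = of_real \<Lambda> * \<alpha>"
  proof -
    have "\<Lambda>\<^sup>2 - (cmod b)\<^sup>2 = \<Lambda> * (\<Lambda> * (1 - (cmod q)\<^sup>2))" by (simp add: b power2_eq_square algebra_simps)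
    also have "\<Lambda> * (1 - (cmod q)\<^sup>2) = cmod \<alpha>" using q2 by (simp add: \<Lambda>_def)
    finally show ?thesis using \<alpha> by (simp add: v_def)
  qed
  show ?thesis
  proof (rule orbitally_unstable_merging_a[where ?w1.0 = 1 and ?w2.0 = "-1" and ?v1.0 = v and ?b2.0 = b
        and ?X1.0 = "\<lambda>z. z ^ l" and ?X2.0 = "\<lambda>z. z ^ (N - l)" and \<Lambda> = \<Lambda>, OF r(1)])
    show "(\<lambda>z. \<alpha> * z ^ l / (1 - q * z ^ N)) holomorphic_on ball 0 r"
      using r(2) by (intro holomorphic_intros) auto
    show "cmod b < \<Lambda>" using q \<Lambda> by (simp add: b)
    show "(1 - v * z ^ l) * (of_real \<Lambda> * - 1 - b * z ^ (N - l)) + (- 1 - v * z ^ l) * (of_real \<Lambda> * 1 - b * z ^ (N - l)) \<noteq> 0"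
      if "cmod z \<le> 1" for z
      unfolding den using nz[OF that] \<Lambda> by simp
    show "\<alpha> * z ^ l / (1 - q * z ^ N) = (\<Lambda>\<^sup>2 - (cmod b)\<^sup>2) * (1 + - 1 - 2 * v * z ^ l)
        / ((1 - v * z ^ l) * (of_real \<Lambda> * - 1 - b * z ^ (N - l)) + (- 1 - v * z ^ l) * (of_real \<Lambda> * 1 - b * z ^ (N - l)))" for z
    proof -
      have "(\<Lambda>\<^sup>2 - (cmod b)\<^sup>2) * (1 + - 1 - 2 * v * z ^ l) = - 2 * (of_real (\<Lambda>\<^sup>2 - (cmod b)\<^sup>2) * v) * z ^ l" by simp
      also have "\<dots> = - 2 * \<Lambda> * (\<alpha> * z ^ l)" unfolding \<Lambda>v by simp
      finally have e: "(\<Lambda>\<^sup>2 - (cmod b)\<^sup>2) * (1 + - 1 - 2 * v * z ^ l) = - 2 * \<Lambda> * (\<alpha> * z ^ l)" .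
      show ?thesis unfolding den e using \<Lambda> by simp
    qed
    have "(cmod b)\<^sup>2 < \<Lambda>\<^sup>2" using q \<Lambda> by (simp add: b power_mult_distrib q2)
    then show "cmod (\<alpha> * 0 ^ l / (1 - q * 0 ^ N)) < \<Lambda> - (cmod b)\<^sup>2 / \<Lambda>"
      using l \<Lambda> by (simp add: power_0_left) (simp add: field_simps power2_eq_square)
  qed (use l v \<Lambda> in \<open>auto simp: norm_power power_le_one intro!: holomorphic_intros\<close>)
qed

theorem theorem4:
  shows "(\<forall>(\<alpha>::complex) (N::nat) (p::nat \<Rightarrow> complex).
            \<alpha> \<noteq> 0 \<longrightarrow> N \<ge> 1 \<longrightarrow> (\<forall>j<N. cmod (p j) < 1) \<longrightarrow>
            orbitally_unstable (\<lambda>z. \<alpha> * (\<Prod>j<N. (z - cnj (p j)) / (1 - p j * z))))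
       \<and> (\<forall>(\<alpha>::complex) (N::nat) (l::nat) (p::complex).
            \<alpha> \<noteq> 0 \<longrightarrow> N \<ge> 2 \<longrightarrow> l \<le> N - 1 \<longrightarrow> 0 < cmod p \<longrightarrow> cmod p < 1 \<longrightarrow>
            orbitally_unstable (\<lambda>z. \<alpha> * z ^ l / (1 - p ^ N * z ^ N)))"
proof (intro conjI allI impI)
  fix \<alpha> :: complex and N :: nat and p :: "nat \<Rightarrow> complex"
  assume "\<alpha> \<noteq> 0" "N \<ge> 1" "\<forall>j<N. cmod (p j) < 1"
  then show "orbitally_unstable (\<lambda>z. \<alpha> * (\<Prod>j<N. (z - cnj (p j)) / (1 - p j * z)))"
    by (intro orbitally_unstable_blaschke) auto
next
  fix \<alpha> :: complex and N l :: nat and p :: complex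
  assume *: "\<alpha> \<noteq> 0" "N \<ge> 2" "l \<le> N - 1" "0 < cmod p" "cmod p < 1"
  then have q: "0 < cmod (p ^ N)" "cmod (p ^ N) < 1"
    by (auto simp: norm_power power_less_one_iff)
  show "orbitally_unstable (\<lambda>z. \<alpha> * z ^ l / (1 - p ^ N * z ^ N))"
  \<comment> \<open>For l = 0 the choice X1 = z^l would not vanish at the origin, and the mean value
    of \<phi> is already as large as alignment of \<open>a1\<close> and \<open>a2\<close> could make
    it; this case goes through the merging of \<open>b1\<close> and \<open>b2\<close>.\<close>
  proof (cases "l = 0")
    case True
    then show ?thesis using orbitally_unstable_merging_b[OF *(1) q *(2)] by simp
  next
    case False
    then show ?thesis using * q by (intro orbitally_unstable_power_quotient) auto
  qed
qed

end
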